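(* Let $M^n$ be a closed hypersurface immersed in $\mathbb{S}^{n+1}$. Then $M^n$ is Integral-Einstein (IE) if and only if for all $a\in\mathbb{S}^{n+1}$, $$\int_M\left(1-(n+1)\varphi_a^2-\psi_a^2\right)=\int_M(\rho-1)\left(1-\varphi_a^2-(n+1)\psi_a^2\right),$$ where $\rho-1=\frac{n^2H^2-S}{n(n-1)}$ and $\rho=\frac{R}{n(n-1)}$ is the normalized scalar curvature. In particular, the following special cases hold. (A) If $M^n$ is minimal, then $M^n$ is IE if and only if $$\int_M S\left(1-\varphi_a^2-(n+1)\psi_a^2\right)=0\quad\text{for all }a\in\mathbb{S}^{n+1}.$$ (B) If $M^n$ is minimal and $S>0$ is constant, then (for all $a\in\mathbb{S}^{n+1}$) $$\int_M\left(\mathrm{Ric}-\frac{R}{n}\mathbf{g}\right)(a^{\rm T},a^{\rm T})=S\left((n+2)\int_M\varphi_a^2-\mathrm{Vol}(M^n)\right).$$ In this case, $M^n$ is IE if and only if any one of the following holds (each is equivalent to IE): (i) $\int_M\varphi_a^2=\frac{1}{n+2}\mathrm{Vol}(M^n)$ for all $a\in\mathbb{S}^{n+1}$; (ii) $\int_M\psi_a^2=\frac{1}{n+2}\mathrm{Vol}(M^n)$ for all $a\in\mathbb{S}^{n+1}$; (iii) $\int_M\varphi_a^2=\int_M\psi_a^2$ for all $a\in\mathbb{S}^{n+1}$; (iv) $\int_M\varphi_a\psi_a f_3=0$ for all $a\in\mathbb{S}^{n+1}$, where $f_3=\mathrm{Tr}(A^3)=3\binom{n}{3}H_3$ and $H_3$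 is the third mean curvature.
   Context: Closed means compact without boundary. For an immersed hypersurface $x:M^n\to\mathbb{S}^{n+1}\subset\mathbb{R}^{n+2}$ with unit normal vector field $\nu$ (in $\mathbb{S}^{n+1}$), $A(X)=-\widetilde\nabla_X\nu$ is the shape operator ($\widetilde\nabla$ the Levi-Civita connection of $\mathbb{S}^{n+1}$), $H=\mathrm{Tr}(A)/n$ the mean curvature, $S=\|A\|^2$ the squared length of the second fundamental form; minimal means $H=0$; $\binom{n}{3}H_3$ is the third elementary symmetric polynomial of the principal curvatures. $\mathbf{g}$ is the induced metric, $\mathrm{Ric}$ and $R$ its Ricci tensor and scalar curvature. For $a\in\mathbb{S}^{n+1}$: $\varphi_a=\langle x,a\rangle$, $\psi_a=\langle\nu,a\rangle$, and $a^{\rm T}\in\Gamma(TM)$ is the tangent component of the constant vector $a$ along $M^n$. Integrals are with respect to the Riemannian volume of $\mathbf{g}$. Definition (IE). A compact submanifold $M^n$ ($n\ge3$) in $\mathbb{R}^N$ is Integral-Einstein (IE) if for every unit vector $a\in\mathbb{S}^{N-1}$, $\int_M\left(\mathrm{Ric}-\frac{R}{n}\mathbf{g}\right)(a^{\rm T},a^{\rm T})=0$. A hypersurface of $\mathbb{S}^{n+1}$ is regarded as a submanifold of $\mathbb{R}^{n+2}$. Wherever IE occurs, $n\ge 3$ as in this definition. *)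

theory Defs
  imports "HOL-Analysis.Analysis"
begin

section \<open>Smooth maps and smooth manifolds\<close>

text \<open>Only used on open sets, where \<^term>\<open>frechet_derivative f (at u)\<close> depends on \<open>f\<close> near \<open>u\<close> alone.\<close>

primrec Ck_on :: "nat \<Rightarrow> 'a::real_normed_vector set \<Rightarrow> ('a \<Rightarrow> 'b::real_normed_vector) \<Rightarrow> bool"
  where
    "Ck_on 0 U f \<longleftrightarrow> continuous_on U f"
  | "Ck_on (Suc k) U f \<longleftrightarrow>
       (\<forall>u\<in>U. f differentiable (at u)) \<and> (\<forall>v. Ck_on k U (\<lambda>u. frechet_derivative f (at u) v))"

definition smooth_on :: "'a::real_normed_vector set \<Rightarrow> ('a \<Rightarrow> 'b::real_normed_vector) \<Rightarrow> bool"
  where "smooth_on U f \<longleftrightarrow> (\<forall>k. Ck_on k U f)"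

text \<open>A local parametrization is a pair \<open>(U, \<phi>)\<close>: the inverse of a chart, together with the
  domain \<open>U\<close> of the coordinates. Values of \<open>\<phi>\<close> outside \<open>U\<close> are irrelevant.\<close>

type_synonym ('n, 'm) param = "(real ^ 'n) set \<times> (real ^ 'n \<Rightarrow> 'm)"

text \<open>The manifold is the set \<open>M\<close> with the subspace topology. All \<open>U\<close> are open in
  \<open>\<real>\<^sup>n\<close>, so \<open>M\<close> has no boundary. Second countability is automatic for compact \<open>M\<close>.\<close>

definition smooth_atlas :: "'m::t2_space set \<Rightarrow> ('n::finite, 'm) param set \<Rightarrow> bool"
  where "smooth_atlas M \<A> \<longleftrightarrow>
    (\<forall>(U, \<phi>)\<in>\<A>. open U \<and> openin (top_of_set M) (\<phi> ` U) \<and> (\<exists>\<phi>'. homeomorphism U (\<phi> ` U) \<phi> \<phi>')) \<and>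
    (\<Union>(U, \<phi>)\<in>\<A>. \<phi> ` U) = M \<and>
    (\<forall>(U, \<phi>)\<in>\<A>. \<forall>(V, \<theta>)\<in>\<A>. smooth_on (U \<inter> \<phi> -` (\<theta> ` V)) (inv_into V \<theta> \<circ> \<phi>))"

definition smooth_map :: "('n::finite, 'm) param set \<Rightarrow> ('m \<Rightarrow> 'v::real_normed_vector) \<Rightarrow> bool"
  where "smooth_map \<A> F \<longleftrightarrow> (\<forall>(U, \<phi>)\<in>\<A>. smooth_on U (F \<circ> \<phi>))"

definition immersion :: "('n::finite, 'm) param set \<Rightarrow> ('m \<Rightarrow> 'v::euclidean_space) \<Rightarrow> bool"
  where "immersion \<A> y \<longleftrightarrow> smooth_map \<A> y \<and>
    (\<forall>(U, \<phi>)\<in>\<A>. \<forall>u\<in>U. inj (frechet_derivative (y \<circ> \<phi>) (at u)))"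

section \<open>Riemannian geometry in coordinates\<close>

definition pd :: "'n::finite \<Rightarrow> (real ^ 'n \<Rightarrow> 'b::real_normed_vector) \<Rightarrow> real ^ 'n \<Rightarrow> 'b"
  where "pd i f u = frechet_derivative f (at u) (axis i 1)"

definition christoffel :: "(real ^ 'n \<Rightarrow> real ^ 'n ^ 'n) \<Rightarrow> 'n::finite \<Rightarrow> 'n \<Rightarrow> 'n \<Rightarrow> real ^ 'n \<Rightarrow> real"
  where "christoffel G k i j u = (1/2) * (\<Sum>l\<in>UNIV. matrix_inv (G u) $ k $ l *
     (pd i (\<lambda>v. G v $ j $ l) u + pd j (\<lambda>v. G v $ i $ l) u - pd l (\<lambda>v. G v $ i $ j) u))"

text \<open>\<open>riemann G l k i j\<close> is the component \<open>R\<^sup>l\<^bsub>kij\<^esub>\<close> with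
  \<open>R(\<partial>\<^sub>i, \<partial>\<^sub>j)\<partial>\<^sub>k = \<Sum>\<^sub>l R\<^sup>l\<^bsub>kij\<^esub> \<partial>\<^sub>l\<close> and
  \<open>R(X,Y) = \<nabla>\<^sub>X\<nabla>\<^sub>Y - \<nabla>\<^sub>Y\<nabla>\<^sub>X - \<nabla>\<^bsub>[X,Y]\<^esub>\<close>; \<open>Ric(Y,Z)\<close> is the trace of
  \<open>X \<mapsto> R(X,Y)Z\<close>, so that round spheres have positive Ricci curvature.\<close>

definition riemann :: "(real ^ 'n \<Rightarrow> real ^ 'n ^ 'n) \<Rightarrow> 'n::finite \<Rightarrow> 'n \<Rightarrow> 'n \<Rightarrow> 'n \<Rightarrow> real ^ 'n \<Rightarrow> real"
  where "riemann G l k i j u =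
     pd i (christoffel G l j k) u - pd j (christoffel G l i k) u +
     (\<Sum>m\<in>UNIV. christoffel G l i m u * christoffel G m j k u
              - christoffel G l j m u * christoffel G m i k u)"

definition ricci :: "(real ^ 'n \<Rightarrow> real ^ 'n ^ 'n) \<Rightarrow> real ^ 'n \<Rightarrow> real ^ 'n ^ 'n::finite"
  where "ricci G u = (\<chi> j k. \<Sum>i\<in>UNIV. riemann G i k i j u)"

definition scalar_curv :: "(real ^ 'n \<Rightarrow> real ^ 'n ^ 'n) \<Rightarrow> real ^ 'n::finite \<Rightarrow> real"
  where "scalar_curv G u = (\<Sum>j\<in>UNIV. \<Sum>k\<in>UNIV. matrix_inv (G u) $ j $ k * ricci G u $ j $ k)"

definition induced_metric :: "(real ^ 'n \<Rightarrow> 'v::euclidean_space) \<Rightarrow> real ^ 'n \<Rightarrow> real ^ 'n ^ 'n::finite"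
  where "induced_metric f u = (\<chi> i j. pd i f u \<bullet> pd j f u)"

text \<open>Coordinates \<open>X\<close> of the tangent component of \<open>a\<close>: \<open>a - df\<^sub>u X\<close> is normal to the immersion.\<close>

definition tangent_comp :: "(real ^ 'n \<Rightarrow> 'v::euclidean_space) \<Rightarrow> real ^ 'n \<Rightarrow> 'v \<Rightarrow> real ^ 'n::finite"
  where "tangent_comp f u a =
    (THE X. \<forall>Y. (a - frechet_derivative f (at u) X) \<bullet> frechet_derivative f (at u) Y = 0)"

text \<open>For \<open>f\<close> with values in the unit sphere and \<open>N\<close> tangent to the sphere along \<open>f\<close>: the
  Levi-Civita derivative \<open>\<nabla>\<^sub>X N\<close> of the sphere, i.e. the part of the flat derivative tangent to
  the sphere.\<close>

definition sphere_deriv :: "(real ^ 'n \<Rightarrow> 'v::euclidean_space) \<Rightarrow> (real ^ 'n \<Rightarrow> 'v) \<Rightarrow>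
    real ^ 'n \<Rightarrow> real ^ 'n::finite \<Rightarrow> 'v"
  where "sphere_deriv f N u X = frechet_derivative N (at u) X
           - (frechet_derivative N (at u) X \<bullet> f u) *\<^sub>R f u"

definition shape_op :: "(real ^ 'n \<Rightarrow> 'v::euclidean_space) \<Rightarrow> (real ^ 'n \<Rightarrow> 'v) \<Rightarrow>
    real ^ 'n \<Rightarrow> real ^ 'n \<Rightarrow> real ^ 'n::finite"
  where "shape_op f N u X = (THE Y. frechet_derivative f (at u) Y = - sphere_deriv f N u X)"

definition second_ff :: "(real ^ 'n \<Rightarrow> 'v::euclidean_space) \<Rightarrow> (real ^ 'n \<Rightarrow> 'v) \<Rightarrow>
    real ^ 'n \<Rightarrow> 'n \<Rightarrow> 'n::finite \<Rightarrow> real"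
  where "second_ff f N u i j =
    frechet_derivative f (at u) (shape_op f N u (axis i 1)) \<bullet> frechet_derivative f (at u) (axis j 1)"

section \<open>Functions on the manifold\<close>

text \<open>Pointwise quantities at \<open>p\<close> are evaluated in some parametrization around \<open>p\<close>; they are
  tensorial, so the choice does not matter.\<close>

definition param_at :: "('n::finite, 'm) param set \<Rightarrow> 'm \<Rightarrow> ('n, 'm) param"
  where "param_at \<A> p = (SOME c. c \<in> \<A> \<and> p \<in> snd c ` fst c)"

definition coord_at :: "('n::finite, 'm) param set \<Rightarrow> 'm \<Rightarrow> real ^ 'n"
  where "coord_at \<A> p = inv_into (fst (param_at \<A> p)) (snd (param_at \<A> p)) p"

definition local_rep :: "('n::finite, 'm) param set \<Rightarrow> ('m \<Rightarrow> 'b) \<Rightarrow> 'm \<Rightarrow> real ^ 'n \<Rightarrow> 'b"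
  where "local_rep \<A> F p = F \<circ> snd (param_at \<A> p)"

definition scalar_curvature :: "('n::finite, 'm) param set \<Rightarrow> ('m \<Rightarrow> 'v::euclidean_space) \<Rightarrow> 'm \<Rightarrow> real"
  where "scalar_curvature \<A> y p = scalar_curv (induced_metric (local_rep \<A> y p)) (coord_at \<A> p)"

definition normalized_scalar_curvature ::
    "('n::finite, 'm) param set \<Rightarrow> ('m \<Rightarrow> 'v::euclidean_space) \<Rightarrow> 'm \<Rightarrow> real"
  where "normalized_scalar_curvature \<A> y p =
    scalar_curvature \<A> y p / (real CARD('n) * (real CARD('n) - 1))"

text \<open>\<open>(Ric - (R/n) g)(a\<^sup>T, a\<^sup>T)\<close> at the point \<open>p\<close>.\<close>

definition traceless_ricci_tangent ::
    "('n::finite, 'm) param set \<Rightarrow> ('m \<Rightarrow> 'v::euclidean_space) \<Rightarrow> 'v \<Rightarrow> 'm \<Rightarrow> real"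
  where "traceless_ricci_tangent \<A> y a p =
    (let G = induced_metric (local_rep \<A> y p); u = coord_at \<A> p;
         X = tangent_comp (local_rep \<A> y p) u a
     in X \<bullet> ((ricci G u - (scalar_curvature \<A> y p / real CARD('n)) *\<^sub>R G u) *v X))"

definition mean_curvature ::
    "('n::finite, 'm) param set \<Rightarrow> ('m \<Rightarrow> 'v::euclidean_space) \<Rightarrow> ('m \<Rightarrow> 'v) \<Rightarrow> 'm \<Rightarrow> real"
  where "mean_curvature \<A> x \<nu> p =
    trace (matrix (shape_op (local_rep \<A> x p) (local_rep \<A> \<nu> p) (coord_at \<A> p))) / real CARD('n)"

text \<open>\<open>S = \<parallel>A\<parallel>\<^sup>2 = \<Sum> g\<^bsup>ik\<^esup> g\<^bsup>jl\<^esup> h\<^bsub>ij\<^esub> h\<^bsub>kl\<^esub>\<close>.\<close>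

definition second_ff_sq ::
    "('n::finite, 'm) param set \<Rightarrow> ('m \<Rightarrow> 'v::euclidean_space) \<Rightarrow> ('m \<Rightarrow> 'v) \<Rightarrow> 'm \<Rightarrow> real"
  where "second_ff_sq \<A> x \<nu> p =
    (let f = local_rep \<A> x p; N = local_rep \<A> \<nu> p; u = coord_at \<A> p;
         Ginv = matrix_inv (induced_metric f u)
     in \<Sum>i\<in>UNIV. \<Sum>j\<in>UNIV. \<Sum>k\<in>UNIV. \<Sum>l\<in>UNIV.
          Ginv $ i $ k * Ginv $ j $ l * second_ff f N u i j * second_ff f N u k l)"

definition trace_A3 ::
    "('n::finite, 'm) param set \<Rightarrow> ('m \<Rightarrow> 'v::euclidean_space) \<Rightarrow> ('m \<Rightarrow> 'v) \<Rightarrow> 'm \<Rightarrow> real"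
  where "trace_A3 \<A> x \<nu> p =
    (let A = matrix (shape_op (local_rep \<A> x p) (local_rep \<A> \<nu> p) (coord_at \<A> p))
     in trace (A ** A ** A))"

text \<open>Eigenvalues of the shape operator with multiplicity, from an orthonormal basis of principal
  directions; unique up to reordering.\<close>

definition principal_curvatures ::
    "('n::finite, 'm) param set \<Rightarrow> ('m \<Rightarrow> 'v::euclidean_space) \<Rightarrow> ('m \<Rightarrow> 'v) \<Rightarrow> 'm \<Rightarrow> 'n \<Rightarrow> real"
  where "principal_curvatures \<A> x \<nu> p =
    (let f = local_rep \<A> x p; N = local_rep \<A> \<nu> p; u = coord_at \<A> p
     in SOME \<kappa>. \<exists>E :: 'n \<Rightarrow> real ^ 'n.
          (\<forall>i j. frechet_derivative f (at u) (E i) \<bullet> frechet_derivative f (at u) (E j)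
                 = (if i = j then 1 else 0)) \<and>
          (\<forall>i. shape_op f N u (E i) = \<kappa> i *\<^sub>R E i))"

definition third_mean_curvature ::
    "('n::finite, 'm) param set \<Rightarrow> ('m \<Rightarrow> 'v::euclidean_space) \<Rightarrow> ('m \<Rightarrow> 'v) \<Rightarrow> 'm \<Rightarrow> real"
  where "third_mean_curvature \<A> x \<nu> p =
    (\<Sum>I | I \<subseteq> (UNIV :: 'n set) \<and> card I = 3. \<Prod>i\<in>I. principal_curvatures \<A> x \<nu> p i)
      / real (CARD('n) choose 3)"

section \<open>Volume, closed hypersurfaces of the sphere, Integral-Einstein submanifolds\<close>

text \<open>The Borel measure on \<open>M\<close> that equals \<open>\<integral>\<^sub>B \<surd>(det g) du\<close> on \<open>\<phi>(B)\<close>, for every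
  parametrization \<open>(U, \<phi>)\<close> and every Borel set \<open>B \<subseteq> U\<close>.\<close>

definition riemannian_volume ::
    "'m set \<Rightarrow> ('n::finite, 'm) param set \<Rightarrow> ('m \<Rightarrow> 'v::euclidean_space) \<Rightarrow> 'm measure"
  where "riemannian_volume M \<A> y =
    extend_measure M {(c, B). c \<in> \<A> \<and> B \<in> sets borel \<and> B \<subseteq> fst c}
      (\<lambda>(c, B). snd c ` B)
      (\<lambda>(c, B). \<integral>\<^sup>+u\<in>B. ennreal (sqrt (det (induced_metric (y \<circ> snd c) u))) \<partial>lborel)"

text \<open>A closed hypersurface \<open>x : M \<rightarrow> S\<^bsup>n+1\<^esup>\<close> together with its unit normal field \<open>\<nu>\<close>.
  Immersed, not necessarily embedded; connectedness is not required.\<close>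

definition closed_immersed_hypersurface ::
    "'m::t2_space set \<Rightarrow> ('n::finite, 'm) param set \<Rightarrow> ('m \<Rightarrow> 'v::euclidean_space) \<Rightarrow> ('m \<Rightarrow> 'v) \<Rightarrow> bool"
  where "closed_immersed_hypersurface M \<A> x \<nu> \<longleftrightarrow>
    DIM('v) = CARD('n) + 2 \<and>
    compact M \<and> smooth_atlas M \<A> \<and>
    immersion \<A> x \<and> x ` M \<subseteq> sphere 0 1 \<and>
    smooth_map \<A> \<nu> \<and> \<nu> ` M \<subseteq> sphere 0 1 \<and> (\<forall>p\<in>M. \<nu> p \<bullet> x p = 0) \<and>
    (\<forall>(U, \<phi>)\<in>\<A>. \<forall>u\<in>U. \<forall>X. \<nu> (\<phi> u) \<bullet> frechet_derivative (x \<circ> \<phi>) (at u) X = 0)"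

definition minimal_hypersurface ::
    "'m set \<Rightarrow> ('n::finite, 'm) param set \<Rightarrow> ('m \<Rightarrow> 'v::euclidean_space) \<Rightarrow> ('m \<Rightarrow> 'v) \<Rightarrow> bool"
  where "minimal_hypersurface M \<A> x \<nu> \<longleftrightarrow> (\<forall>p\<in>M. mean_curvature \<A> x \<nu> p = 0)"

text \<open>For a compact immersed submanifold \<open>y : M\<^sup>n \<rightarrow> \<real>\<^sup>N\<close> with \<open>n \<ge> 3\<close>.\<close>

definition integral_einstein ::
    "'m set \<Rightarrow> ('n::finite, 'm) param set \<Rightarrow> ('m \<Rightarrow> 'v::euclidean_space) \<Rightarrow> bool"
  where "integral_einstein M \<A> y \<longleftrightarrow>
    (\<forall>a\<in>sphere 0 1. (\<integral>p. traceless_ricci_tangent \<A> y a p \<partial>riemannian_volume M \<A> y) = 0)"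

end

theory Submission
  imports Defs
begin

text \<open>
  On a hypersurface of the unit sphere \<open>a\<^sup>T = \<nabla>\<phi>\<^sub>a\<close>, \<open>\<nabla>\<psi>\<^sub>a = - A a\<^sup>T\<close>,
  \<open>\<nabla>\<^sub>X a\<^sup>T = - \<phi>\<^sub>a X + \<psi>\<^sub>a A X\<close> and \<open>|a\<^sup>T|\<^sup>2 = 1 - \<phi>\<^sub>a\<^sup>2 - \<psi>\<^sub>a\<^sup>2\<close>. The Gauss equation turns
  the integrand of the IE condition into a combination of \<open>|a\<^sup>T|\<^sup>2\<close> and
  \<open>nH\<langle>A a\<^sup>T, a\<^sup>T\<rangle> - |A a\<^sup>T|\<^sup>2\<close>. By the Codazzi equation \<open>nH I - A\<close> is divergence free, so the
  divergence theorem for \<open>\<phi>\<^sub>a a\<^sup>T\<close> and \<open>\<psi>\<^sub>a (nH I - A) a\<^sup>T\<close> expresses the integral of the latter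
  through \<open>\<phi>\<^sub>a\<close>, \<open>\<psi>\<^sub>a\<close>, \<open>S\<close> and \<open>H\<close>. If \<open>H = 0\<close> and \<open>S\<close> is constant, \<open>A\<^sup>2\<close> is divergence free as well,
  and the field \<open>\<phi>\<^sub>a A\<^sup>2 a\<^sup>T\<close> relates \<open>\<integral> \<phi>\<^sub>a \<psi>\<^sub>a f\<^sub>3\<close> to \<open>\<integral> (\<phi>\<^sub>a\<^sup>2 - \<psi>\<^sub>a\<^sup>2)\<close>.
  In a chart everything is computed in the ambient space with the frame \<open>e\<^sub>i = \<partial>\<^sub>i x\<close> and its dual
  frame \<open>E\<^sup>i\<close>, for which \<open>div W = \<Sum>\<^sub>j E\<^sup>j \<bullet> \<partial>\<^sub>j W\<close> for every tangent field \<open>W\<close>.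
\<close>

text \<open>Because all fields are ambient-valued, no connection on M has to be developed:
  Christoffel symbols are products of the dual frame with second derivatives of x, Codazzi becomes
  symmetry of the second derivatives of \<nu>, and the Gauss equation is an expansion in the frame
  completed by x and \<nu>. The derivative of \<nu> is minus the shape operator, so traces of odd
  degree carry a sign: -nH and -f_3 occur, while S is unchanged. The divergence theorem is proved
  for fields of class C^1, where squares of positive parts serve as cutoffs and the divergence times
  the volume density is a coordinate divergence of compact support. In the general criterion the
  field built from \<psi>_a enters with weight 1 and \<phi>_a a^T with weight n - 1; this is the
  weight for which the terms in H \<phi>_a \<psi>_a cancel. In case (B) only Vol, I =
  \<integral>\<phi>_a^2 and J = \<integral>\<psi>_a^2 remain, tied by Vol = (n+1) I + J. Hence I = J
  exactly when either equals Vol/(n+2), which is the origin of n + 2.\<close>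

lemma frechet_eqI: "(f has_derivative f') (at u) \<Longrightarrow> frechet_derivative f (at u) = f'"
  using frechet_derivative_at by metis

lemma frechet_works: "f differentiable (at u) \<Longrightarrow> (f has_derivative frechet_derivative f (at u)) (at u)"
  using frechet_derivative_works by blast

lemma frechet_cong_open:
  assumes "open U" "u \<in> U" "\<And>w. w \<in> U \<Longrightarrow> f w = g w"
  shows "frechet_derivative f (at u) = frechet_derivative g (at u)"
    and "f differentiable (at u) \<longleftrightarrow> g differentiable (at u)"
proof -
  have *: "(f has_derivative D) (at u) \<longleftrightarrow> (g has_derivative D) (at u)" for D
    using has_derivative_transform_within_open[OF _ assms(1,2)] assms(3) by metis
  show "frechet_derivative f (at u) = frechet_derivative g (at u)"
    by (simp add: frechet_derivative_def *)
  show "f differentiable (at u) \<longleftrightarrow> g differentiable (at u)"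
    by (simp add: differentiable_def *)
qed

section \<open>Functions of class \<open>C\<^sup>k\<close>\<close>

lemma Ck_on_cong:
  assumes "open U" "\<And>u. u \<in> U \<Longrightarrow> f u = g u"
  shows "Ck_on k U f \<longleftrightarrow> Ck_on k U g"
  using assms(2)
proof (induction k arbitrary: f g)
  case 0
  then show ?case by (auto intro: continuous_on_cong)
next
  case (Suc k)
  have "Ck_on k U (\<lambda>u. frechet_derivative f (at u) v) \<longleftrightarrow> Ck_on k U (\<lambda>u. frechet_derivative g (at u) v)" for v
    by (rule Suc.IH) (simp add: frechet_cong_open(1)[OF assms(1) _ Suc.prems])
  moreover have "f differentiable (at u) \<longleftrightarrow> g differentiable (at u)" if "u \<in> U" for u
    by (rule frechet_cong_open(2)[OF assms(1) that Suc.prems])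
  ultimately show ?case by auto
qed

text \<open>Gluing on two open pieces is how functions extended by zero are shown to be regular
  across the edge of their support.\<close>

lemma Ck_on_Un:
  assumes "open U" "open V"
  shows "Ck_on k U f \<Longrightarrow> Ck_on k V f \<Longrightarrow> Ck_on k (U \<union> V) f"
  by (induction k arbitrary: f) (auto intro: continuous_on_open_Un assms)

lemma Ck_on_SucD: "Ck_on (Suc k) U f \<Longrightarrow> Ck_on k U f"
proof (induction k arbitrary: f)
  case 0
  then show ?case
    by (auto intro!: continuous_at_imp_continuous_on differentiable_imp_continuous_within)
next
  case (Suc k)
  then show ?case by (metis Ck_on.simps(2))
qed

lemma Ck_on_le: "Ck_on k U f \<Longrightarrow> j \<le> k \<Longrightarrow> Ck_on j U f"
  by (induction k) (auto simp: le_Suc_eq dest: Ck_on_SucD simp del: Ck_on.simps)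

lemma Ck_on_imp_continuous_on: "Ck_on k U f \<Longrightarrow> continuous_on U f"
  using Ck_on_le[of k U f 0] by simp

lemma Ck_on_const [simp]: "Ck_on k U (\<lambda>_. c)"
  by (induction k arbitrary: c) auto

lemma Ck_on_linear:
  assumes L: "bounded_linear L" and U: "open U"
  shows "Ck_on k U f \<Longrightarrow> Ck_on k U (\<lambda>u. L (f u))"
proof (induction k arbitrary: f)
  case 0
  then show ?case by (auto intro: bounded_linear.continuous_on[OF L])
next
  case (Suc k)
  have d: "((\<lambda>u. L (f u)) has_derivative (\<lambda>v. L (frechet_derivative f (at u) v))) (at u)" if "u \<in> U" for u
    using that Suc.prems by (intro bounded_linear.has_derivative[OF L] frechet_works) auto
  have "Ck_on k U (\<lambda>u. frechet_derivative (\<lambda>u. L (f u)) (at u) v)" for v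
    by (subst Ck_on_cong[OF U, where g="\<lambda>u. L (frechet_derivative f (at u) v)"])
       (use Suc frechet_eqI[OF d] in auto)
  with d show ?case by (auto simp: differentiable_def)
qed

lemma Ck_on_add:
  assumes U: "open U"
  shows "Ck_on k U f \<Longrightarrow> Ck_on k U g \<Longrightarrow> Ck_on k U (\<lambda>u. f u + g u)"
proof (induction k arbitrary: f g)
  case 0
  then show ?case by (auto intro: continuous_intros)
next
  case (Suc k)
  have d: "((\<lambda>u. f u + g u) has_derivative (\<lambda>v. frechet_derivative f (at u) v + frechet_derivative g (at u) v)) (at u)" if "u \<in> U" for u
    using that Suc.prems by (intro has_derivative_add frechet_works) auto
  have "Ck_on k U (\<lambda>u. frechet_derivative (\<lambda>u. f u + g u) (at u) v)" for v
    by (subst Ck_on_cong[OF U, where g="\<lambda>u. frechet_derivative f (at u) v + frechet_derivative g (at u) v"])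
       (use Suc frechet_eqI[OF d] in auto)
  with d show ?case by (auto simp: differentiable_def)
qed

text \<open>One Leibniz induction for inner products, scalings and products alike. The product rule
  returns undifferentiated factors, so the induction step also uses their regularity one order
  lower.\<close>

lemma Ck_on_bilinear:
  assumes B: "bounded_bilinear B" and U: "open U"
  shows "Ck_on k U f \<Longrightarrow> Ck_on k U g \<Longrightarrow> Ck_on k U (\<lambda>u. B (f u) (g u))"
proof (induction k arbitrary: f g)
  case 0
  then show ?case by (auto intro: bounded_bilinear.continuous_on[OF B])
next
  case (Suc k)
  have d: "((\<lambda>u. B (f u) (g u)) has_derivative (\<lambda>v. B (f u) (frechet_derivative g (at u) v) + B (frechet_derivative f (at u) v) (g u))) (at u)" if "u \<in> U" for u
    using that Suc.prems by (intro bounded_bilinear.FDERIV[OF B] frechet_works) auto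
  have "Ck_on k U f" "Ck_on k U g"
    using Suc.prems Ck_on_SucD by blast+
  then have "Ck_on k U (\<lambda>u. frechet_derivative (\<lambda>u. B (f u) (g u)) (at u) v)" for v
    by (subst Ck_on_cong[OF U, where g="\<lambda>u. B (f u) (frechet_derivative g (at u) v) + B (frechet_derivative f (at u) v) (g u)"])
       (use Suc.IH Suc.prems frechet_eqI[OF d] in \<open>auto intro: Ck_on_add[OF U]\<close>)
  with d show ?case by (auto simp: differentiable_def)
qed

lemmas Ck_on_inner = Ck_on_bilinear[OF bounded_bilinear_inner]
  and Ck_on_scaleR = Ck_on_bilinear[OF bounded_bilinear_scaleR]
  and Ck_on_mult = Ck_on_bilinear[OF bounded_bilinear_mult]

lemma Ck_on_uminus: "open U \<Longrightarrow> Ck_on k U f \<Longrightarrow> Ck_on k U (\<lambda>u. - f u)"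
  by (rule Ck_on_linear[OF bounded_linear_minus[OF bounded_linear_ident]])

lemma Ck_on_diff: "open U \<Longrightarrow> Ck_on k U f \<Longrightarrow> Ck_on k U g \<Longrightarrow> Ck_on k U (\<lambda>u. f u - g u)"
  using Ck_on_add[of U k f "\<lambda>u. - g u"] Ck_on_uminus[of U k g] by simp

lemma Ck_on_sum:
  assumes "open U" "\<And>i. i \<in> I \<Longrightarrow> Ck_on k U (f i)"
  shows "Ck_on k U (\<lambda>u. \<Sum>i\<in>I. f i u)"
  using assms(2) by (induction I rule: infinite_finite_induct) (auto intro: Ck_on_add[OF assms(1)])

lemma Ck_on_prod:
  fixes f :: "'i \<Rightarrow> 'a::real_normed_vector \<Rightarrow> real"
  assumes "open U" "\<And>i. i \<in> I \<Longrightarrow> Ck_on k U (f i)"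
  shows "Ck_on k U (\<lambda>u. \<Prod>i\<in>I. f i u)"
  using assms(2) by (induction I rule: infinite_finite_induct) (auto intro: Ck_on_mult[OF assms(1)])

text \<open>The derivative of a reciprocal is a polynomial in the reciprocal and the derivative of
  \<open>f\<close>, so order k of the reciprocal feeds order k + 1. The square root below bootstraps
  in the same way.\<close>

lemma Ck_on_inverse:
  fixes f :: "'a::real_normed_vector \<Rightarrow> real"
  assumes U: "open U" and nz: "\<And>u. u \<in> U \<Longrightarrow> f u \<noteq> 0"
  shows "Ck_on k U f \<Longrightarrow> Ck_on k U (\<lambda>u. inverse (f u))"
proof (induction k)
  case 0
  then show ?case using nz by (auto intro: continuous_intros)
next
  case (Suc k)
  have d: "((\<lambda>u. inverse (f u)) has_derivative (\<lambda>v. - (inverse (f u) * frechet_derivative f (at u) v * inverse (f u)))) (at u)" if "u \<in> U" for u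
    using that Suc.prems nz by (intro Deriv.has_derivative_inverse frechet_works) auto
  have "Ck_on k U (\<lambda>u. inverse (f u))"
    using Suc Ck_on_SucD by blast
  then have "Ck_on k U (\<lambda>u. frechet_derivative (\<lambda>u. inverse (f u)) (at u) v)" for v
    by (subst Ck_on_cong[OF U, where g="\<lambda>u. - (inverse (f u) * frechet_derivative f (at u) v * inverse (f u))"])
       (use Suc.prems frechet_eqI[OF d] in \<open>auto intro!: Ck_on_mult Ck_on_uminus U\<close>)
  with d show ?case by (auto simp: differentiable_def)
qed

lemma Ck_on_divide:
  fixes f :: "'a::real_normed_vector \<Rightarrow> real"
  assumes "open U" "\<And>u. u \<in> U \<Longrightarrow> g u \<noteq> 0" "Ck_on k U f" "Ck_on k U g"
  shows "Ck_on k U (\<lambda>u. f u / g u)"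
  using assms by (simp add: divide_inverse Ck_on_mult Ck_on_inverse)

lemma Ck_on_sqrt:
  fixes f :: "'a::real_normed_vector \<Rightarrow> real"
  assumes U: "open U" and pos: "\<And>u. u \<in> U \<Longrightarrow> f u > 0"
  shows "Ck_on k U f \<Longrightarrow> Ck_on k U (\<lambda>u. sqrt (f u))"
proof (induction k)
  case 0
  then show ?case by (auto intro: continuous_intros)
next
  case (Suc k)
  have d: "((\<lambda>u. sqrt (f u)) has_derivative (\<lambda>v. frechet_derivative f (at u) v * inverse (2 * sqrt (f u)))) (at u)" if "u \<in> U" for u
    using that Suc.prems pos[OF that]
    by (auto intro!: derivative_eq_intros frechet_works simp: field_simps)
  have "Ck_on k U (\<lambda>u. sqrt (f u))"
    using Suc Ck_on_SucD by blast
  then have "Ck_on k U (\<lambda>u. inverse (2 * sqrt (f u)))"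
    by (intro Ck_on_inverse[OF U] Ck_on_mult[OF U]) (use pos in \<open>auto simp: less_imp_neq[symmetric]\<close>)
  then have "Ck_on k U (\<lambda>u. frechet_derivative (\<lambda>u. sqrt (f u)) (at u) v)" for v
    by (subst Ck_on_cong[OF U, where g="\<lambda>u. frechet_derivative f (at u) v * inverse (2 * sqrt (f u))"])
       (use frechet_eqI[OF d] in simp, intro Ck_on_mult[OF U], use Suc.prems in simp_all)
  with d show ?case by (auto simp: differentiable_def)
qed

lemma Ck_on_pd: "Ck_on (Suc k) U f \<Longrightarrow> Ck_on k U (pd i f)"
  by (simp add: pd_def[abs_def])

lemma Ck_on_differentiable: "Ck_on k U f \<Longrightarrow> 0 < k \<Longrightarrow> u \<in> U \<Longrightarrow> f differentiable (at u)"
  by (cases k) auto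

section \<open>Partial derivatives\<close>

lemma pd_cong_open:
  assumes "open U" "u \<in> U" "\<And>w. w \<in> U \<Longrightarrow> f w = g w"
  shows "pd i f u = pd i g u"
  unfolding pd_def using frechet_cong_open(1)[OF assms] by simp

lemma pd_const [simp]: "pd i (\<lambda>_. c) u = 0"
  by (simp add: pd_def)

lemma pd_diff: "f differentiable (at u) \<Longrightarrow> g differentiable (at u) \<Longrightarrow>
    pd i (\<lambda>u. f u - g u) u = pd i f u - pd i g u"
  unfolding pd_def by (subst frechet_eqI[OF has_derivative_diff[OF frechet_works frechet_works]]) auto

lemma pd_bilinear:
  assumes "bounded_bilinear B" "f differentiable (at u)" "g differentiable (at u)"
  shows "pd i (\<lambda>u. B (f u) (g u)) u = B (f u) (pd i g u) + B (pd i f u) (g u)"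
  unfolding pd_def
  by (subst frechet_eqI[OF bounded_bilinear.FDERIV[OF assms(1) frechet_works frechet_works]]) (use assms in auto)

lemmas pd_inner = pd_bilinear[OF bounded_bilinear_inner]
  and pd_scaleR = pd_bilinear[OF bounded_bilinear_scaleR]
  and pd_mult = pd_bilinear[OF bounded_bilinear_mult]

lemma pd_sum:
  assumes "\<And>i. i \<in> I \<Longrightarrow> f i differentiable (at u)"
  shows "pd j (\<lambda>u. \<Sum>i\<in>I. f i u) u = (\<Sum>i\<in>I. pd j (f i) u)"
  unfolding pd_def
  by (subst frechet_eqI[OF has_derivative_sum[OF frechet_works]]) (use assms in auto)

lemma differentiable_inner' [intro]:
  "f differentiable (at u) \<Longrightarrow> g differentiable (at u) \<Longrightarrow> (\<lambda>u. f u \<bullet> g u) differentiable (at u)"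
  unfolding differentiable_def using has_derivative_inner by blast

lemma differentiable_scaleR' [intro]:
  "f differentiable (at u) \<Longrightarrow> g differentiable (at u) \<Longrightarrow> (\<lambda>u. f u *\<^sub>R g u) differentiable (at u)"
  unfolding differentiable_def using has_derivative_scaleR by blast

lemma differentiable_sum' [intro]:
  assumes "\<And>i. i \<in> I \<Longrightarrow> f i differentiable (at u)"
  shows "(\<lambda>u. \<Sum>i\<in>I. f i u) differentiable (at u)"
  using assms by (induction I rule: infinite_finite_induct) (auto intro: differentiable_add)

lemma frechet_derivative_eq_sum_pd:
  assumes "f differentiable (at u)"
  shows "frechet_derivative f (at u) X = (\<Sum>i\<in>UNIV. X $ i *\<^sub>R pd i f u)"
proof -
  interpret linear "frechet_derivative f (at u)" using assms by (rule linear_frechet_derivative)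
  have "X = (\<Sum>i\<in>UNIV. X $ i *\<^sub>R axis i 1)"
    using basis_expansion[of X] by (simp add: scalar_mult_eq_scaleR)
  then have "frechet_derivative f (at u) X = frechet_derivative f (at u) (\<Sum>i\<in>UNIV. X $ i *\<^sub>R axis i 1)"
    by simp
  then show ?thesis by (simp add: sum scale pd_def)
qed

section \<open>Symmetry of mixed second derivatives\<close>

lemma has_real_derivative_line:
  fixes g :: "'a::real_normed_vector \<Rightarrow> real"
  assumes "g differentiable (at (c + s *\<^sub>R v))"
  shows "((\<lambda>s. g (c + s *\<^sub>R v)) has_real_derivative frechet_derivative g (at (c + s *\<^sub>R v)) v) (at s)"
proof -
  have l: "linear (frechet_derivative g (at (c + s *\<^sub>R v)))"
    using assms by (rule linear_frechet_derivative)
  have "((\<lambda>s. c + s *\<^sub>R v) has_derivative (\<lambda>t. t *\<^sub>R v)) (at s)"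
    by (auto intro!: derivative_eq_intros)
  from has_derivative_compose[OF this frechet_works[OF assms]]
  show ?thesis
    unfolding has_field_derivative_def by (simp add: linear_scale[OF l] mult_commute_abs)
qed

text \<open>Both mixed derivatives are limits of the same second difference quotient; this is the
  mean value theorem applied twice to it.\<close>

lemma second_difference_mean_value:
  fixes f :: "'a::real_normed_vector \<Rightarrow> real"
  assumes h: "h > 0"
    and diff: "\<And>s t. 0 \<le> s \<Longrightarrow> s \<le> h \<Longrightarrow> 0 \<le> t \<Longrightarrow> t \<le> h \<Longrightarrow> f differentiable (at (u + s *\<^sub>R a + t *\<^sub>R b))"
    and diff2: "\<And>s t. 0 \<le> s \<Longrightarrow> s \<le> h \<Longrightarrow> 0 \<le> t \<Longrightarrow> t \<le> h \<Longrightarrow>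
      (\<lambda>w. frechet_derivative f (at w) a) differentiable (at (u + s *\<^sub>R a + t *\<^sub>R b))"
  shows "\<exists>s t. 0 \<le> s \<and> s \<le> h \<and> 0 \<le> t \<and> t \<le> h \<and>
    f (u + h *\<^sub>R a + h *\<^sub>R b) - f (u + h *\<^sub>R a) - f (u + h *\<^sub>R b) + f u =
    h * (h * frechet_derivative (\<lambda>w. frechet_derivative f (at w) a) (at (u + s *\<^sub>R a + t *\<^sub>R b)) b)"
proof -
  define g where "g s = f ((u + h *\<^sub>R b) + s *\<^sub>R a) - f (u + s *\<^sub>R a)" for s
  have "\<exists>s>0. s < h \<and> g h - g 0 = (h - 0) * (frechet_derivative f (at ((u + h *\<^sub>R b) + s *\<^sub>R a)) a
      - frechet_derivative f (at (u + s *\<^sub>R a)) a)"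
    unfolding g_def
    by (rule MVT2[OF h]) (intro DERIV_diff has_real_derivative_line, use diff[of _ h] diff[of _ 0] h in \<open>auto simp: algebra_simps\<close>)
  then obtain s where s: "0 < s" "s < h"
    and gs: "g h - g 0 = h * (frechet_derivative f (at ((u + h *\<^sub>R b) + s *\<^sub>R a)) a
      - frechet_derivative f (at (u + s *\<^sub>R a)) a)" by auto
  define k where "k t = frechet_derivative f (at ((u + s *\<^sub>R a) + t *\<^sub>R b)) a" for t
  have "\<exists>t>0. t < h \<and> k h - k 0 = (h - 0) *
      frechet_derivative (\<lambda>w. frechet_derivative f (at w) a) (at ((u + s *\<^sub>R a) + t *\<^sub>R b)) b"
    unfolding k_def
    by (rule MVT2[OF h]) (intro has_real_derivative_line[where g="\<lambda>w. frechet_derivative f (at w) a"], use diff2[of s] s in auto)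
  then obtain t where t: "0 < t" "t < h" and kt: "k h - k 0 = h *
      frechet_derivative (\<lambda>w. frechet_derivative f (at w) a) (at ((u + s *\<^sub>R a) + t *\<^sub>R b)) b" by auto
  have "k h - k 0 = frechet_derivative f (at ((u + h *\<^sub>R b) + s *\<^sub>R a)) a
      - frechet_derivative f (at (u + s *\<^sub>R a)) a"
    by (simp add: k_def add_ac)
  then have "g h - g 0 = h * (h *
      frechet_derivative (\<lambda>w. frechet_derivative f (at w) a) (at ((u + s *\<^sub>R a) + t *\<^sub>R b)) b)"
    using gs kt by simp
  moreover have "g h - g 0 = f (u + h *\<^sub>R a + h *\<^sub>R b) - f (u + h *\<^sub>R a) - f (u + h *\<^sub>R b) + f u"
    by (simp add: g_def algebra_simps)
  ultimately show ?thesis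
    using s t by (intro exI[of _ s] exI[of _ t]) auto
qed

text \<open>If the two mixed derivatives differed by 2\<epsilon> at \<open>u\<close>, continuity
  would keep each within \<epsilon> of its value at \<open>u\<close> on a small parallelogram. Yet
  the same second difference equals \<open>h * h\<close> times each of them at some point of that
  parallelogram.\<close>

lemma frechet_derivative_commute_real:
  fixes f :: "'a::real_normed_vector \<Rightarrow> real"
  assumes U: "open U" "u \<in> U" and C: "Ck_on 2 U f"
  shows "frechet_derivative (\<lambda>w. frechet_derivative f (at w) a) (at u) b =
         frechet_derivative (\<lambda>w. frechet_derivative f (at w) b) (at u) a" (is "?L u = ?R u")
proof (rule ccontr)
  assume ne: "?L u \<noteq> ?R u"
  define \<epsilon> where "\<epsilon> = \<bar>?L u - ?R u\<bar> / 2"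
  have \<epsilon>: "\<epsilon> > 0" using ne by (simp add: \<epsilon>_def)
  have C': "f differentiable (at w)" "(\<lambda>w. frechet_derivative f (at w) v) differentiable (at w)" if "w \<in> U" for w v
    using C that by (auto simp: numeral_2_eq_2)
  have cont: "continuous_on U (\<lambda>w. frechet_derivative (\<lambda>w. frechet_derivative f (at w) v) (at w) v')" for v v'
    using C by (auto simp: numeral_2_eq_2)
  have "isCont ?L u" "isCont ?R u"
    using cont U by (auto simp: continuous_on_eq_continuous_at)
  then obtain d1 d2 where d1: "d1 > 0" "\<And>w. dist w u < d1 \<Longrightarrow> dist (?L w) (?L u) < \<epsilon>"
    and d2: "d2 > 0" "\<And>w. dist w u < d2 \<Longrightarrow> dist (?R w) (?R u) < \<epsilon>"
    using \<epsilon> unfolding continuous_at_eps_delta by metis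
  obtain d3 where d3: "d3 > 0" "ball u d3 \<subseteq> U" using U open_contains_ball by blast
  define d where "d = min d1 (min d2 d3)"
  have d: "d > 0" using d1 d2 d3 by (simp add: d_def)
  \<comment> \<open>This keeps the parallelogram with edges \<open>h *\<^sub>R a\<close> and
    \<open>h *\<^sub>R b\<close> within distance d/2 of \<open>u\<close>; the summand 1 excludes a
    zero denominator.\<close>
  define h where "h = d / (2 * (norm a + norm b + 1))"
  have pos: "norm a + norm b + 1 > 0" by (smt (verit) norm_ge_zero)
  have h: "h > 0" using d pos by (simp add: h_def)
  have small: "dist (u + s *\<^sub>R a + t *\<^sub>R b) u < d" if "0 \<le> s" "s \<le> h" "0 \<le> t" "t \<le> h" for s t
  proof -
    have "dist (u + s *\<^sub>R a + t *\<^sub>R b) u = norm (s *\<^sub>R a + t *\<^sub>R b)"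
      by (simp add: dist_norm algebra_simps)
    also have "\<dots> \<le> s * norm a + t * norm b"
      using norm_triangle_ineq[of "s *\<^sub>R a" "t *\<^sub>R b"] that by simp
    also have "\<dots> \<le> h * norm a + h * norm b"
      using that by (intro add_mono mult_right_mono) auto
    also have "\<dots> \<le> h * (norm a + norm b + 1)"
      using h by (simp add: algebra_simps)
    also have "\<dots> = d / 2" using pos by (simp add: h_def divide_simps)
    finally show ?thesis using d by linarith
  qed
  have inU: "u + s *\<^sub>R a + t *\<^sub>R b \<in> U" if "0 \<le> s" "s \<le> h" "0 \<le> t" "t \<le> h" for s t
    using small[OF that] d3(2) by (auto simp: d_def dist_commute subset_iff)
  obtain s t where st: "0 \<le> s" "s \<le> h" "0 \<le> t" "t \<le> h" and
     1: "f (u + h *\<^sub>R a + h *\<^sub>R b) - f (u + h *\<^sub>R a) - f (u + h *\<^sub>R b) + f u = h * (h * ?L (u + s *\<^sub>R a + t *\<^sub>R b))"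
    using second_difference_mean_value[OF h, of f u a b] C' inU by blast
  have "\<exists>s t. 0 \<le> s \<and> s \<le> h \<and> 0 \<le> t \<and> t \<le> h \<and>
    f (u + h *\<^sub>R b + h *\<^sub>R a) - f (u + h *\<^sub>R b) - f (u + h *\<^sub>R a) + f u = h * (h * ?R (u + s *\<^sub>R b + t *\<^sub>R a))"
    by (rule second_difference_mean_value[OF h]) (use C' inU in \<open>simp_all add: add.assoc add.commute[of "_ *\<^sub>R b"]\<close>)
  then obtain s' t' where st': "0 \<le> s'" "s' \<le> h" "0 \<le> t'" "t' \<le> h" and
     2: "f (u + h *\<^sub>R b + h *\<^sub>R a) - f (u + h *\<^sub>R b) - f (u + h *\<^sub>R a) + f u = h * (h * ?R (u + s' *\<^sub>R b + t' *\<^sub>R a))"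
    by blast
  have "f (u + h *\<^sub>R b + h *\<^sub>R a) = f (u + h *\<^sub>R a + h *\<^sub>R b)" by (simp add: algebra_simps)
  then have "h * (h * ?L (u + s *\<^sub>R a + t *\<^sub>R b)) = h * (h * ?R (u + s' *\<^sub>R b + t' *\<^sub>R a))"
    using 1 2 by linarith
  then have eq: "?L (u + s *\<^sub>R a + t *\<^sub>R b) = ?R (u + s' *\<^sub>R b + t' *\<^sub>R a)" using h by simp
  have sw: "u + s' *\<^sub>R b + t' *\<^sub>R a = u + t' *\<^sub>R a + s' *\<^sub>R b" by simp
  have "dist (?R (u + s' *\<^sub>R b + t' *\<^sub>R a)) (?R u) < \<epsilon>"
    unfolding sw using d2(2) small[OF st'(3,4,1,2)] by (simp add: d_def)
  moreover have "dist (?L (u + s *\<^sub>R a + t *\<^sub>R b)) (?L u) < \<epsilon>"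
    using d1(2) small[OF st] by (simp add: d_def)
  ultimately show False using eq by (simp add: dist_real_def \<epsilon>_def) argo
qed

lemma pd_commute:
  fixes f :: "real ^ 'n::finite \<Rightarrow> 'b::euclidean_space"
  assumes U: "open U" "u \<in> U" and C: "Ck_on 2 U f"
  shows "pd i (pd j f) u = pd j (pd i f) u"
proof (rule euclidean_eqI)
  fix b :: 'b
  have d: "f differentiable (at w)" "pd k f differentiable (at w)" if "w \<in> U" for w k
    using C that by (auto simp: numeral_2_eq_2 pd_def[abs_def])
  have C': "Ck_on 2 U (\<lambda>u. f u \<bullet> b)" by (intro Ck_on_inner U C Ck_on_const)
  have 1: "pd k (\<lambda>w. f w \<bullet> b) w = pd k f w \<bullet> b" if "w \<in> U" for w k
    using pd_inner[OF d(1)[OF that], of "\<lambda>_. b" k] by simp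
  have 2: "pd l (pd k (\<lambda>w. f w \<bullet> b)) u = pd l (pd k f) u \<bullet> b" for k l
    using pd_cong_open[OF U, of "pd k (\<lambda>w. f w \<bullet> b)" "\<lambda>w. pd k f w \<bullet> b" l] 1
      pd_inner[OF d(2)[OF U(2)], of "\<lambda>_. b" l k] by simp
  have "pd i (pd j (\<lambda>w. f w \<bullet> b)) u = pd j (pd i (\<lambda>w. f w \<bullet> b)) u"
    unfolding pd_def[abs_def] by (rule frechet_derivative_commute_real[OF U C'])
  then show "pd i (pd j f) u \<bullet> b = pd j (pd i f) u \<bullet> b" by (simp add: 2)
qed

lemma sum_delta [simp]:
  fixes g :: "'n::finite \<Rightarrow> real" and w :: "'n \<Rightarrow> 'a::real_vector"
  shows "(\<Sum>j\<in>UNIV. g j * (if i = j then 1 else 0)) = g i"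
    "(\<Sum>j\<in>UNIV. g j * (if j = i then 1 else 0)) = g i"
    "(\<Sum>j\<in>UNIV. (if i = j then 1 else 0) * g j) = g i"
    "(\<Sum>j\<in>UNIV. (if j = i then 1 else 0) * g j) = g i"
    "(\<Sum>j\<in>UNIV. (if i = j then 1 else 0 :: real) *\<^sub>R w j) = w i"
    "(\<Sum>j\<in>UNIV. (if j = i then 1 else 0 :: real) *\<^sub>R w j) = w i"
  by (simp_all add: if_distrib[of "\<lambda>c. c * _"] if_distrib[of "\<lambda>c. c *\<^sub>R _"] if_distrib[of "(*) _"] cong: if_cong)

section \<open>Determinants and inverses of matrix-valued functions\<close>

lemma matrix_inv_works:
  fixes A :: "real ^ 'n ^ 'n"
  assumes "invertible A"
  shows "A ** matrix_inv A = mat 1" "matrix_inv A ** A = mat 1"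
proof -
  have "A ** matrix_inv A = mat 1 \<and> matrix_inv A ** A = mat 1"
    using assms unfolding invertible_def matrix_inv_def by (rule someI_ex)
  then show "A ** matrix_inv A = mat 1" "matrix_inv A ** A = mat 1" by auto
qed

text \<open>Cramer's rule for a column of the identity. As quotients of polynomials in the entries
  of \<open>A\<close>, the entries of the inverse inherit the regularity of the matrix.\<close>

lemma matrix_inv_eq_det:
  fixes A :: "real ^ 'n ^ 'n"
  assumes "invertible A"
  shows "matrix_inv A $ i $ j = det (\<chi> a b. if b = i then axis j 1 $ a else A $ a $ b) / det A"
proof -
  have "A *v (matrix_inv A *v axis j 1) = axis j 1"
    by (simp add: matrix_vector_mul_assoc matrix_inv_works[OF assms])
  then have "matrix_inv A *v axis j 1 = (\<chi> k. det (\<chi> a b. if b = k then axis j 1 $ a else A $ a $ b) / det A)"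
    using cramer[of A "matrix_inv A *v axis j 1" "axis j 1"] assms by (simp add: invertible_det_nz)
  moreover have "(matrix_inv A *v axis j 1) $ i = matrix_inv A $ i $ j"
    by (simp add: matrix_vector_mult_basis column_def)
  ultimately show ?thesis by simp
qed

lemma Ck_on_det:
  assumes "open U" "\<And>i j. Ck_on k U (\<lambda>u. A u $ i $ j)"
  shows "Ck_on k U (\<lambda>u. det (A u :: real ^ 'n ^ 'n))"
  unfolding det_def by (intro Ck_on_sum Ck_on_mult Ck_on_prod Ck_on_const assms)

lemma Ck_on_matrix_inv:
  assumes U: "open U" and inv: "\<And>u. u \<in> U \<Longrightarrow> invertible (A u)"
    and A: "\<And>i j. Ck_on k U (\<lambda>u. A u $ i $ j)"
  shows "Ck_on k U (\<lambda>u. matrix_inv (A u :: real ^ 'n ^ 'n) $ i $ j)"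
proof -
  have "Ck_on k U (\<lambda>u. det (\<chi> a b. if b = i then axis j 1 $ a else A u $ a $ b) / det (A u))"
  proof (intro Ck_on_divide Ck_on_det U A)
    show "Ck_on k U (\<lambda>u. (\<chi> a b. if b = i then axis j 1 $ a else A u $ a $ b) $ a $ b)" for a b
      using A by (cases "b = i") auto
  qed (use inv invertible_det_nz in blast)
  then show ?thesis
    by (subst Ck_on_cong[OF U matrix_inv_eq_det[OF inv]])
qed

lemma pd_prod:
  fixes g :: "'i \<Rightarrow> real ^ 'n::finite \<Rightarrow> real"
  assumes "finite I" "\<And>i. i \<in> I \<Longrightarrow> g i differentiable (at u)"
  shows "pd m (\<lambda>u. \<Prod>i\<in>I. g i u) u = (\<Sum>i\<in>I. pd m (g i) u * (\<Prod>j\<in>I - {i}. g j u))"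
proof -
  have "((\<lambda>u. \<Prod>i\<in>I. g i u) has_derivative
      (\<lambda>y. \<Sum>i\<in>I. frechet_derivative (g i) (at u) y * (\<Prod>j\<in>I - {i}. g j u))) (at u)"
    by (intro has_derivative_prod frechet_works assms)
  then show ?thesis by (simp add: pd_def frechet_eqI)
qed

text \<open>Jacobi's formula. Expanding the derivative row by row, the \<open>r\<close>-th summand is the determinant
  with row \<open>r\<close> replaced by that of \<open>(\<partial>A \<cdot> A\<^sup>-\<^sup>1) A\<close>, i.e. by a combination of the rows of \<open>A\<close>.\<close>

lemma det_derivative_rows:
  fixes A :: "real ^ 'm::finite \<Rightarrow> real ^ 'n ^ 'n"
  assumes d: "\<And>i j. (\<lambda>u. A u $ i $ j) differentiable (at u)"
  shows "pd m (\<lambda>u. det (A u)) u =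
    (\<Sum>r\<in>UNIV. det (\<chi> i. if i = r then (\<chi> j. pd m (\<lambda>u. A u $ r $ j) u) else A u $ i))"
proof -
  have dp: "(\<lambda>u. \<Prod>i\<in>UNIV. A u $ i $ p i) differentiable (at u)" for p
    unfolding differentiable_def by (rule exI, rule has_derivative_prod, rule frechet_works, rule d)
  have "pd m (\<lambda>u. det (A u)) u =
      (\<Sum>p | p permutes UNIV. of_int (sign p) * (\<Sum>r\<in>UNIV. pd m (\<lambda>u. A u $ r $ p r) u * (\<Prod>i\<in>UNIV - {r}. A u $ i $ p i)))"
    unfolding det_def
    by (subst pd_sum) (use d dp in \<open>auto simp: pd_mult pd_prod intro: differentiable_mult\<close>)
  also have "\<dots> = (\<Sum>r\<in>UNIV. \<Sum>p | p permutes UNIV. of_int (sign p) *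
      (pd m (\<lambda>u. A u $ r $ p r) u * (\<Prod>i\<in>UNIV - {r}. A u $ i $ p i)))"
    by (subst sum.swap) (simp add: sum_distrib_left)
  also have "\<dots> = (\<Sum>r\<in>UNIV. det (\<chi> i. if i = r then (\<chi> j. pd m (\<lambda>u. A u $ r $ j) u) else A u $ i))"
    unfolding det_def
  proof (intro sum.cong refl arg_cong2[where f="(*)"])
    fix r p
    show "pd m (\<lambda>u. A u $ r $ p r) u * (\<Prod>i\<in>UNIV - {r}. A u $ i $ p i) =
      (\<Prod>i\<in>UNIV. (\<chi> i. if i = r then (\<chi> j. pd m (\<lambda>u. A u $ r $ j) u) else A u $ i) $ i $ p i)"
      by (subst prod.remove[of UNIV r]) (auto intro!: prod.cong)
  qed
  finally show ?thesis .
qed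

lemma pd_det:
  fixes A :: "real ^ 'm::finite \<Rightarrow> real ^ 'n ^ 'n"
  assumes d: "\<And>i j. (\<lambda>u. A u $ i $ j) differentiable (at u)" and inv: "invertible (A u)"
  shows "pd m (\<lambda>u. det (A u)) u =
    det (A u) * (\<Sum>i\<in>UNIV. \<Sum>j\<in>UNIV. matrix_inv (A u) $ i $ j * pd m (\<lambda>u. A u $ j $ i) u)"
proof -
  define C :: "real ^ 'n ^ 'n" where "C = (\<chi> i j. pd m (\<lambda>u. A u $ i $ j) u) ** matrix_inv (A u)"
  have CA: "C ** A u = (\<chi> i j. pd m (\<lambda>u. A u $ i $ j) u)"
    by (simp add: C_def matrix_mul_assoc[symmetric] matrix_inv_works[OF inv])
  have "det (\<chi> i. if i = r then (\<chi> j. pd m (\<lambda>u. A u $ r $ j) u) else A u $ i) = C $ r $ r * det (A u)" for r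
  proof -
    have "(\<chi> j. pd m (\<lambda>u. A u $ r $ j) u) = (\<Sum>i\<in>UNIV. C $ r $ i *s row i (A u))"
      using arg_cong[OF CA, of "\<lambda>B. B $ r"]
      by (simp add: vec_eq_iff matrix_matrix_mult_def row_def)
    moreover have "row i (A u) = A u $ i" for i
      by (simp add: row_def vec_eq_iff)
    ultimately show ?thesis
      using cramer_lemma_transpose[of r "C $ r" "A u"] by (simp cong: if_cong)
  qed
  then have "pd m (\<lambda>u. det (A u)) u = det (A u) * (\<Sum>r\<in>UNIV. C $ r $ r)"
    using det_derivative_rows[OF d] by (simp add: sum_distrib_left mult.commute)
  also have "(\<Sum>r\<in>UNIV. C $ r $ r) = (\<Sum>j\<in>UNIV. \<Sum>i\<in>UNIV. matrix_inv (A u) $ i $ j * pd m (\<lambda>u. A u $ j $ i) u)"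
    by (simp add: C_def matrix_matrix_mult_def mult.commute)
  also have "\<dots> = (\<Sum>i\<in>UNIV. \<Sum>j\<in>UNIV. matrix_inv (A u) $ i $ j * pd m (\<lambda>u. A u $ j $ i) u)"
    by (rule sum.swap)
  finally show ?thesis .
qed

text \<open>The determinant is continuous along the segment from \<open>mat 1\<close> to
  \<open>A\<close>. A zero on the way would give a kernel vector, but the quadratic form stays
  positive on the whole segment.\<close>

lemma det_pos_definite:
  fixes A :: "real ^ 'n ^ 'n"
  assumes pos: "\<And>X. X \<noteq> 0 \<Longrightarrow> X \<bullet> (A *v X) > 0"
  shows "det A > 0"
proof (rule ccontr)
  define P where "P t = (1 - t) *\<^sub>R mat 1 + t *\<^sub>R A" for t :: real
  assume "\<not> det A > 0"
  then have "det (P 1) \<le> 0 \<and> det (P 0) \<ge> 0" by (simp add: P_def)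
  moreover have "continuous_on {0..1} (\<lambda>t. det (P t))"
    unfolding det_def P_def by (intro continuous_intros)
  ultimately obtain t where t: "0 \<le> t" "t \<le> 1" "det (P t) = 0"
    using IVT2'[of "\<lambda>t. det (P t)" 1 0 0] by auto
  then obtain X where X: "X \<noteq> 0" "P t *v X = 0"
    by (metis invertible_det_nz invertible_left_inverse matrix_left_invertible_ker)
  have "P t *v X = (1 - t) *\<^sub>R X + t *\<^sub>R (A *v X)"
    by (simp add: P_def matrix_vector_mult_add_rdistrib scaleR_matrix_vector_assoc[symmetric])
  then have "0 = (1 - t) * (X \<bullet> X) + t * (X \<bullet> (A *v X))"
    using X by (metis inner_add_right inner_scaleR_right inner_zero_right)
  moreover have "(1 - t) * (X \<bullet> X) \<ge> 0" "t * (X \<bullet> (A *v X)) \<ge> 0"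
    using t pos[OF X(1)] by auto
  moreover have "(1 - t) * (X \<bullet> X) > 0 \<or> t * (X \<bullet> (A *v X)) > 0"
    using t pos[OF X(1)] X(1) by (cases "t = 0") auto
  ultimately show False by linarith
qed

section \<open>Hypersurface patches\<close>

text \<open>One chart of the hypersurface read in coordinates, with \<open>f\<close> and
  \<open>N\<close> in the roles of x and \<nu> composed with the parametrization. All local geometry
  is done here and transferred to each chart by \<open>chart_patch\<close>.\<close>

locale patch =
  fixes U :: "(real ^ 'n::finite) set" and f N :: "real ^ 'n \<Rightarrow> 'v::euclidean_space"
  assumes dim: "DIM('v) = CARD('n) + 2"
    and U: "open U"
    and smooth_f: "smooth_on U f" and smooth_N: "smooth_on U N"
    and ff: "u \<in> U \<Longrightarrow> f u \<bullet> f u = 1"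
    and NN: "u \<in> U \<Longrightarrow> N u \<bullet> N u = 1"
    and Nf: "u \<in> U \<Longrightarrow> N u \<bullet> f u = 0"
    and N_normal: "u \<in> U \<Longrightarrow> N u \<bullet> frechet_derivative f (at u) X = 0"
    and inj_df: "u \<in> U \<Longrightarrow> inj (frechet_derivative f (at u))"
begin

abbreviation e where "e i \<equiv> pd i f"
abbreviation nu where "nu i \<equiv> pd i N"
abbreviation G where "G \<equiv> induced_metric f"

text \<open>The Riemannian gradient of the i-th coordinate function. Being tangent, it reads off the
  i-th coordinate of the tangential part of any ambient vector.\<close>

definition E where "E i u = (\<Sum>j\<in>UNIV. matrix_inv (G u) $ i $ j *\<^sub>R e j u)"

text \<open>\<open>Bm\<close> is the matrix of minus the shape operator.\<close>

definition Bm :: "real ^ 'n \<Rightarrow> real ^ 'n ^ 'n" where "Bm u = (\<chi> i j. E i u \<bullet> nu j u)"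

lemma Ck_f [simp]: "Ck_on k U f" and Ck_N [simp]: "Ck_on k U N"
  using smooth_f smooth_N by (auto simp: smooth_on_def)

lemma Ck_e [simp]: "Ck_on k U (e i)" and Ck_nu [simp]: "Ck_on k U (nu i)"
  by (auto intro: Ck_on_pd)

lemma Ck_de [simp]: "Ck_on k U (pd j (e i))" and Ck_dnu [simp]: "Ck_on k U (pd j (nu i))"
  by (auto intro: Ck_on_pd)

lemma df_eq: "u \<in> U \<Longrightarrow> frechet_derivative f (at u) X = (\<Sum>i\<in>UNIV. X $ i *\<^sub>R e i u)"
  by (rule frechet_derivative_eq_sum_pd) (rule Ck_on_differentiable[OF Ck_f[of 1]], auto)

lemma dN_eq: "u \<in> U \<Longrightarrow> frechet_derivative N (at u) X = (\<Sum>i\<in>UNIV. X $ i *\<^sub>R nu i u)"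
  by (rule frechet_derivative_eq_sum_pd) (rule Ck_on_differentiable[OF Ck_N[of 1]], auto)

lemma linear_df: "u \<in> U \<Longrightarrow> linear (frechet_derivative f (at u))"
  by (rule linear_frechet_derivative) (rule Ck_on_differentiable[OF Ck_f[of 1]], auto)

lemma G_nth: "G u $ i $ j = e i u \<bullet> e j u"
  by (simp add: induced_metric_def)

lemma G_quadratic: "u \<in> U \<Longrightarrow> X \<bullet> (G u *v Y) = frechet_derivative f (at u) X \<bullet> frechet_derivative f (at u) Y"
  by (simp add: df_eq inner_vec_def matrix_vector_mult_def G_nth inner_sum_left inner_sum_right
      sum_distrib_left algebra_simps) (rule sum.swap)

lemma G_pos:
  assumes "u \<in> U" "X \<noteq> 0"
  shows "X \<bullet> (G u *v X) > 0"
proof -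
  have "frechet_derivative f (at u) X \<noteq> frechet_derivative f (at u) 0"
    using inj_df[OF assms(1)] assms(2) by (simp add: inj_eq)
  then show ?thesis using assms by (simp add: G_quadratic linear_0[OF linear_df])
qed

lemma det_G_pos: "u \<in> U \<Longrightarrow> det (G u) > 0"
  by (rule det_pos_definite) (rule G_pos)

lemma invertible_G: "u \<in> U \<Longrightarrow> invertible (G u)"
  using det_G_pos invertible_det_nz by fastforce

lemma Ck_G: "Ck_on k U (\<lambda>u. G u $ i $ j)"
  unfolding G_nth by (intro Ck_on_inner U Ck_e)

lemma Ck_ginv: "Ck_on k U (\<lambda>u. matrix_inv (G u) $ i $ j)"
  by (intro Ck_on_matrix_inv U invertible_G Ck_G)

lemma Ck_E [simp]: "Ck_on k U (E i)"
  unfolding E_def[abs_def] by (intro Ck_on_sum Ck_on_scaleR U Ck_ginv Ck_e)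

lemma differentiable_frame [simp]:
  assumes "u \<in> U"
  shows "f differentiable (at u)" "N differentiable (at u)" "e i differentiable (at u)"
    "nu i differentiable (at u)" "pd j (e i) differentiable (at u)" "pd j (nu i) differentiable (at u)"
    "E i differentiable (at u)"
  by (rule Ck_on_differentiable[where k=1 and U=U]; simp add: assms)+

lemma E_e: "u \<in> U \<Longrightarrow> E i u \<bullet> e j u = (if i = j then 1 else 0)"
  using arg_cong[OF matrix_inv_works(2)[OF invertible_G], of u "\<lambda>A. A $ i $ j"]
  by (simp add: E_def inner_sum_left matrix_matrix_mult_def G_nth mat_def)

lemma e_E: "u \<in> U \<Longrightarrow> e j u \<bullet> E i u = (if i = j then 1 else 0)"
  by (subst inner_commute) (rule E_e)

lemma ginv: "u \<in> U \<Longrightarrow> matrix_inv (G u) $ i $ j = E i u \<bullet> E j u"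
proof -
  assume u: "u \<in> U"
  have "E i u \<bullet> E j u = (\<Sum>k\<in>UNIV. matrix_inv (G u) $ i $ k * (e k u \<bullet> E j u))"
    by (subst E_def) (simp add: inner_sum_left)
  also have "\<dots> = (\<Sum>k\<in>UNIV. if k = j then matrix_inv (G u) $ i $ k else 0)"
    using u by (intro sum.cong) (auto simp: e_E)
  finally show ?thesis by simp
qed

lemma ginv_sym: "u \<in> U \<Longrightarrow> matrix_inv (G u) $ i $ j = matrix_inv (G u) $ j $ i"
  by (simp add: ginv inner_commute)

lemma N_e: "u \<in> U \<Longrightarrow> N u \<bullet> e i u = 0"
  using N_normal by (simp add: pd_def)

text \<open>The source of the relations that follow: each inner product of frame vectors that is
  constant on \<open>U\<close> yields, when differentiated, a relation one order higher.\<close>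

lemma pd_const_open: "u \<in> U \<Longrightarrow> (\<And>w. w \<in> U \<Longrightarrow> g w = c) \<Longrightarrow> pd i g u = 0"
  using pd_cong_open[OF U, of u g "\<lambda>_. c" i] by simp

lemma f_e: "u \<in> U \<Longrightarrow> f u \<bullet> e i u = 0"
  using pd_const_open[of u "\<lambda>u. f u \<bullet> f u" 1 i] ff by (simp add: pd_inner inner_commute)

lemma N_nu: "u \<in> U \<Longrightarrow> N u \<bullet> nu i u = 0"
  using pd_const_open[of u "\<lambda>u. N u \<bullet> N u" 1 i] NN by (simp add: pd_inner inner_commute)

lemma f_nu: "u \<in> U \<Longrightarrow> f u \<bullet> nu i u = 0"
  using pd_const_open[of u "\<lambda>u. N u \<bullet> f u" 0 i] Nf N_e by (simp add: pd_inner inner_commute)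

lemma f_E: "u \<in> U \<Longrightarrow> f u \<bullet> E i u = 0" and N_E: "u \<in> U \<Longrightarrow> N u \<bullet> E i u = 0"
  by (simp_all add: E_def inner_sum_right f_e N_e)

lemma fN: "u \<in> U \<Longrightarrow> f u \<bullet> N u = 0"
  using Nf by (simp add: inner_commute)

lemmas orth = ff NN Nf fN E_e e_E f_e N_e f_nu N_nu f_E N_E
lemmas orth' = f_e[unfolded inner_commute[of "f _"]] N_e[unfolded inner_commute[of "N _"]]
   f_nu[unfolded inner_commute[of "f _"]] N_nu[unfolded inner_commute[of "N _"]]
   f_E[unfolded inner_commute[of "f _"]] N_E[unfolded inner_commute[of "N _"]]

text \<open>The codimension enters only here: \<open>e\<^sub>1,\<dots>,e\<^sub>n,f,N\<close> span the ambient space.\<close>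

lemma expand:
  assumes u: "u \<in> U"
  shows "v = (\<Sum>i\<in>UNIV. (v \<bullet> E i u) *\<^sub>R e i u) + (v \<bullet> f u) *\<^sub>R f u + (v \<bullet> N u) *\<^sub>R N u"
proof -
  define F where "F = (\<lambda>(X, s, t). frechet_derivative f (at u) X + s *\<^sub>R f u + t *\<^sub>R N u)"
  interpret df: linear "frechet_derivative f (at u)" using u by (rule linear_df)
  have F: "F (X, s, t) = (\<Sum>i\<in>UNIV. X $ i *\<^sub>R e i u) + s *\<^sub>R f u + t *\<^sub>R N u" for X s t
    using u by (simp add: F_def df_eq)
  have comp: "F (X, s, t) \<bullet> f u = s" "F (X, s, t) \<bullet> N u = t" "F (X, s, t) \<bullet> E i u = X $ i" for X s t i
    using u by (simp_all add: F inner_add_left inner_sum_left orth orth' cong: if_cong)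
  have lin: "linear F"
    by (rule linearI) (auto simp: F_def df.add df.scale algebra_simps)
  have "inj F"
  proof (rule injI)
    fix a b assume "F a = F b"
    then show "a = b"
      by (cases a; cases b) (metis comp vec_eq_iff)
  qed
  then have "dim (range F) = DIM((real ^ 'n) \<times> real \<times> real)"
    using dim_image_eq[OF lin, of UNIV] by simp
  also have "\<dots> = DIM('v)" by (simp add: dim)
  finally have "range F = UNIV" using dim_eq_full by (metis lin linear_subspace_image span_eq_iff subspace_UNIV)
  then obtain X s t where v: "v = F (X, s, t)" by (metis prod_cases3 surjD)
  show ?thesis unfolding v comp by (simp add: F)
qed

text \<open>Both sides have the same products with \<open>f\<close>, \<open>N\<close> and all
  \<open>E j\<close>, and by \<open>expand\<close> these products determine a vector.\<close>

lemma expand':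
  assumes u: "u \<in> U"
  shows "v = (\<Sum>i\<in>UNIV. (v \<bullet> e i u) *\<^sub>R E i u) + (v \<bullet> f u) *\<^sub>R f u + (v \<bullet> N u) *\<^sub>R N u" (is "v = ?w")
proof -
  have w: "?w \<bullet> f u = v \<bullet> f u" "?w \<bullet> N u = v \<bullet> N u"
    using u by (simp_all add: inner_add_left inner_sum_left orth orth')
  have "?w \<bullet> E j u = v \<bullet> E j u" for j
  proof -
    have "?w \<bullet> E j u = (\<Sum>i\<in>UNIV. (v \<bullet> e i u) * (E i u \<bullet> E j u))"
      using u by (simp add: inner_add_left inner_sum_left orth)
    also have "\<dots> = v \<bullet> (\<Sum>i\<in>UNIV. matrix_inv (G u) $ j $ i *\<^sub>R e i u)"
      unfolding ginv[OF u, symmetric] by (simp add: inner_sum_right ginv_sym[OF u, of _ j] mult.commute)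
    finally show ?thesis by (simp add: E_def[of j])
  qed
  then have "?w = v"
    by (subst expand[OF u, of ?w]) (simp only: w expand[OF u, of v, symmetric])
  then show ?thesis ..
qed

text \<open>A resolution of the identity inserted between two vectors. This, with its primed
  variant, is what turns ambient inner products into index contractions.\<close>

lemma inner_expand:
  assumes u: "u \<in> U"
  shows "v \<bullet> w = (\<Sum>i\<in>UNIV. (v \<bullet> E i u) * (e i u \<bullet> w)) + (v \<bullet> f u) * (f u \<bullet> w) + (v \<bullet> N u) * (N u \<bullet> w)"
  by (subst expand[OF u, of v]) (simp add: inner_add_left inner_sum_left)

lemma inner_expand':
  assumes u: "u \<in> U"
  shows "v \<bullet> w = (\<Sum>i\<in>UNIV. (v \<bullet> e i u) * (E i u \<bullet> w)) + (v \<bullet> f u) * (f u \<bullet> w) + (v \<bullet> N u) * (N u \<bullet> w)"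
  by (subst expand'[OF u, of v]) (simp add: inner_add_left inner_sum_left)

section \<open>Structure equations and the Gauss equation\<close>

lemma e_commute: "u \<in> U \<Longrightarrow> pd i (e j) u = pd j (e i) u"
  by (rule pd_commute[OF U]) auto

lemma nu_commute: "u \<in> U \<Longrightarrow> pd i (nu j) u = pd j (nu i) u"
  by (rule pd_commute[OF U]) auto

lemma de_commute: "u \<in> U \<Longrightarrow> pd i (pd j (e k)) u = pd j (pd i (e k)) u"
  by (rule pd_commute[OF U]) auto

text \<open>The normal part of a second derivative of the immersion: differentiating the
  orthogonality of \<open>e j\<close> and \<open>N\<close> moves the derivative onto
  \<open>N\<close>. The companion \<open>f_de\<close> gives the part normal to the sphere, which
  later produces its curvature 1.\<close>

lemma N_de: "u \<in> U \<Longrightarrow> pd i (e j) u \<bullet> N u = - (e j u \<bullet> nu i u)"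
  using pd_const_open[of u "\<lambda>u. e j u \<bullet> N u" 0 i] N_e by (simp add: pd_inner inner_commute)

lemma f_de: "u \<in> U \<Longrightarrow> pd i (e j) u \<bullet> f u = - (e i u \<bullet> e j u)"
  using pd_const_open[of u "\<lambda>u. e j u \<bullet> f u" 0 i] f_e by (simp add: pd_inner inner_commute)

text \<open>Symmetry of the second fundamental form, inherited from equality of the mixed second
  derivatives of \<open>f\<close>.\<close>

lemma nu_sym: "u \<in> U \<Longrightarrow> nu i u \<bullet> e j u = nu j u \<bullet> e i u"
  using N_de[of u i j] N_de[of u j i] e_commute[of u i j] by (simp add: inner_commute)

text \<open>Differentiating the duality relations gives all components of the derivative of the dual
  frame without ever differentiating the inverse metric.\<close>

lemma pd_E:
  assumes u: "u \<in> U"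
  shows "pd j (E k) u \<bullet> e m u = - (E k u \<bullet> pd j (e m) u)"
    and "pd j (E k) u \<bullet> f u = - (if j = k then 1 else 0)"
    and "pd j (E k) u \<bullet> N u = - (E k u \<bullet> nu j u)"
proof -
  show "pd j (E k) u \<bullet> e m u = - (E k u \<bullet> pd j (e m) u)"
    using pd_const_open[OF u, of "\<lambda>u. E k u \<bullet> e m u" "if k = m then 1 else 0" j] E_e u by (simp add: pd_inner)
  show "pd j (E k) u \<bullet> f u = - (if j = k then 1 else 0)"
    using pd_const_open[OF u, of "\<lambda>u. E k u \<bullet> f u" 0 j] u by (simp add: pd_inner orth' E_e split: if_splits)
  show "pd j (E k) u \<bullet> N u = - (E k u \<bullet> nu j u)"
    using pd_const_open[OF u, of "\<lambda>u. E k u \<bullet> N u" 0 j] u by (simp add: pd_inner orth')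
qed

lemma pd_G: "u \<in> U \<Longrightarrow> pd i (\<lambda>v. G v $ j $ l) u = pd i (e j) u \<bullet> e l u + pd i (e l) u \<bullet> e j u"
  by (simp add: G_nth pd_inner inner_commute)

text \<open>After expansion the bracket has six terms. By symmetry of second derivatives four cancel
  and the other two coincide, which absorbs the factor 1/2.\<close>

lemma christoffel_eq:
  assumes u: "u \<in> U"
  shows "christoffel G k i j u = E k u \<bullet> pd i (e j) u"
proof -
  have "pd i (\<lambda>v. G v $ j $ l) u + pd j (\<lambda>v. G v $ i $ l) u - pd l (\<lambda>v. G v $ i $ j) u = 2 * (pd i (e j) u \<bullet> e l u)" for l
    using u by (simp add: pd_G e_commute[of u j i] e_commute[of u l])
  then show ?thesis
    by (simp add: christoffel_def E_def inner_sum_left sum_distrib_left inner_commute[of "e _ u" "pd _ _ u"])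
qed

text \<open>The Gauss equation. Third derivatives of \<open>f\<close> cancel, leaving products of
  first derivatives of \<open>E\<close> and \<open>e\<close>. Split along the frame, their
  tangential part cancels the quadratic Christoffel terms, the \<open>f\<close> part gives the
  curvature of the sphere, and the \<open>N\<close> part gives the second fundamental form.\<close>

lemma riemann_eq:
  assumes u: "u \<in> U"
  shows "riemann G l k i j u = (e j u \<bullet> e k u) * (if i = l then 1 else 0) - (e i u \<bullet> e k u) * (if j = l then 1 else 0)
     + (e j u \<bullet> nu k u) * (E l u \<bullet> nu i u) - (e i u \<bullet> nu k u) * (E l u \<bullet> nu j u)"
proof -
  have c: "pd i (christoffel G l j k) u = E l u \<bullet> pd i (pd j (e k)) u + pd i (E l) u \<bullet> pd j (e k) u" for i j
  proof -
    have "pd i (christoffel G l j k) u = pd i (\<lambda>u. E l u \<bullet> pd j (e k) u) u"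
      by (rule pd_cong_open[OF U u]) (rule christoffel_eq)
    then show ?thesis using u by (simp add: pd_inner)
  qed
  have g: "pd i (E l) u \<bullet> pd j (e k) u = - (\<Sum>m\<in>UNIV. (E l u \<bullet> pd i (e m) u) * (E m u \<bullet> pd j (e k) u))
      + (if i = l then 1 else 0) * (e j u \<bullet> e k u) + (E l u \<bullet> nu i u) * (e k u \<bullet> nu j u)" for i j
    by (subst inner_expand'[OF u])
      (simp add: pd_E[OF u] N_de[OF u, unfolded inner_commute[of _ "N u"]] f_de[OF u, unfolded inner_commute[of _ "f u"]] sum_negf)
  show ?thesis
    unfolding riemann_def c g de_commute[OF u, of j i]
    using nu_sym[OF u, of k] by (simp add: christoffel_eq[OF u] sum_subtractf inner_commute algebra_simps)
qed

end

context patch begin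

section \<open>Curvature of a patch\<close>

text \<open>The traces of the first, second and third power of minus the shape operator, so that
  \<open>h\<close> is -nH, \<open>S\<close> is the squared length of the second fundamental form,
  and \<open>T\<close> is -f_3.\<close>

definition h where "h u = (\<Sum>i\<in>UNIV. E i u \<bullet> nu i u)"
definition S where "S u = (\<Sum>i\<in>UNIV. \<Sum>j\<in>UNIV. (E i u \<bullet> nu j u) * (E j u \<bullet> nu i u))"
definition T where "T u = (\<Sum>i\<in>UNIV. \<Sum>j\<in>UNIV. \<Sum>k\<in>UNIV. (E i u \<bullet> nu j u) * (E j u \<bullet> nu k u) * (E k u \<bullet> nu i u))"

text \<open>\<open>Q a\<close> is minus the shape operator applied to the tangent part of \<open>a\<close>, i.e. the gradient of
  \<open>\<psi>\<^sub>a\<close>; \<open>Z a\<close> is the square of the shape operator applied to it.\<close>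

definition Q where "Q a u = (\<Sum>k\<in>UNIV. (a \<bullet> E k u) *\<^sub>R nu k u)"
definition Z where "Z a u = (\<Sum>k\<in>UNIV. (Q a u \<bullet> E k u) *\<^sub>R nu k u)"
definition tangential_part where "tangential_part a u = a - (f u \<bullet> a) *\<^sub>R f u - (N u \<bullet> a) *\<^sub>R N u"
definition dv where "dv W u = (\<Sum>j\<in>UNIV. E j u \<bullet> pd j W u)"

lemma Ck_h: "Ck_on k U h" and Ck_S: "Ck_on k U S" and Ck_Q: "Ck_on k U (Q a)"
  unfolding h_def[abs_def] S_def[abs_def] Q_def[abs_def]
  by (intro Ck_on_sum Ck_on_inner Ck_on_mult Ck_on_scaleR U Ck_E Ck_nu Ck_on_const)+

lemma Ck_Z: "Ck_on k U (Z a)"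
  unfolding Z_def[abs_def] by (intro Ck_on_sum Ck_on_inner Ck_on_scaleR U Ck_E Ck_nu Ck_Q)

lemma Ck_tan: "Ck_on k U (tangential_part a)"
  unfolding tangential_part_def[abs_def] by (intro Ck_on_diff Ck_on_inner Ck_on_scaleR U Ck_f Ck_N Ck_on_const)

lemma differentiable_fields [simp]:
  assumes "u \<in> U"
  shows "h differentiable (at u)" "S differentiable (at u)" "Q a differentiable (at u)"
    "Z a differentiable (at u)" "tangential_part a differentiable (at u)"
  by (rule Ck_on_differentiable[where k=1 and U=U]; simp only: assms Ck_h Ck_S Ck_Q Ck_Z Ck_tan zero_less_one)+

lemma tan_expand: "u \<in> U \<Longrightarrow> tangential_part a u = (\<Sum>i\<in>UNIV. (a \<bullet> E i u) *\<^sub>R e i u)"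
  using expand[of u a] by (simp add: tangential_part_def inner_commute algebra_simps)

lemma Q_f: "u \<in> U \<Longrightarrow> Q a u \<bullet> f u = 0" and Q_N: "u \<in> U \<Longrightarrow> Q a u \<bullet> N u = 0"
  by (simp_all add: Q_def inner_sum_left orth')

lemma Z_f: "u \<in> U \<Longrightarrow> Z a u \<bullet> f u = 0" and Z_N: "u \<in> U \<Longrightarrow> Z a u \<bullet> N u = 0"
  by (simp_all add: Z_def inner_sum_left orth')

lemma tan_f: "u \<in> U \<Longrightarrow> tangential_part a u \<bullet> f u = 0" and tan_N: "u \<in> U \<Longrightarrow> tangential_part a u \<bullet> N u = 0"
  by (simp_all add: tangential_part_def inner_diff_left orth) (simp_all add: inner_commute)

lemma ginv_e: "u \<in> U \<Longrightarrow> (\<Sum>j\<in>UNIV. matrix_inv (G u) $ k $ j * (e j u \<bullet> v)) = E k u \<bullet> v"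
  by (simp add: E_def inner_sum_left)

text \<open>The products of the tangent vectors \<open>nu j\<close> form the third fundamental form,
  which is the square of the shape operator with an index lowered; its metric trace is therefore
  \<open>S\<close>.\<close>

lemma ginv_nu_nu: "u \<in> U \<Longrightarrow> (\<Sum>j\<in>UNIV. \<Sum>k\<in>UNIV. matrix_inv (G u) $ j $ k * (nu j u \<bullet> nu k u)) = S u"
proof -
  assume u: "u \<in> U"
  have "(\<Sum>k\<in>UNIV. matrix_inv (G u) $ j $ k * (nu j u \<bullet> nu k u)) = (\<Sum>i\<in>UNIV. (E j u \<bullet> nu i u) * (E i u \<bullet> nu j u))" for j
  proof -
    have "(\<Sum>k\<in>UNIV. matrix_inv (G u) $ j $ k * (nu j u \<bullet> nu k u)) =
        (\<Sum>k\<in>UNIV. \<Sum>i\<in>UNIV. matrix_inv (G u) $ j $ k * ((nu j u \<bullet> E i u) * (nu i u \<bullet> e k u)))"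
      using nu_sym[OF u]
      by (subst inner_expand[OF u]) (simp add: orth orth' u sum_distrib_left inner_commute)
    also have "\<dots> = (\<Sum>i\<in>UNIV. (nu j u \<bullet> E i u) * (\<Sum>k\<in>UNIV. matrix_inv (G u) $ j $ k * (e k u \<bullet> nu i u)))"
      by (subst sum.swap) (simp add: sum_distrib_left inner_commute mult_ac)
    finally show ?thesis
      unfolding ginv_e[OF u] by (simp add: inner_commute mult.commute)
  qed
  then show ?thesis by (simp add: S_def)
qed

text \<open>Contraction of the Gauss equation. The Kronecker sum removes one of the n equal terms,
  whence n - 1, and \<open>nn\<close> recognises the last sum as the third fundamental form.\<close>

lemma ricci_eq:
  assumes u: "u \<in> U"
  shows "ricci G u $ j $ k = (real CARD('n) - 1) * (e j u \<bullet> e k u) + h u * (e j u \<bullet> nu k u) - nu j u \<bullet> nu k u"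
proof -
  have nn: "nu j u \<bullet> nu k u = (\<Sum>i\<in>UNIV. (e i u \<bullet> nu k u) * (E i u \<bullet> nu j u))"
    using inner_expand'[OF u, of "nu k u" "nu j u"] u by (simp add: orth orth' inner_commute)
  have "ricci G u $ j $ k = (\<Sum>i\<in>(UNIV::'n set). (e j u \<bullet> e k u)) - (\<Sum>i\<in>UNIV. (e i u \<bullet> e k u) * (if j = i then 1 else 0))
     + (\<Sum>i\<in>UNIV. (e j u \<bullet> nu k u) * (E i u \<bullet> nu i u)) - (\<Sum>i\<in>UNIV. (e i u \<bullet> nu k u) * (E i u \<bullet> nu j u))"
    by (simp only: ricci_def vec_lambda_beta riemann_eq[OF u]) (simp add: sum.distrib sum_subtractf)
  then show ?thesis
    unfolding nn by (simp add: h_def sum_distrib_left sum_distrib_right algebra_simps)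
qed

lemma scalar_curv_eq:
  assumes u: "u \<in> U"
  shows "scalar_curv G u = real CARD('n) * (real CARD('n) - 1) + (h u)\<^sup>2 - S u"
proof -
  have 1: "(\<Sum>k\<in>UNIV. matrix_inv (G u) $ j $ k * (e j u \<bullet> e k u)) = 1" for j
    using ginv_e[OF u, of j "e j u"] u by (simp add: inner_commute E_e e_E)
  have 2: "(\<Sum>k\<in>UNIV. matrix_inv (G u) $ j $ k * (e j u \<bullet> nu k u)) = E j u \<bullet> nu j u" for j
    using ginv_e[OF u, of j "nu j u"] nu_sym[OF u, of j] by (simp add: inner_commute)
  have "scalar_curv G u = (\<Sum>j\<in>UNIV. (real CARD('n) - 1) * (\<Sum>k\<in>UNIV. matrix_inv (G u) $ j $ k * (e j u \<bullet> e k u))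
     + h u * (\<Sum>k\<in>UNIV. matrix_inv (G u) $ j $ k * (e j u \<bullet> nu k u))
     - (\<Sum>k\<in>UNIV. matrix_inv (G u) $ j $ k * (nu j u \<bullet> nu k u)))"
    unfolding scalar_curv_def ricci_eq[OF u]
    by (simp add: sum.distrib sum_subtractf sum_distrib_left algebra_simps)
  also have "\<dots> = real CARD('n) * (real CARD('n) - 1) + h u * h u - S u"
    unfolding 1 2 by (simp add: sum.distrib sum_subtractf ginv_nu_nu[OF u] h_def sum_distrib_left)
  finally show ?thesis by (simp add: power2_eq_square)
qed

section \<open>The defined geometric quantities expressed in the frame\<close>

lemma tan_norm:
  assumes u: "u \<in> U"
  shows "tangential_part a u \<bullet> tangential_part a u = a \<bullet> a - (f u \<bullet> a)\<^sup>2 - (N u \<bullet> a)\<^sup>2"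
  using u by (simp add: tangential_part_def inner_diff_left inner_diff_right orth power2_eq_square inner_commute)

text \<open>This justifies the definite description in \<open>tangent_comp\<close>. The images of
  two solutions under the differential differ by a vector orthogonal to itself, and the differential
  is injective.\<close>

lemma tangent_orth_iff:
  assumes u: "u \<in> U"
  shows "(\<forall>Y. (a - frechet_derivative f (at u) X) \<bullet> frechet_derivative f (at u) Y = 0) \<longleftrightarrow> X = (\<chi> i. a \<bullet> E i u)"
proof
  interpret df: linear "frechet_derivative f (at u)" using u by (rule linear_df)
  let ?X = "\<chi> i. a \<bullet> E i u"
  have "a - frechet_derivative f (at u) ?X = (f u \<bullet> a) *\<^sub>R f u + (N u \<bullet> a) *\<^sub>R N u"
    using tan_expand[OF u, of a] u by (simp add: df_eq tangential_part_def algebra_simps)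
  then have *: "(a - frechet_derivative f (at u) ?X) \<bullet> frechet_derivative f (at u) Y = 0" for Y
    using u by (simp add: df_eq inner_add_left inner_sum_right orth)
  then show "\<forall>Y. (a - frechet_derivative f (at u) X) \<bullet> frechet_derivative f (at u) Y = 0" if "X = ?X"
    using that by simp
  assume X: "\<forall>Y. (a - frechet_derivative f (at u) X) \<bullet> frechet_derivative f (at u) Y = 0"
  let ?D = "frechet_derivative f (at u) (X - ?X)"
  have "?D \<bullet> ?D = 0"
    using X[rule_format, of "X - ?X"] *[of "X - ?X"] by (simp add: df.diff inner_diff_left)
  then have "?D = frechet_derivative f (at u) 0" by (simp add: df.zero)
  then have "X - ?X = 0" by (rule injD[OF inj_df[OF u]])
  then show "X = ?X" by simp
qed

lemma tangent_comp_eq: "u \<in> U \<Longrightarrow> tangent_comp f u a = (\<chi> i. a \<bullet> E i u)"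
  by (simp add: tangent_comp_def tangent_orth_iff)

text \<open>The flat derivative of \<open>N\<close> is already orthogonal to \<open>f\<close> and to
  \<open>N\<close>, so the projection to the sphere changes nothing and the result lies in the image
  of the differential. Injectivity gives uniqueness.\<close>

lemma shape_op_eq:
  assumes u: "u \<in> U"
  shows "shape_op f N u X = - (Bm u *v X)"
  unfolding shape_op_def
proof (rule the_equality)
  interpret df: linear "frechet_derivative f (at u)" using u by (rule linear_df)
  have s: "sphere_deriv f N u X = (\<Sum>j\<in>UNIV. X $ j *\<^sub>R nu j u)"
    using u by (simp add: sphere_deriv_def dN_eq inner_sum_left orth')
  have "(\<Sum>j\<in>UNIV. X $ j *\<^sub>R nu j u) = frechet_derivative f (at u) (Bm u *v X)"
    by (subst expand[OF u, of "\<Sum>j\<in>UNIV. X $ j *\<^sub>R nu j u"])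
      (simp add: df_eq u inner_sum_left orth' Bm_def matrix_vector_mult_def inner_commute[of "nu _ u" "E _ u"] mult.commute)
  then show *: "frechet_derivative f (at u) (- (Bm u *v X)) = - sphere_deriv f N u X"
    by (simp add: s df.neg)
  fix Y assume "frechet_derivative f (at u) Y = - sphere_deriv f N u X"
  with * inj_df[OF u] show "Y = - (Bm u *v X)" by (metis injD)
qed

lemma matrix_shape_op: "u \<in> U \<Longrightarrow> matrix (shape_op f N u) = - Bm u"
proof -
  assume u: "u \<in> U"
  have "shape_op f N u = (*v) (- Bm u)"
  proof
    fix X show "shape_op f N u X = (- Bm u) *v X"
      using u by (simp add: shape_op_eq matrix_vector_mult_def vec_eq_iff sum_negf)
  qed
  then show ?thesis by simp
qed

lemma trace_shape_op: "u \<in> U \<Longrightarrow> trace (matrix (shape_op f N u)) = - h u"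
  by (simp add: matrix_shape_op trace_def Bm_def h_def sum_negf)

lemma trace_shape_op3:
  assumes u: "u \<in> U"
  shows "(let A = matrix (shape_op f N u) in trace (A ** A ** A)) = - T u"
proof -
  have "trace (- Bm u ** - Bm u ** - Bm u) = - (\<Sum>i\<in>UNIV. \<Sum>k\<in>UNIV. \<Sum>j\<in>UNIV. Bm u $ i $ j * Bm u $ j $ k * Bm u $ k $ i)"
    by (simp add: trace_def matrix_matrix_mult_def sum_distrib_right sum_negf)
  also have "\<dots> = - T u"
    unfolding T_def Bm_def by (simp, rule sum.cong[OF refl], rule sum.swap)
  finally show ?thesis using u by (simp add: matrix_shape_op)
qed

lemma second_ff_eq: "u \<in> U \<Longrightarrow> second_ff f N u i j = - (nu i u \<bullet> e j u)"
proof -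
  assume u: "u \<in> U"
  interpret df: linear "frechet_derivative f (at u)" using u by (rule linear_df)
  have "frechet_derivative f (at u) (Bm u *v axis i 1) = nu i u"
    using u by (subst expand[OF u, of "nu i u"])
      (simp add: df_eq matrix_vector_mult_basis column_def Bm_def orth orth' inner_commute)
  then show ?thesis
    using u by (simp add: second_ff_def shape_op_eq df.neg pd_def)
qed

lemma second_ff_sq_eq:
  assumes u: "u \<in> U"
  shows "(let Ginv = matrix_inv (G u) in \<Sum>i\<in>UNIV. \<Sum>j\<in>UNIV. \<Sum>k\<in>UNIV. \<Sum>l\<in>UNIV.
          Ginv $ i $ k * Ginv $ j $ l * second_ff f N u i j * second_ff f N u k l) = S u"
proof -
  have kl: "(\<Sum>k\<in>UNIV. \<Sum>l\<in>UNIV. matrix_inv (G u) $ i $ k * matrix_inv (G u) $ j $ l * second_ff f N u i j * second_ff f N u k l)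
      = (nu i u \<bullet> e j u) * (\<Sum>l\<in>UNIV. matrix_inv (G u) $ j $ l * (E i u \<bullet> nu l u))" for i j
  proof -
    have "(\<Sum>k\<in>UNIV. matrix_inv (G u) $ i $ k * (nu k u \<bullet> e l u)) = E i u \<bullet> nu l u" for l
      using ginv_e[OF u, of i "nu l u"] nu_sym[OF u, of _ l] by (simp add: inner_commute)
    moreover have "(\<Sum>k\<in>UNIV. \<Sum>l\<in>UNIV. matrix_inv (G u) $ i $ k * matrix_inv (G u) $ j $ l * second_ff f N u i j * second_ff f N u k l)
      = (nu i u \<bullet> e j u) * (\<Sum>l\<in>UNIV. matrix_inv (G u) $ j $ l * (\<Sum>k\<in>UNIV. matrix_inv (G u) $ i $ k * (nu k u \<bullet> e l u)))"
      by (subst sum.swap) (simp add: second_ff_eq[OF u] mult_ac sum_distrib_left)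
    ultimately show ?thesis by simp
  qed
  have "(\<Sum>j\<in>UNIV. (nu i u \<bullet> e j u) * (\<Sum>l\<in>UNIV. matrix_inv (G u) $ j $ l * (E i u \<bullet> nu l u)))
      = (\<Sum>l\<in>UNIV. (\<Sum>j\<in>UNIV. matrix_inv (G u) $ l $ j * (e j u \<bullet> nu i u)) * (E i u \<bullet> nu l u))" for i
    by (simp add: sum_distrib_left sum_distrib_right, subst sum.swap)
      (simp add: ginv_sym[OF u] inner_commute mult_ac)
  then show ?thesis
    unfolding Let_def kl by (simp add: ginv_e[OF u] S_def mult.commute)
qed

lemma traceless_ricci_eq:
  assumes u: "u \<in> U"
  shows "tangent_comp f u a \<bullet> ((ricci G u - c *\<^sub>R G u) *v tangent_comp f u a) =
    (real CARD('n) - 1 - c) * (tangential_part a u \<bullet> tangential_part a u) + h u * (Q a u \<bullet> a) - Q a u \<bullet> Q a u"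
proof -
  define X where "X i = a \<bullet> E i u" for i
  have "tangent_comp f u a \<bullet> ((ricci G u - c *\<^sub>R G u) *v tangent_comp f u a) =
      (\<Sum>i\<in>UNIV. \<Sum>j\<in>UNIV. X i * (X j * ((real CARD('n) - 1 - c) * (e i u \<bullet> e j u) + h u * (e i u \<bullet> nu j u) - nu i u \<bullet> nu j u)))"
    by (simp add: tangent_comp_eq[OF u] X_def inner_vec_def matrix_vector_mult_def sum_distrib_left ricci_eq[OF u] G_nth algebra_simps)
  also have "\<dots> = (real CARD('n) - 1 - c) * (\<Sum>i\<in>UNIV. \<Sum>j\<in>UNIV. X i * (X j * (e i u \<bullet> e j u)))
      + h u * (\<Sum>i\<in>UNIV. \<Sum>j\<in>UNIV. X i * (X j * (e i u \<bullet> nu j u))) - (\<Sum>i\<in>UNIV. \<Sum>j\<in>UNIV. X i * (X j * (nu i u \<bullet> nu j u)))"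
    by (simp add: sum_distrib_left sum.distrib[symmetric] sum_subtractf[symmetric] algebra_simps)
  also have "(\<Sum>i\<in>UNIV. \<Sum>j\<in>UNIV. X i * (X j * (e i u \<bullet> e j u))) = tangential_part a u \<bullet> tangential_part a u"
    by (simp add: tan_expand[OF u] X_def inner_sum_left inner_sum_right sum_distrib_left inner_commute mult.left_commute)
  also have "(\<Sum>i\<in>UNIV. \<Sum>j\<in>UNIV. X i * (X j * (e i u \<bullet> nu j u))) = tangential_part a u \<bullet> Q a u"
    by (simp add: tan_expand[OF u] Q_def X_def inner_sum_left inner_sum_right sum_distrib_left)
      (subst sum.swap, simp add: mult.left_commute)
  also have "(\<Sum>i\<in>UNIV. \<Sum>j\<in>UNIV. X i * (X j * (nu i u \<bullet> nu j u))) = Q a u \<bullet> Q a u"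
    by (simp add: Q_def X_def inner_sum_left inner_sum_right sum_distrib_left inner_commute mult.left_commute)
  also have "tangential_part a u \<bullet> Q a u = Q a u \<bullet> a"
    using Q_f[OF u, of a] Q_N[OF u, of a] by (simp add: tangential_part_def inner_commute[of _ "Q a u"] inner_diff_right)
  finally show ?thesis .
qed

section \<open>Divergence computations\<close>

lemma pd_phi: "u \<in> U \<Longrightarrow> pd j (\<lambda>u. f u \<bullet> a) u = e j u \<bullet> a"
  and pd_psi: "u \<in> U \<Longrightarrow> pd j (\<lambda>u. N u \<bullet> a) u = nu j u \<bullet> a"
  by (simp_all add: pd_inner)

lemma pd_tan:
  assumes u: "u \<in> U"
  shows "pd j (tangential_part a) u = - ((f u \<bullet> a) *\<^sub>R e j u) - (e j u \<bullet> a) *\<^sub>R f u - (N u \<bullet> a) *\<^sub>R nu j u - (nu j u \<bullet> a) *\<^sub>R N u"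
proof -
  have d: "(\<lambda>u. (f u \<bullet> a) *\<^sub>R f u) differentiable (at u)" "(\<lambda>u. (N u \<bullet> a) *\<^sub>R N u) differentiable (at u)"
    "(\<lambda>u. f u \<bullet> a) differentiable (at u)" "(\<lambda>u. N u \<bullet> a) differentiable (at u)"
    using u by auto
  then have "(\<lambda>u. a - (f u \<bullet> a) *\<^sub>R f u) differentiable (at u)" by simp
  with d u show ?thesis
    unfolding tangential_part_def[abs_def] by (simp add: pd_diff pd_scaleR pd_phi pd_psi)
qed

lemma dv_tan: "u \<in> U \<Longrightarrow> dv (tangential_part a) u = - real CARD('n) * (f u \<bullet> a) - (N u \<bullet> a) * h u"
  by (simp add: dv_def pd_tan inner_diff_right orth orth' sum_subtractf sum_negf h_def sum_distrib_left)

lemma dv_scaleR: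
  assumes "u \<in> U" "c differentiable (at u)" "W differentiable (at u)"
  shows "dv (\<lambda>u. c u *\<^sub>R W u) u = c u * dv W u + (\<Sum>j\<in>UNIV. pd j c u * (E j u \<bullet> W u))"
  using assms by (simp add: dv_def pd_scaleR inner_add_right sum.distrib sum_distrib_left)

lemma dv_diff:
  assumes "V differentiable (at u)" "W differentiable (at u)"
  shows "dv (\<lambda>u. V u - W u) u = dv V u - dv W u"
  using assms by (simp add: dv_def pd_diff inner_diff_right sum_subtractf)

lemma E_tan: "u \<in> U \<Longrightarrow> E j u \<bullet> tangential_part a u = E j u \<bullet> a"
  by (simp add: tangential_part_def inner_diff_right orth')

lemma dv_phi_tan:
  assumes u: "u \<in> U"
  shows "dv (\<lambda>u. (f u \<bullet> a) *\<^sub>R tangential_part a u) u =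
    a \<bullet> a - (real CARD('n) + 1) * (f u \<bullet> a)\<^sup>2 - (N u \<bullet> a)\<^sup>2 - h u * (f u \<bullet> a) * (N u \<bullet> a)"
proof -
  have "(\<Sum>j\<in>UNIV. (e j u \<bullet> a) * (E j u \<bullet> a)) = a \<bullet> a - (f u \<bullet> a)\<^sup>2 - (N u \<bullet> a)\<^sup>2"
    using inner_expand'[OF u, of a a] by (simp add: inner_commute power2_eq_square)
  moreover have "(\<lambda>u. f u \<bullet> a) differentiable (at u)" using u by auto
  ultimately show ?thesis
    using u by (simp add: dv_scaleR pd_phi E_tan dv_tan power2_eq_square algebra_simps)
qed

text \<open>The Christoffel terms are displayed so that they can cancel against those arising in
  \<open>dv_nu_combination\<close>.\<close>

lemma pd_h:
  assumes u: "u \<in> U"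
  shows "pd k h u = (\<Sum>j\<in>UNIV. E j u \<bullet> pd k (nu j) u) -
     (\<Sum>j\<in>UNIV. \<Sum>m\<in>UNIV. (E j u \<bullet> pd k (e m) u) * (E m u \<bullet> nu j u))"
proof -
  have "pd k (E j) u \<bullet> nu j u = - (\<Sum>m\<in>UNIV. (E j u \<bullet> pd k (e m) u) * (E m u \<bullet> nu j u))" for j
    by (subst inner_expand'[OF u]) (simp add: pd_E[OF u] orth u sum_negf)
  then show ?thesis
    unfolding h_def[abs_def] using u
    by (subst pd_sum) (auto simp: pd_inner sum.distrib sum_subtractf sum_negf)
qed

text \<open>The hypothesis says that \<open>D\<close> is the covariant derivative of the tangent field with
  components \<open>c\<close>; all Christoffel symbols then cancel.\<close>

lemma dv_nu_combination:
  assumes u: "u \<in> U" and c: "\<And>k. c k differentiable (at u)"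
    and D: "\<And>j k. pd j (c k) u = D j k - (\<Sum>m\<in>UNIV. c m u * (E k u \<bullet> pd j (e m) u))"
  shows "dv (\<lambda>u. \<Sum>k\<in>UNIV. c k u *\<^sub>R nu k u) u =
    (\<Sum>j\<in>UNIV. \<Sum>k\<in>UNIV. D j k * (E j u \<bullet> nu k u)) + (\<Sum>k\<in>UNIV. c k u * pd k h u)"
proof -
  let ?X = "\<Sum>m\<in>UNIV. c m u * (\<Sum>j\<in>UNIV. \<Sum>k\<in>UNIV. (E k u \<bullet> pd m (e j) u) * (E j u \<bullet> nu k u))"
  have "dv (\<lambda>u. \<Sum>k\<in>UNIV. c k u *\<^sub>R nu k u) u =
     (\<Sum>j\<in>UNIV. \<Sum>k\<in>UNIV. c k u * (E j u \<bullet> pd j (nu k) u)) + (\<Sum>j\<in>UNIV. \<Sum>k\<in>UNIV. pd j (c k) u * (E j u \<bullet> nu k u))"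
    unfolding dv_def using u c
    by (subst pd_sum) (auto simp: pd_scaleR inner_sum_right inner_add_right sum.distrib)
  \<comment> \<open>This is where Codazzi enters: exchanging the two derivatives of \<open>N\<close>
    turns the divergence of the second fundamental form into the derivative of its trace.\<close>
  also have "(\<Sum>j\<in>UNIV. \<Sum>k\<in>UNIV. c k u * (E j u \<bullet> pd j (nu k) u)) = (\<Sum>k\<in>UNIV. c k u * (\<Sum>j\<in>UNIV. E j u \<bullet> pd k (nu j) u))"
    by (subst sum.swap) (simp add: sum_distrib_left nu_commute[OF u])
  also have "\<dots> = (\<Sum>k\<in>UNIV. c k u * pd k h u) + ?X"
  proof -
    have "(\<Sum>j\<in>UNIV. E j u \<bullet> pd k (nu j) u) = pd k h u + (\<Sum>j\<in>UNIV. \<Sum>i\<in>UNIV. (E i u \<bullet> pd k (e j) u) * (E j u \<bullet> nu i u))" for k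
      unfolding pd_h[OF u] by (simp, rule sum.swap)
    then show ?thesis by (simp add: algebra_simps sum.distrib)
  qed
  also have "(\<Sum>j\<in>UNIV. \<Sum>k\<in>UNIV. pd j (c k) u * (E j u \<bullet> nu k u)) =
     (\<Sum>j\<in>UNIV. \<Sum>k\<in>UNIV. D j k * (E j u \<bullet> nu k u)) -
     (\<Sum>j\<in>UNIV. \<Sum>k\<in>UNIV. \<Sum>m\<in>UNIV. c m u * ((E k u \<bullet> pd m (e j) u) * (E j u \<bullet> nu k u)))"
    unfolding D e_commute[OF u] by (simp add: algebra_simps sum_subtractf sum_distrib_left)
  also have "(\<Sum>j\<in>UNIV. \<Sum>k\<in>UNIV. \<Sum>m\<in>UNIV. c m u * ((E k u \<bullet> pd m (e j) u) * (E j u \<bullet> nu k u))) = ?X"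
    by (subst sum.swap[of _ UNIV UNIV], simp add: sum_distrib_left) (subst sum.swap[of _ UNIV UNIV], simp)
  finally show ?thesis by simp
qed

text \<open>The coordinate form of the covariant derivative of a^T. The Christoffel sum is kept
  apart so that the other terms can serve as \<open>D\<close> in \<open>dv_nu_combination\<close>.
  Since \<open>a\<close> is any fixed ambient vector, the value of a field at \<open>u\<close> may
  be inserted for it.\<close>

lemma pd_component:
  assumes u: "u \<in> U"
  shows "a \<bullet> pd j (E k) u = - (f u \<bullet> a) * (if j = k then 1 else 0) - (N u \<bullet> a) * (E k u \<bullet> nu j u)
     - (\<Sum>m\<in>UNIV. (a \<bullet> E m u) * (E k u \<bullet> pd j (e m) u))"
proof -
  have "a \<bullet> pd j (E k) u = (\<Sum>m\<in>UNIV. (a \<bullet> E m u) * (pd j (E k) u \<bullet> e m u)) + (a \<bullet> f u) * (pd j (E k) u \<bullet> f u) + (a \<bullet> N u) * (pd j (E k) u \<bullet> N u)"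
    by (subst inner_expand[OF u]) (simp add: inner_commute)
  then show ?thesis
    unfolding pd_E[OF u] by (simp add: sum_negf inner_commute)
qed

lemma dv_Q:
  assumes u: "u \<in> U"
  shows "dv (Q a) u = (\<Sum>k\<in>UNIV. (a \<bullet> E k u) * pd k h u) - (f u \<bullet> a) * h u - (N u \<bullet> a) * S u"
proof -
  let ?D = "\<lambda>j k. - (f u \<bullet> a) * (if j = k then 1 else 0) - (N u \<bullet> a) * (E k u \<bullet> nu j u)"
  have "dv (Q a) u = (\<Sum>j\<in>UNIV. \<Sum>k\<in>UNIV. ?D j k * (E j u \<bullet> nu k u)) + (\<Sum>k\<in>UNIV. (a \<bullet> E k u) * pd k h u)"
    unfolding Q_def[abs_def]
    by (rule dv_nu_combination[OF u]) (use u pd_component[OF u, of a] in \<open>auto simp: pd_inner\<close>)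
  also have "(\<Sum>j\<in>UNIV. \<Sum>k\<in>UNIV. ?D j k * (E j u \<bullet> nu k u)) = - (f u \<bullet> a) * h u - (N u \<bullet> a) * S u"
  proof -
    have "(\<Sum>k\<in>UNIV. ?D j k * (E j u \<bullet> nu k u)) = - (f u \<bullet> a) * (\<Sum>k\<in>UNIV. (if j = k then 1 else 0) * (E j u \<bullet> nu k u))
        - (N u \<bullet> a) * (\<Sum>k\<in>UNIV. (E k u \<bullet> nu j u) * (E j u \<bullet> nu k u))" for j
      by (simp only: left_diff_distrib sum_subtractf mult.assoc sum_distrib_left)
    moreover have "S u = (\<Sum>j\<in>UNIV. \<Sum>k\<in>UNIV. (E k u \<bullet> nu j u) * (E j u \<bullet> nu k u))"
      by (simp add: S_def mult.commute)
    ultimately show ?thesis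
      by (simp add: sum_subtractf sum_negf h_def sum_distrib_left)
  qed
  finally show ?thesis by simp
qed

text \<open>With the signs of \<open>Q\<close> and \<open>h\<close>, the field is \<psi>_a (nH I -
  A) a^T. Both summands produce the derivative of \<open>h\<close> along a^T, and these
  cancel.\<close>

lemma dv_Q_tan:
  assumes u: "u \<in> U"
  shows "dv (\<lambda>u. (N u \<bullet> a) *\<^sub>R (Q a u - h u *\<^sub>R tangential_part a u)) u =
    Q a u \<bullet> Q a u - h u * (Q a u \<bullet> a) + (real CARD('n) - 1) * (h u * (f u \<bullet> a) * (N u \<bullet> a))
      + (N u \<bullet> a)\<^sup>2 * ((h u)\<^sup>2 - S u)"
proof -
  have d: "(\<lambda>u. h u *\<^sub>R tangential_part a u) differentiable (at u)" "(\<lambda>u. N u \<bullet> a) differentiable (at u)"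
    using u by auto
  then have d': "(\<lambda>u. Q a u - h u *\<^sub>R tangential_part a u) differentiable (at u)" using u by simp
  \<comment> \<open>Self-adjointness of the shape operator: the differential of \<psi>_a applied to
    a tangent vector \<open>w\<close> equals the product of \<open>Q a u\<close> with
    \<open>w\<close>.\<close>
  have 1: "(\<Sum>j\<in>UNIV. (nu j u \<bullet> a) * (E j u \<bullet> w)) = Q a u \<bullet> w" if "w \<bullet> f u = 0" "w \<bullet> N u = 0" for w
  proof -
    have "Q a u \<bullet> w = (\<Sum>k\<in>UNIV. (a \<bullet> E k u) * (nu k u \<bullet> w))"
      by (simp add: Q_def inner_sum_left)
    also have "\<dots> = (\<Sum>k\<in>UNIV. (a \<bullet> E k u) * (\<Sum>j\<in>UNIV. (nu j u \<bullet> e k u) * (E j u \<bullet> w)))"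
      using that nu_sym[OF u] by (subst inner_expand'[OF u, of _ w]) (simp add: orth orth' u)
    also have "\<dots> = (\<Sum>j\<in>UNIV. (\<Sum>k\<in>UNIV. (a \<bullet> E k u) * (nu j u \<bullet> e k u)) * (E j u \<bullet> w))"
      by (simp add: sum_distrib_left sum_distrib_right, subst sum.swap) (simp add: mult_ac)
    also have "\<dots> = (\<Sum>j\<in>UNIV. (nu j u \<bullet> a) * (E j u \<bullet> w))"
      using inner_expand[OF u, of a "nu _ u"] by (simp add: orth orth' u inner_commute)
    finally show ?thesis by simp
  qed
  have Qa: "Q a u \<bullet> tangential_part a u = Q a u \<bullet> a"
    using Q_f[OF u, of a] Q_N[OF u, of a] by (simp add: tangential_part_def inner_diff_right)
  have h1: "(\<Sum>j\<in>UNIV. (nu j u \<bullet> a) * (E j u \<bullet> (Q a u - h u *\<^sub>R tangential_part a u))) = Q a u \<bullet> Q a u - h u * (Q a u \<bullet> a)"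
    by (subst 1) (simp_all add: inner_diff_left inner_diff_right Q_f Q_N tan_f tan_N u Qa)
  have h2: "dv (\<lambda>u. h u *\<^sub>R tangential_part a u) u = - h u * (real CARD('n) * (f u \<bullet> a) + (N u \<bullet> a) * h u) + (\<Sum>k\<in>UNIV. (a \<bullet> E k u) * pd k h u)"
    using u by (simp add: dv_scaleR dv_tan E_tan inner_commute mult.commute algebra_simps)
  show ?thesis
    using u d d' by (simp add: dv_scaleR dv_diff pd_psi h1 h2 dv_Q) (simp add: algebra_simps power2_eq_square)
qed

text \<open>Codazzi leaves the derivative of the trace, zero by minimality, and a contraction of the
  shape operator with its own covariant derivative, which is half the derivative of \<open>S\<close>
  and so vanishes as well.\<close>

lemma dv_phi_Z:
  assumes u: "u \<in> U" and h0: "\<And>w. w \<in> U \<Longrightarrow> h w = 0" and S0: "\<And>w. w \<in> U \<Longrightarrow> S w = s"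
  shows "dv (\<lambda>u. (f u \<bullet> a) *\<^sub>R Z a u) u = Q a u \<bullet> Q a u - (f u \<bullet> a)\<^sup>2 * s - (f u \<bullet> a) * (N u \<bullet> a) * T u"
proof -
  define B where "B i j = E i u \<bullet> nu j u" for i j
  define \<Gamma> where "\<Gamma> k j m = E k u \<bullet> pd j (e m) u" for k j m
  define c where "c m = a \<bullet> E m u" for m
  let ?D = "\<lambda>j k. pd j (Q a) u \<bullet> E k u"
  have "dv (Z a) u = (\<Sum>j\<in>UNIV. \<Sum>k\<in>UNIV. ?D j k * (E j u \<bullet> nu k u)) + (\<Sum>k\<in>UNIV. (Q a u \<bullet> E k u) * pd k h u)"
    unfolding Z_def[abs_def]
  proof (rule dv_nu_combination[OF u])
    show "(\<lambda>u. Q a u \<bullet> E k u) differentiable (at u)" for k using u by auto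
    show "pd j (\<lambda>u. Q a u \<bullet> E k u) u = ?D j k - (\<Sum>m\<in>UNIV. (Q a u \<bullet> E m u) * (E k u \<bullet> pd j (e m) u))" for j k
      using u pd_component[OF u, of "Q a u" j k] Q_f[OF u, of a] Q_N[OF u, of a]
      by (simp add: pd_inner inner_commute)
  qed
  moreover have "pd k h u = 0" for k using pd_const_open[OF u h0] .
  ultimately have dvZ: "dv (Z a) u = (\<Sum>j\<in>UNIV. \<Sum>i\<in>UNIV. ?D j i * B j i)"
    by (simp add: B_def)
  have dQ: "?D j i = - (f u \<bullet> a) * B i j - (N u \<bullet> a) * (\<Sum>k\<in>UNIV. B k j * B i k)
      - (\<Sum>k\<in>UNIV. \<Sum>m\<in>UNIV. c m * \<Gamma> k j m * B i k) + (\<Sum>k\<in>UNIV. c k * (E i u \<bullet> pd k (nu j) u))" for i j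
  proof -
    have "pd j (Q a) u = (\<Sum>k\<in>UNIV. (a \<bullet> pd j (E k) u) *\<^sub>R nu k u + c k *\<^sub>R pd k (nu j) u)"
      unfolding Q_def[abs_def] using u
      by (subst pd_sum) (auto simp: pd_scaleR pd_inner c_def nu_commute add.commute)
    then have "?D j i = (\<Sum>k\<in>UNIV. (a \<bullet> pd j (E k) u) * B i k) + (\<Sum>k\<in>UNIV. c k * (E i u \<bullet> pd k (nu j) u))"
      by (simp add: inner_sum_left inner_add_left sum.distrib) (simp add: B_def inner_commute)
    also have "(\<Sum>k\<in>UNIV. (a \<bullet> pd j (E k) u) * B i k) = - (f u \<bullet> a) * (\<Sum>k\<in>UNIV. (if j = k then 1 else 0) * B i k)
       - (N u \<bullet> a) * (\<Sum>k\<in>UNIV. B k j * B i k) - (\<Sum>k\<in>UNIV. \<Sum>m\<in>UNIV. c m * \<Gamma> k j m * B i k)"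
      unfolding pd_component[OF u] B_def[symmetric] \<Gamma>_def[symmetric] c_def[symmetric]
      by (simp only: left_diff_distrib sum_subtractf sum_distrib_left sum_distrib_right mult.assoc)
    finally show ?thesis by simp
  qed
  \<comment> \<open>Constancy of \<open>S\<close>, with the partial derivatives of the matrix
    \<open>B\<close> on one side and the Christoffel corrections on the other.\<close>
  have dS: "(\<Sum>i\<in>UNIV. \<Sum>j\<in>UNIV. B j i * (E i u \<bullet> pd k (nu j) u)) = (\<Sum>i\<in>UNIV. \<Sum>j\<in>UNIV. \<Sum>m\<in>UNIV. \<Gamma> i k m * B m j * B j i)" for k
  proof -
    have dB: "pd k (\<lambda>u. E i u \<bullet> nu j u) u = (E i u \<bullet> pd k (nu j) u) - (\<Sum>m\<in>UNIV. \<Gamma> i k m * B m j)" for i j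
    proof -
      have "pd k (E i) u \<bullet> nu j u = - (\<Sum>m\<in>UNIV. \<Gamma> i k m * B m j)"
        by (subst inner_expand'[OF u]) (simp add: pd_E[OF u] orth u sum_negf \<Gamma>_def B_def)
      then show ?thesis using u by (simp add: pd_inner)
    qed
    have "0 = pd k S u" using pd_const_open[OF u S0] by simp
    also have "\<dots> = (\<Sum>i\<in>UNIV. pd k (\<lambda>u. \<Sum>j\<in>UNIV. (E i u \<bullet> nu j u) * (E j u \<bullet> nu i u)) u)"
      unfolding S_def[abs_def] using u by (subst pd_sum) auto
    also have "\<dots> = (\<Sum>i\<in>UNIV. \<Sum>j\<in>UNIV. B i j * pd k (\<lambda>u. E j u \<bullet> nu i u) u + pd k (\<lambda>u. E i u \<bullet> nu j u) u * B j i)"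
      using u by (subst pd_sum) (auto simp: pd_mult B_def differentiable_inner')
    also have "\<dots> = 2 * (\<Sum>i\<in>UNIV. \<Sum>j\<in>UNIV. pd k (\<lambda>u. E i u \<bullet> nu j u) u * B j i)"
      unfolding sum.distrib by (subst (1) sum.swap) (simp add: mult.commute)
    finally have "(\<Sum>i\<in>UNIV. \<Sum>j\<in>UNIV. pd k (\<lambda>u. E i u \<bullet> nu j u) u * B j i) = 0" by simp
    then show ?thesis
      unfolding dB by (simp add: algebra_simps sum_subtractf sum_distrib_left)
  qed
  have t1: "(\<Sum>j\<in>UNIV. \<Sum>i\<in>UNIV. B i j * B j i) = s"
    using S0[OF u] unfolding S_def B_def[symmetric] by (simp add: mult.commute)
  have t2: "(\<Sum>j\<in>UNIV. \<Sum>i\<in>UNIV. (\<Sum>k\<in>UNIV. B k j * B i k) * B j i) = T u"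
    unfolding T_def B_def[symmetric]
    by (simp add: sum_distrib_left sum_distrib_right mult_ac)
  \<comment> \<open>Symmetry of the lower Christoffel indices and reordering of the sums bring these
    terms to the right-hand side of \<open>dS\<close>, so that they cancel against
    \<open>t4\<close>.\<close>
  have t3: "(\<Sum>j\<in>UNIV. \<Sum>i\<in>UNIV. (\<Sum>k\<in>UNIV. \<Sum>m\<in>UNIV. c m * \<Gamma> k j m * B i k) * B j i) =
      (\<Sum>m\<in>UNIV. c m * (\<Sum>k\<in>UNIV. \<Sum>i\<in>UNIV. \<Sum>j\<in>UNIV. \<Gamma> k m j * B j i * B i k))"
  proof -
    let ?F = "\<lambda>j i k m. c m * (\<Gamma> k m j * B j i * B i k)"
    have sym: "\<Gamma> k j m = \<Gamma> k m j" for k j m by (simp add: \<Gamma>_def e_commute[OF u, of j m])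
    have "(\<Sum>j\<in>UNIV. \<Sum>i\<in>UNIV. (\<Sum>k\<in>UNIV. \<Sum>m\<in>UNIV. c m * \<Gamma> k j m * B i k) * B j i) =
       (\<Sum>j\<in>UNIV. \<Sum>i\<in>UNIV. \<Sum>k\<in>UNIV. \<Sum>m\<in>UNIV. ?F j i k m)"
      by (simp add: sum_distrib_left sum_distrib_right mult_ac) (simp add: sym)
    also have "\<dots> = (\<Sum>j\<in>UNIV. \<Sum>i\<in>UNIV. \<Sum>m\<in>UNIV. \<Sum>k\<in>UNIV. ?F j i k m)"
      by (intro sum.cong refl sum.swap)
    also have "\<dots> = (\<Sum>j\<in>UNIV. \<Sum>m\<in>UNIV. \<Sum>i\<in>UNIV. \<Sum>k\<in>UNIV. ?F j i k m)"
      by (intro sum.cong refl sum.swap)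
    also have "\<dots> = (\<Sum>m\<in>UNIV. \<Sum>j\<in>UNIV. \<Sum>i\<in>UNIV. \<Sum>k\<in>UNIV. ?F j i k m)"
      by (rule sum.swap)
    also have "\<dots> = (\<Sum>m\<in>UNIV. \<Sum>j\<in>UNIV. \<Sum>k\<in>UNIV. \<Sum>i\<in>UNIV. ?F j i k m)"
      by (intro sum.cong refl sum.swap)
    also have "\<dots> = (\<Sum>m\<in>UNIV. \<Sum>k\<in>UNIV. \<Sum>j\<in>UNIV. \<Sum>i\<in>UNIV. ?F j i k m)"
      by (intro sum.cong refl sum.swap)
    also have "\<dots> = (\<Sum>m\<in>UNIV. \<Sum>k\<in>UNIV. \<Sum>i\<in>UNIV. \<Sum>j\<in>UNIV. ?F j i k m)"
      by (intro sum.cong refl sum.swap)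
    finally show ?thesis by (simp add: sum_distrib_left)
  qed
  have t4: "(\<Sum>j\<in>UNIV. \<Sum>i\<in>UNIV. (\<Sum>k\<in>UNIV. c k * (E i u \<bullet> pd k (nu j) u)) * B j i) =
      (\<Sum>k\<in>UNIV. c k * (\<Sum>i\<in>UNIV. \<Sum>j\<in>UNIV. B j i * (E i u \<bullet> pd k (nu j) u)))"
  proof -
    let ?F = "\<lambda>j i k. c k * (B j i * (E i u \<bullet> pd k (nu j) u))"
    have "(\<Sum>j\<in>UNIV. \<Sum>i\<in>UNIV. (\<Sum>k\<in>UNIV. c k * (E i u \<bullet> pd k (nu j) u)) * B j i) =
        (\<Sum>j\<in>UNIV. \<Sum>i\<in>UNIV. \<Sum>k\<in>UNIV. ?F j i k)"
      by (simp add: sum_distrib_left mult_ac)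
    also have "\<dots> = (\<Sum>i\<in>UNIV. \<Sum>j\<in>UNIV. \<Sum>k\<in>UNIV. ?F j i k)"
      by (rule sum.swap)
    also have "\<dots> = (\<Sum>i\<in>UNIV. \<Sum>k\<in>UNIV. \<Sum>j\<in>UNIV. ?F j i k)"
      by (intro sum.cong refl sum.swap)
    also have "\<dots> = (\<Sum>k\<in>UNIV. \<Sum>i\<in>UNIV. \<Sum>j\<in>UNIV. ?F j i k)"
      by (rule sum.swap)
    finally show ?thesis by (simp add: sum_distrib_left)
  qed
  have lin: "(\<Sum>j\<in>UNIV. \<Sum>i\<in>UNIV. (y * p i j - z * q i j - r i j + t i j) * B j i) =
      y * (\<Sum>j\<in>UNIV. \<Sum>i\<in>UNIV. p i j * B j i) - z * (\<Sum>j\<in>UNIV. \<Sum>i\<in>UNIV. q i j * B j i)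
      - (\<Sum>j\<in>UNIV. \<Sum>i\<in>UNIV. r i j * B j i) + (\<Sum>j\<in>UNIV. \<Sum>i\<in>UNIV. t i j * B j i)" for y z :: real and p q r t
    by (simp add: left_diff_distrib distrib_right sum.distrib sum_subtractf sum_distrib_left mult.assoc)
  have "dv (Z a) u = - (f u \<bullet> a) * (\<Sum>j\<in>UNIV. \<Sum>i\<in>UNIV. B i j * B j i)
      - (N u \<bullet> a) * (\<Sum>j\<in>UNIV. \<Sum>i\<in>UNIV. (\<Sum>k\<in>UNIV. B k j * B i k) * B j i)
      - (\<Sum>j\<in>UNIV. \<Sum>i\<in>UNIV. (\<Sum>k\<in>UNIV. \<Sum>m\<in>UNIV. c m * \<Gamma> k j m * B i k) * B j i)
      + (\<Sum>j\<in>UNIV. \<Sum>i\<in>UNIV. (\<Sum>k\<in>UNIV. c k * (E i u \<bullet> pd k (nu j) u)) * B j i)"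
    unfolding dvZ dQ by (rule lin)
  then have dvZ': "dv (Z a) u = - (f u \<bullet> a) * s - (N u \<bullet> a) * T u"
    unfolding t1 t2 t3 t4 dS by simp
  have "(\<Sum>j\<in>UNIV. (e j u \<bullet> a) * (E j u \<bullet> Z a u)) = a \<bullet> Z a u"
    using inner_expand'[OF u, of a "Z a u"] Z_f[OF u, of a] Z_N[OF u, of a] by (simp add: inner_commute)
  also have "\<dots> = Q a u \<bullet> Q a u"
  proof -
    have "a \<bullet> Z a u = (\<Sum>k\<in>UNIV. (Q a u \<bullet> E k u) * (\<Sum>j\<in>UNIV. (a \<bullet> E j u) * (e j u \<bullet> nu k u)))"
      using inner_expand[OF u, of a "nu _ u"] by (simp add: Z_def inner_sum_right orth u)
    also have "\<dots> = (\<Sum>k\<in>UNIV. (Q a u \<bullet> E k u) * (e k u \<bullet> Q a u))"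
      using nu_sym[OF u] by (simp add: Q_def[of a u] inner_sum_right inner_commute)
    also have "\<dots> = Q a u \<bullet> Q a u"
      using inner_expand[OF u, of "Q a u" "Q a u"] Q_f[OF u, of a] Q_N[OF u, of a] by simp
    finally show ?thesis .
  qed
  finally have "(\<Sum>j\<in>UNIV. (e j u \<bullet> a) * (E j u \<bullet> Z a u)) = Q a u \<bullet> Q a u" .
  moreover have "(\<lambda>u. f u \<bullet> a) differentiable (at u)" using u by auto
  ultimately show ?thesis
    using u by (simp add: dv_scaleR pd_phi dvZ' algebra_simps power2_eq_square)
qed

section \<open>Volume density and divergence in coordinates\<close>

definition dens where "dens u = sqrt (det (G u))"

lemma Ck_dens: "Ck_on k U dens"
  unfolding dens_def[abs_def] by (intro Ck_on_sqrt Ck_on_det U det_G_pos Ck_G)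

text \<open>Jacobi's formula yields two equal traces, one from each factor in the derivative of the
  metric; together they compensate the factor 1/2 of the square root.\<close>

lemma pd_dens:
  assumes u: "u \<in> U"
  shows "pd m dens u = dens u * (\<Sum>i\<in>UNIV. E i u \<bullet> pd m (e i) u)"
proof -
  have dG: "(\<lambda>u. G u $ i $ j) differentiable (at u)" for i j
    using Ck_on_differentiable[OF Ck_G[of 1] _ u] by simp
  have dd: "(\<lambda>u. det (G u)) differentiable (at u)"
    by (rule Ck_on_differentiable[OF Ck_on_det[OF U Ck_G[of 1]]]) (auto simp: u)
  have "((\<lambda>u. sqrt (det (G u))) has_derivative (\<lambda>v. frechet_derivative (\<lambda>u. det (G u)) (at u) v * inverse (2 * sqrt (det (G u))))) (at u)"
    using det_G_pos[OF u] by (auto intro!: derivative_eq_intros frechet_works dd simp: field_simps)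
  from frechet_eqI[OF this]
  have "pd m dens u = pd m (\<lambda>u. det (G u)) u * inverse (2 * sqrt (det (G u)))"
    unfolding dens_def[abs_def] pd_def by simp
  also have "pd m (\<lambda>u. det (G u)) u = det (G u) * (2 * (\<Sum>i\<in>UNIV. E i u \<bullet> pd m (e i) u))"
  proof -
    have "(\<Sum>i\<in>UNIV. \<Sum>j\<in>UNIV. matrix_inv (G u) $ i $ j * pd m (\<lambda>u. G u $ j $ i) u) =
       (\<Sum>i\<in>UNIV. \<Sum>j\<in>UNIV. matrix_inv (G u) $ j $ i * (e i u \<bullet> pd m (e j) u)) +
       (\<Sum>i\<in>UNIV. \<Sum>j\<in>UNIV. matrix_inv (G u) $ i $ j * (e j u \<bullet> pd m (e i) u))"
      using ginv_sym[OF u] by (simp add: pd_G[OF u] sum.distrib distrib_left inner_commute)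
    also have "(\<Sum>i\<in>UNIV. \<Sum>j\<in>UNIV. matrix_inv (G u) $ j $ i * (e i u \<bullet> pd m (e j) u)) =
       (\<Sum>j\<in>UNIV. \<Sum>i\<in>UNIV. matrix_inv (G u) $ j $ i * (e i u \<bullet> pd m (e j) u))"
      by (rule sum.swap)
    finally show ?thesis
      unfolding pd_det[OF dG invertible_G[OF u]] by (simp add: ginv_e[OF u])
  qed
  finally have "pd m dens u = det (G u) * inverse (sqrt (det (G u))) * (\<Sum>i\<in>UNIV. E i u \<bullet> pd m (e i) u)"
    by simp
  also have "det (G u) * inverse (sqrt (det (G u))) = dens u"
    using det_G_pos[OF u] by (simp add: dens_def field_simps)
  finally show ?thesis .
qed

text \<open>The left side is a flat divergence, which Lebesgue integration can handle. The
  derivative of the density and that of the dual frame contribute the same Christoffel trace with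
  opposite signs; tangency of \<open>W\<close> removes the remaining normal terms.\<close>

lemma pd_dens_component:
  assumes u: "u \<in> U" and W: "W differentiable (at u)" "W u \<bullet> f u = 0" "W u \<bullet> N u = 0"
  shows "(\<Sum>i\<in>UNIV. pd i (\<lambda>u. dens u * (W u \<bullet> E i u)) u) = dens u * dv W u"
proof -
  have dd: "dens differentiable (at u)"
    by (rule Ck_on_differentiable[OF Ck_dens[of 1]]) (auto simp: u)
  have "W u \<bullet> pd i (E i) u = - (\<Sum>m\<in>UNIV. (W u \<bullet> E m u) * (E i u \<bullet> pd m (e i) u))" for i
    using W by (simp add: pd_component[OF u] inner_commute[of _ "W u"] e_commute[OF u, of i])
  moreover define X where "X i = (\<Sum>m\<in>UNIV. (W u \<bullet> E m u) * (E i u \<bullet> pd m (e i) u))" for i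
  moreover define Y where "Y i = (\<Sum>m\<in>UNIV. E m u \<bullet> pd i (e m) u) * (W u \<bullet> E i u)" for i
  ultimately have "pd i (\<lambda>u. dens u * (W u \<bullet> E i u)) u = dens u * (E i u \<bullet> pd i W u) - dens u * X i + dens u * Y i" for i
    using u dd W(1) by (simp add: pd_mult pd_inner pd_dens differentiable_inner' inner_commute[of "pd i W u"] distrib_left right_diff_distrib)
  moreover have "(\<Sum>i\<in>UNIV. X i) = (\<Sum>i\<in>UNIV. Y i)"
    unfolding X_def Y_def by (subst sum.swap) (simp add: sum_distrib_left mult.commute)
  ultimately show ?thesis
    by (simp add: sum.distrib sum_subtractf dv_def sum_distrib_left[symmetric])
qed

end

section \<open>Compactly supported functions\<close>

text \<open>By translation invariance all difference quotients of \<open>F\<close> have integral zero, and they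
  converge dominatedly to the derivative.\<close>

lemma integral_pd_compact_support:
  fixes F :: "real ^ 'n::finite \<Rightarrow> real"
  assumes C: "Ck_on 1 UNIV F" and Z: "\<And>u. u \<notin> cball c r \<Longrightarrow> F u = 0"
  shows "integrable lborel (pd i F)" "integral\<^sup>L lborel (pd i F) = 0"
proof -
  let ?b = "axis i (1::real)"
  have d: "F differentiable (at u)" for u using C by simp
  have cF: "continuous_on UNIV F" using Ck_on_imp_continuous_on[OF C] .
  have cD: "continuous_on UNIV (pd i F)" using C by (simp add: pd_def[abs_def])
  have zD: "pd i F u = 0" if "u \<notin> cball c r" for u
    using pd_cong_open[of "- cball c r" u F "\<lambda>_. 0" i] Z that by auto
  have int: "integrable lborel g" if "continuous_on UNIV g" "\<And>u. u \<notin> cball c r \<Longrightarrow> g u = 0" for g :: "real ^ 'n \<Rightarrow> real"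
  proof -
    have "integrable lborel (\<lambda>u. indicator (cball c r) u *\<^sub>R g u)"
      by (rule borel_integrable_compact) (auto intro: continuous_on_subset[OF that(1)])
    moreover have "(\<lambda>u. indicator (cball c r) u *\<^sub>R g u) = g"
      by (rule ext) (use that(2) in \<open>auto simp: indicator_def\<close>)
    ultimately show ?thesis by simp
  qed
  show "integrable lborel (pd i F)" by (rule int[OF cD zD])
  have "bounded (pd i F ` cball c r)"
    by (intro compact_imp_bounded compact_continuous_image) (auto intro: continuous_on_subset[OF cD])
  then obtain B where B: "B > 0" "\<And>u. u \<in> cball c r \<Longrightarrow> \<bar>pd i F u\<bar> \<le> B"
    unfolding bounded_pos by auto
  then have B': "\<bar>pd i F u\<bar> \<le> B" for u using zD[of u] by (cases "u \<in> cball c r") auto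
  \<comment> \<open>Steps of length at most 1 keep the support of every difference quotient inside
    the ball of radius r + 1. There the mean value theorem bounds the quotients by \<open>B\<close>,
    which provides the integrable majorant.\<close>
  define t where "t k = 1 / real (Suc k)" for k
  have t: "t k > 0" "t k \<le> 1" for k by (auto simp: t_def)
  define s where "s k u = (F (u + t k *\<^sub>R ?b) - F u) / t k" for k u
  have "(\<lambda>k. integral\<^sup>L lborel (s k)) \<longlonglongrightarrow> integral\<^sup>L lborel (pd i F)"
  proof (rule integral_dominated_convergence[where w="\<lambda>u. indicator (cball c (r + 1)) u *\<^sub>R B"])
    show "pd i F \<in> borel_measurable lborel"
      using borel_measurable_continuous_onI[OF cD] by simp
    have "continuous_on UNIV (s k)" for k
      unfolding s_def[abs_def] using t
      by (intro continuous_intros continuous_on_compose2[OF cF]) (auto simp: less_imp_neq[symmetric])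
    then show "s k \<in> borel_measurable lborel" for k
      using borel_measurable_continuous_onI by auto
    show "integrable lborel (\<lambda>u. indicator (cball c (r + 1)) u *\<^sub>R B)"
      by (rule borel_integrable_compact) auto
    show "AE u in lborel. (\<lambda>k. s k u) \<longlonglongrightarrow> pd i F u"
    proof (rule AE_I2)
      fix u
      have "((\<lambda>s. F (u + s *\<^sub>R ?b)) has_real_derivative frechet_derivative F (at (u + 0 *\<^sub>R ?b)) ?b) (at 0)"
        by (rule has_real_derivative_line) (rule d)
      then have "((\<lambda>h. (F (u + h *\<^sub>R ?b) - F u) / h) \<longlongrightarrow> pd i F u) (at 0)"
        by (simp add: DERIV_def pd_def)
      moreover have "filterlim t (at 0) sequentially"
      proof (rule filterlim_atI)
        show "t \<longlonglongrightarrow> 0"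
          unfolding t_def[abs_def] using LIMSEQ_inverse_real_of_nat by (simp only: inverse_eq_divide)
        show "\<forall>\<^sub>F k in sequentially. t k \<noteq> 0" using t(1) by (simp add: less_imp_neq[symmetric])
      qed
      ultimately show "(\<lambda>k. s k u) \<longlonglongrightarrow> pd i F u"
        unfolding s_def by (rule filterlim_compose)
    qed
    show "AE u in lborel. norm (s k u) \<le> indicator (cball c (r + 1)) u *\<^sub>R B" for k
    proof (rule AE_I2)
      fix u
      show "norm (s k u) \<le> indicator (cball c (r + 1)) u *\<^sub>R B"
      proof (cases "u \<in> cball c (r + 1)")
        case True
        have "\<exists>z>0. z < t k \<and> F (u + t k *\<^sub>R ?b) - F (u + 0 *\<^sub>R ?b) = (t k - 0) * frechet_derivative F (at (u + z *\<^sub>R ?b)) ?b"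
          by (rule MVT2[OF t(1)]) (rule has_real_derivative_line[OF d])
        then obtain z where "F (u + t k *\<^sub>R ?b) - F u = t k * pd i F (u + z *\<^sub>R ?b)"
          by (auto simp: pd_def)
        then have "s k u = pd i F (u + z *\<^sub>R ?b)" using t(1)[of k] by (simp add: s_def)
        then show ?thesis using True B' by simp
      next
        case False
        have "dist (u + t k *\<^sub>R ?b) u \<le> 1" using t[of k] by (simp add: dist_norm)
        then have "u + t k *\<^sub>R ?b \<notin> cball c r" "u \<notin> cball c r"
          using False dist_triangle[of c u "u + t k *\<^sub>R ?b"] by auto
        then show ?thesis using False by (simp add: s_def Z)
      qed
    qed
  qed
  moreover have "integral\<^sup>L lborel (s k) = 0" for k
  proof -
    have iF: "integrable lborel F" by (rule int[OF cF Z])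
    have mF: "F \<in> borel_measurable borel" using borel_measurable_continuous_onI[OF cF] .
    have "integral\<^sup>L lborel F = integral\<^sup>L (distr lborel borel ((+) (t k *\<^sub>R ?b))) F"
      by (simp add: lborel_distr_plus)
    also have "\<dots> = integral\<^sup>L lborel (\<lambda>u. F (t k *\<^sub>R ?b + u))"
      by (rule integral_distr) (use mF in auto)
    finally have e: "integral\<^sup>L lborel (\<lambda>u. F (u + t k *\<^sub>R ?b)) = integral\<^sup>L lborel F"
      by (simp add: add.commute)
    have "integrable (distr lborel borel ((+) (t k *\<^sub>R ?b))) F"
      using iF by (simp add: lborel_distr_plus)
    then have "integrable lborel (\<lambda>u. F (t k *\<^sub>R ?b + u))"
      by (subst (asm) integrable_distr_eq) (use mF in auto)
    then have "integrable lborel (\<lambda>u. F (u + t k *\<^sub>R ?b))" by (simp add: add.commute)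
    then show ?thesis unfolding s_def using iF e by simp
  qed
  ultimately show "integral\<^sup>L lborel (pd i F) = 0"
    by (simp add: LIMSEQ_const_iff)
qed

text \<open>Squaring the positive part makes it C^1 across 0, so that it can serve as the profile of
  the cutoffs.\<close>

lemma pos_part_square_derivative: "((\<lambda>t::real. (max 0 t)\<^sup>2) has_real_derivative 2 * max 0 t) (at t)"
proof -
  consider "t > 0" | "t < 0" | "t = 0" by linarith
  then show ?thesis
  proof cases
    case 1
    have "((\<lambda>t::real. t\<^sup>2) has_real_derivative 2 * max 0 t) (at t)"
      using 1 by (auto intro!: derivative_eq_intros)
    then show ?thesis
      by (rule has_field_derivative_transform_within_open[of _ _ _ "{0<..}"]) (use 1 in auto)
  next
    case 2
    have "((\<lambda>t::real. 0) has_real_derivative 2 * max 0 t) (at t)" using 2 by simp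
    then show ?thesis
      by (rule has_field_derivative_transform_within_open[of _ _ _ "{..<0}"]) (use 2 in auto)
  next
    case 3
    \<comment> \<open>At the origin the difference quotient of the squared positive part is the
      positive part itself, which tends to 0.\<close>
    have "((\<lambda>h::real. max 0 h) \<longlongrightarrow> max 0 0) (at 0)"
      by (intro tendsto_intros)
    moreover have "\<forall>\<^sub>F h in at (0::real). max 0 h = ((max 0 (0 + h))\<^sup>2 - (max 0 0)\<^sup>2) / h"
      unfolding eventually_at_filter by (simp add: max_def power2_eq_square)
    ultimately have "((\<lambda>h::real. ((max 0 (0 + h))\<^sup>2 - (max 0 0)\<^sup>2) / h) \<longlongrightarrow> 0) (at 0)"
      using tendsto_cong by fastforce
    then show ?thesis using 3 by (simp add: DERIV_def)
  qed
qed

lemma Ck_on_pos_part_square: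
  fixes g :: "'a::real_normed_vector \<Rightarrow> real"
  assumes U: "open U" and g: "Ck_on 1 U g"
  shows "Ck_on 1 U (\<lambda>u. (max 0 (g u))\<^sup>2)"
proof -
  have d: "((\<lambda>u. (max 0 (g u))\<^sup>2) has_derivative (\<lambda>v. 2 * max 0 (g u) * frechet_derivative g (at u) v)) (at u)" if "u \<in> U" for u
    using has_derivative_compose[where f=g and x=u and g="\<lambda>t. (max 0 t)\<^sup>2", OF frechet_works pos_part_square_derivative[of "g u", unfolded has_field_derivative_def]] g that
    by simp
  have "continuous_on U g" using Ck_on_imp_continuous_on[OF g] .
  then have "Ck_on 0 U (\<lambda>u. 2 * max 0 (g u) * frechet_derivative g (at u) v)" for v
    using g by (auto intro!: continuous_intros)
  then have "Ck_on 0 U (\<lambda>u. frechet_derivative (\<lambda>u. (max 0 (g u))\<^sup>2) (at u) v)" for v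
    by (subst Ck_on_cong[OF U]) (auto simp: frechet_eqI[OF d])
  with d show ?thesis by (auto simp: differentiable_def)
qed

section \<open>Charts\<close>

locale hypersurface =
  fixes M :: "'m::t2_space set" and \<A> :: "('n::finite, 'm) param set"
    and x \<nu> :: "'m \<Rightarrow> 'v::euclidean_space"
  assumes hyp: "closed_immersed_hypersurface M \<A> x \<nu>"
begin

lemma compact_M: "compact M"
  using hyp by (simp add: closed_immersed_hypersurface_def)

lemma chart:
  assumes "(U, \<phi>) \<in> \<A>"
  shows "open U" "openin (top_of_set M) (\<phi> ` U)" "\<exists>\<phi>'. homeomorphism U (\<phi> ` U) \<phi> \<phi>'"
    "continuous_on U \<phi>" "inj_on \<phi> U" "\<phi> ` U \<subseteq> M"
proof -
  have "smooth_atlas M \<A>" using hyp by (simp add: closed_immersed_hypersurface_def)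
  then have 1: "open U \<and> openin (top_of_set M) (\<phi> ` U) \<and> (\<exists>\<phi>'. homeomorphism U (\<phi> ` U) \<phi> \<phi>')"
    using assms unfolding smooth_atlas_def by blast
  then obtain \<phi>' where "homeomorphism U (\<phi> ` U) \<phi> \<phi>'" by blast
  then show "continuous_on U \<phi>" "inj_on \<phi> U"
    by (auto simp: homeomorphism_def intro: inj_on_inverseI)
  from 1 show "open U" "openin (top_of_set M) (\<phi> ` U)" "\<exists>\<phi>'. homeomorphism U (\<phi> ` U) \<phi> \<phi>'" by auto
  then show "\<phi> ` U \<subseteq> M" using openin_imp_subset by blast
qed

lemma charts_cover: "p \<in> M \<Longrightarrow> \<exists>U \<phi>. (U, \<phi>) \<in> \<A> \<and> p \<in> \<phi> ` U"
  using hyp by (auto simp: closed_immersed_hypersurface_def smooth_atlas_def)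

lemma transition:
  assumes "(U, \<phi>) \<in> \<A>" "(V, \<theta>) \<in> \<A>"
  shows "smooth_on (U \<inter> \<phi> -` (\<theta> ` V)) (inv_into V \<theta> \<circ> \<phi>)" "open (U \<inter> \<phi> -` (\<theta> ` V))"
proof -
  have "smooth_atlas M \<A>" using hyp by (simp add: closed_immersed_hypersurface_def)
  then show "smooth_on (U \<inter> \<phi> -` (\<theta> ` V)) (inv_into V \<theta> \<circ> \<phi>)"
    using assms unfolding smooth_atlas_def by blast
  have "openin (top_of_set U) (U \<inter> \<phi> -` (\<theta> ` V))"
    by (rule continuous_openin_preimage[OF chart(4)[OF assms(1)] _ chart(2)[OF assms(2)]])
       (use chart(6)[OF assms(1)] in auto)
  then show "open (U \<inter> \<phi> -` (\<theta> ` V))"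
    using chart(1)[OF assms(1)] openin_open_trans by blast
qed

lemma inv_chart: "(U, \<phi>) \<in> \<A> \<Longrightarrow> u \<in> U \<Longrightarrow> inv_into U \<phi> (\<phi> u) = u"
  using chart(5) inv_into_f_f by metis

lemma chart_image_ball:
  assumes "(U, \<phi>) \<in> \<A>" "open B" "B \<subseteq> U"
  shows "openin (top_of_set M) (\<phi> ` B)"
proof -
  obtain \<phi>' where "homeomorphism U (\<phi> ` U) \<phi> \<phi>'" using chart(3)[OF assms(1)] by blast
  then have "openin (top_of_set (\<phi> ` U)) (\<phi> ` B)"
    by (rule homeomorphism_imp_open_map) (use assms in \<open>simp add: open_openin_trans openin_open_eq chart(1)\<close>)
  then show ?thesis using chart(2)[OF assms(1)] openin_trans by blast
qed

lemma chart_patch: "(U, \<phi>) \<in> \<A> \<Longrightarrow> patch U (x \<circ> \<phi>) (\<nu> \<circ> \<phi>)"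
proof -
  assume c: "(U, \<phi>) \<in> \<A>"
  have M: "\<phi> u \<in> M" if "u \<in> U" for u using chart(6)[OF c] that by blast
  have n: "norm (x p) = 1" "norm (\<nu> p) = 1" "\<nu> p \<bullet> x p = 0" if "p \<in> M" for p
    using hyp that by (auto simp: closed_immersed_hypersurface_def image_subset_iff)
  show ?thesis
  proof
    show "DIM('v) = CARD('n) + 2" using hyp by (simp add: closed_immersed_hypersurface_def)
    show "open U" using chart(1)[OF c] .
    show "smooth_on U (x \<circ> \<phi>)" "smooth_on U (\<nu> \<circ> \<phi>)"
      using hyp c by (auto simp: closed_immersed_hypersurface_def immersion_def smooth_map_def)
    show "(x \<circ> \<phi>) u \<bullet> (x \<circ> \<phi>) u = 1" "(\<nu> \<circ> \<phi>) u \<bullet> (\<nu> \<circ> \<phi>) u = 1" "(\<nu> \<circ> \<phi>) u \<bullet> (x \<circ> \<phi>) u = 0"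
      if "u \<in> U" for u
      using n[OF M[OF that]] by (simp_all add: norm_eq_1)
    show "(\<nu> \<circ> \<phi>) u \<bullet> frechet_derivative (x \<circ> \<phi>) (at u) X = 0" if "u \<in> U" for u X
      using hyp c that by (auto simp: closed_immersed_hypersurface_def)
    show "inj (frechet_derivative (x \<circ> \<phi>) (at u))" if "u \<in> U" for u
      using hyp c that by (auto simp: closed_immersed_hypersurface_def immersion_def)
  qed
qed

lemma param_at:
  assumes "p \<in> M"
  obtains U \<phi> where "param_at \<A> p = (U, \<phi>)" "(U, \<phi>) \<in> \<A>" "coord_at \<A> p \<in> U" "\<phi> (coord_at \<A> p) = p"
    "\<And>F :: 'm \<Rightarrow> 'c. local_rep \<A> F p = F \<circ> \<phi>"
proof -
  have "\<exists>c. c \<in> \<A> \<and> p \<in> snd c ` fst c" using charts_cover[OF assms] by force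
  then have "param_at \<A> p \<in> \<A> \<and> p \<in> snd (param_at \<A> p) ` fst (param_at \<A> p)"
    unfolding param_at_def by (rule someI_ex)
  moreover obtain U \<phi> where c: "param_at \<A> p = (U, \<phi>)" by fastforce
  ultimately have "(U, \<phi>) \<in> \<A>" "p \<in> \<phi> ` U" by auto
  moreover from this have "coord_at \<A> p \<in> U" "\<phi> (coord_at \<A> p) = p"
    by (auto simp: coord_at_def c inv_into_into f_inv_into_f)
  ultimately show thesis using that c by (simp add: local_rep_def)
qed

section \<open>Chart-independent derivatives and divergence\<close>

definition C1 :: "('m \<Rightarrow> 'w::real_normed_vector) \<Rightarrow> bool"
  where "C1 W \<longleftrightarrow> (\<forall>(U, \<phi>)\<in>\<A>. Ck_on 1 U (W \<circ> \<phi>))"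

definition C0 :: "('m \<Rightarrow> real) \<Rightarrow> bool"
  where "C0 F \<longleftrightarrow> (\<forall>(U, \<phi>)\<in>\<A>. continuous_on U (F \<circ> \<phi>))"

lemma C1D: "C1 W \<Longrightarrow> (U, \<phi>) \<in> \<A> \<Longrightarrow> Ck_on 1 U (W \<circ> \<phi>)"
  by (auto simp: C1_def)

lemma C1_differentiable: "C1 W \<Longrightarrow> (U, \<phi>) \<in> \<A> \<Longrightarrow> u \<in> U \<Longrightarrow> (W \<circ> \<phi>) differentiable (at u)"
  using Ck_on_differentiable[OF C1D] by simp

lemma C1_C0: "C1 F \<Longrightarrow> C0 F"
  using Ck_on_imp_continuous_on C1D unfolding C0_def by fast

text \<open>The derivative along the tangential part of an ambient vector. Admitting ambient
  directions allows traces over the fixed basis of the ambient space, with no local frame to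
  choose.\<close>

definition tangent_deriv :: "('m \<Rightarrow> 'w::real_normed_vector) \<Rightarrow> 'm \<Rightarrow> 'v \<Rightarrow> 'w"
  where "tangent_deriv W p v = frechet_derivative (W \<circ> snd (param_at \<A> p)) (at (coord_at \<A> p))
    (tangent_comp (x \<circ> snd (param_at \<A> p)) (coord_at \<A> p) v)"

text \<open>Independence of the chart: the transition map has an invertible derivative \<open>J\<close>, and the
  coordinates of the tangent part of \<open>v\<close> in the two charts are related by \<open>J\<close>.\<close>

lemma tangent_deriv_chart:
  assumes c: "(U, \<phi>) \<in> \<A>" and u: "u \<in> U" and W: "C1 W"
  shows "tangent_deriv W (\<phi> u) v = frechet_derivative (W \<circ> \<phi>) (at u) (tangent_comp (x \<circ> \<phi>) u v)"
proof -
  have pM: "\<phi> u \<in> M" using chart(6)[OF c] u by blast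
  then obtain U0 \<phi>0 where p0: "param_at \<A> (\<phi> u) = (U0, \<phi>0)" and c0: "(U0, \<phi>0) \<in> \<A>" and u0: "coord_at \<A> (\<phi> u) \<in> U0"
    and e0: "\<phi>0 (coord_at \<A> (\<phi> u)) = \<phi> u" by (rule param_at)
  define w where "w = coord_at \<A> (\<phi> u)"
  define \<tau> where "\<tau> = inv_into U0 \<phi>0 \<circ> \<phi>"
  define V where "V = U \<inter> \<phi> -` (\<phi>0 ` U0)"
  have V: "open V" "smooth_on V \<tau>" using transition[OF c c0] by (auto simp: V_def \<tau>_def)
  have uV: "u \<in> V" using u u0 e0 by (force simp: V_def)
  have \<tau>V: "\<phi> z = \<phi>0 (\<tau> z)" if "z \<in> V" for z
    using that by (auto simp: V_def \<tau>_def f_inv_into_f)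
  have \<tau>u: "\<tau> u = w"
    using inv_chart[OF c0 u0] e0 by (simp add: \<tau>_def w_def)
  have d\<tau>: "\<tau> differentiable (at u)"
    using V(2) uV Ck_on_differentiable[of 1 V \<tau> u] by (simp add: smooth_on_def)
  define J where "J = frechet_derivative \<tau> (at u)"
  have linJ: "linear J" unfolding J_def using d\<tau> by (rule linear_frechet_derivative)
  have chain: "frechet_derivative (F \<circ> \<phi>) (at u) = frechet_derivative (F \<circ> \<phi>0) (at w) \<circ> J" if "(F \<circ> \<phi>0) differentiable (at w)" for F :: "'m \<Rightarrow> 'c::real_normed_vector"
  proof -
    have "frechet_derivative (F \<circ> \<phi>) (at u) = frechet_derivative ((F \<circ> \<phi>0) \<circ> \<tau>) (at u)"
      by (rule frechet_cong_open(1)[OF V(1) uV]) (simp add: \<tau>V)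
    also have "\<dots> = frechet_derivative (F \<circ> \<phi>0) (at (\<tau> u)) \<circ> frechet_derivative \<tau> (at u)"
      by (rule frechet_derivative_compose) (use that \<tau>u d\<tau> in auto)
    finally show ?thesis by (simp add: \<tau>u J_def)
  qed
  interpret P0: patch U0 "x \<circ> \<phi>0" "\<nu> \<circ> \<phi>0" using c0 by (rule chart_patch)
  interpret P: patch U "x \<circ> \<phi>" "\<nu> \<circ> \<phi>" using c by (rule chart_patch)
  have wU: "w \<in> U0" using u0 by (simp add: w_def)
  have dx: "frechet_derivative (x \<circ> \<phi>) (at u) = frechet_derivative (x \<circ> \<phi>0) (at w) \<circ> J"
    by (rule chain) (rule P0.differentiable_frame(1)[OF wU])
  have dW: "frechet_derivative (W \<circ> \<phi>) (at u) = frechet_derivative (W \<circ> \<phi>0) (at w) \<circ> J"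
    by (rule chain) (rule C1_differentiable[OF W c0 wU])
  have "inj J" using P.inj_df[OF u] dx by (metis inj_on_imageI2)
  then have "surj J" using linJ linear_injective_imp_surjective by blast
  define X where "X = tangent_comp (x \<circ> \<phi>) u v"
  have "\<forall>Y. (v - frechet_derivative (x \<circ> \<phi>0) (at w) (J X)) \<bullet> frechet_derivative (x \<circ> \<phi>0) (at w) Y = 0"
  proof
    fix Y
    obtain Y' where "Y = J Y'" using \<open>surj J\<close> by (metis surjD)
    then show "(v - frechet_derivative (x \<circ> \<phi>0) (at w) (J X)) \<bullet> frechet_derivative (x \<circ> \<phi>0) (at w) Y = 0"
      using P.tangent_orth_iff[OF u, of v X] by (simp add: X_def P.tangent_comp_eq[OF u] dx)
  qed
  then have "J X = tangent_comp (x \<circ> \<phi>0) w v"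
    using P0.tangent_orth_iff[OF wU] by (simp add: P0.tangent_comp_eq[OF wU])
  then show ?thesis
    by (simp add: tangent_deriv_def p0 w_def[symmetric] dW X_def[symmetric])
qed

text \<open>An ambient trace that nevertheless sees only tangent directions, because
  \<open>tangent_deriv\<close> projects its direction first.\<close>

definition divg :: "('m \<Rightarrow> 'v) \<Rightarrow> 'm \<Rightarrow> real"
  where "divg W p = (\<Sum>b\<in>Basis. b \<bullet> tangent_deriv W p b)"

lemma sum_Basis_inner: "(\<Sum>b\<in>Basis. (b \<bullet> v) * (b \<bullet> w)) = v \<bullet> (w :: 'v)"
  using euclidean_inner[of v w] by (simp add: inner_commute)

lemma tangent_deriv_coord:
  assumes c: "(U, \<phi>) \<in> \<A>" and u: "u \<in> U" and W: "C1 W"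
  shows "tangent_deriv W (\<phi> u) v = (\<Sum>i\<in>UNIV. (v \<bullet> patch.E (x \<circ> \<phi>) i u) *\<^sub>R pd i (W \<circ> \<phi>) u)"
proof -
  interpret patch U "x \<circ> \<phi>" "\<nu> \<circ> \<phi>" using c by (rule chart_patch)
  show ?thesis
    unfolding tangent_deriv_chart[OF assms] by (simp add: frechet_derivative_eq_sum_pd C1_differentiable[OF W c u] tangent_comp_eq[OF u])
qed

lemma divg_chart:
  assumes c: "(U, \<phi>) \<in> \<A>" and u: "u \<in> U" and W: "C1 W"
  shows "divg W (\<phi> u) = patch.dv (x \<circ> \<phi>) (W \<circ> \<phi>) u"
proof -
  interpret patch U "x \<circ> \<phi>" "\<nu> \<circ> \<phi>" using c by (rule chart_patch)
  have "divg W (\<phi> u) = (\<Sum>i\<in>UNIV. \<Sum>b\<in>Basis. (b \<bullet> E i u) * (b \<bullet> pd i (W \<circ> \<phi>) u))"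
    unfolding divg_def tangent_deriv_coord[OF assms] by (simp add: inner_sum_right, rule sum.swap)
  then show ?thesis by (simp only: sum_Basis_inner dv_def)
qed

end

context hypersurface begin

lemma C1_const [simp]: "C1 (\<lambda>_. c)"
  by (simp add: C1_def comp_def)

lemma C1_bilinear:
  assumes "bounded_bilinear B" "C1 V" "C1 W"
  shows "C1 (\<lambda>p. B (V p) (W p))"
  unfolding C1_def
proof safe
  fix U \<phi> assume c: "(U, \<phi>) \<in> \<A>"
  have "Ck_on 1 U (\<lambda>u. B ((V \<circ> \<phi>) u) ((W \<circ> \<phi>) u))"
    by (rule Ck_on_bilinear[OF assms(1) chart(1)[OF c] C1D[OF assms(2) c] C1D[OF assms(3) c]])
  then show "Ck_on 1 U ((\<lambda>p. B (V p) (W p)) \<circ> \<phi>)" by (simp add: comp_def)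
qed

lemmas C1_scaleR = C1_bilinear[OF bounded_bilinear_scaleR]
  and C1_mult = C1_bilinear[OF bounded_bilinear_mult]

lemma C1_sum:
  assumes "\<And>i. i \<in> I \<Longrightarrow> C1 (W i)"
  shows "C1 (\<lambda>p. \<Sum>i\<in>I. W i p)"
  unfolding C1_def
proof safe
  fix U \<phi> assume c: "(U, \<phi>) \<in> \<A>"
  have "Ck_on 1 U (\<lambda>u. \<Sum>i\<in>I. (W i \<circ> \<phi>) u)"
    by (intro Ck_on_sum assms chart(1)[OF c] C1D[OF _ c])
  then show "Ck_on 1 U ((\<lambda>p. \<Sum>i\<in>I. W i p) \<circ> \<phi>)" by (simp add: comp_def)
qed

lemma C1_inverse:
  assumes "C1 F" "\<And>p. p \<in> M \<Longrightarrow> F p \<noteq> 0"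
  shows "C1 (\<lambda>p. inverse (F p) :: real)"
  unfolding C1_def
proof safe
  fix U \<phi> assume c: "(U, \<phi>) \<in> \<A>"
  have "Ck_on 1 U (\<lambda>u. inverse ((F \<circ> \<phi>) u))"
    by (intro Ck_on_inverse chart(1)[OF c] C1D[OF assms(1) c]) (use assms(2) chart(6)[OF c] in auto)
  then show "Ck_on 1 U ((\<lambda>p. inverse (F p)) \<circ> \<phi>)" by (simp add: comp_def)
qed

lemma tangent_deriv_local:
  assumes c: "(V, \<theta>) \<in> \<A>" and W: "C1 W" "C1 W'" and B: "open B" "u \<in> B" "B \<subseteq> V" "\<And>w. w \<in> B \<Longrightarrow> W (\<theta> w) = W' (\<theta> w)"
  shows "tangent_deriv W (\<theta> u) v = tangent_deriv W' (\<theta> u) v"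
proof -
  have "frechet_derivative (W \<circ> \<theta>) (at u) = frechet_derivative (W' \<circ> \<theta>) (at u)"
    by (rule frechet_cong_open(1)[OF B(1,2)]) (simp add: B)
  moreover have "u \<in> V" using B by blast
  ultimately show ?thesis by (simp add: tangent_deriv_chart[OF c _ W(1)] tangent_deriv_chart[OF c _ W(2)])
qed

lemma divg_cong:
  assumes W: "C1 W" "C1 W'" "\<And>p. p \<in> M \<Longrightarrow> W p = W' p" and p: "p \<in> M"
  shows "divg W p = divg W' p"
proof -
  obtain V \<theta> u where c: "(V, \<theta>) \<in> \<A>" "u \<in> V" "p = \<theta> u" using charts_cover[OF p] by blast
  have "tangent_deriv W (\<theta> u) b = tangent_deriv W' (\<theta> u) b" for b
    by (rule tangent_deriv_local[OF c(1) W(1,2) chart(1)[OF c(1)] c(2) order_refl]) (use W(3) chart(6)[OF c(1)] in blast)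
  then show ?thesis by (simp add: divg_def c(3))
qed

lemma divg_sum:
  assumes "finite I" "\<And>i. i \<in> I \<Longrightarrow> C1 (W i)" and p: "p \<in> M"
  shows "divg (\<lambda>p. \<Sum>i\<in>I. W i p) p = (\<Sum>i\<in>I. divg (W i) p)"
proof -
  obtain V \<theta> u where c: "(V, \<theta>) \<in> \<A>" "u \<in> V" "p = \<theta> u" using charts_cover[OF p] by blast
  interpret patch V "x \<circ> \<theta>" "\<nu> \<circ> \<theta>" using c(1) by (rule chart_patch)
  have "pd j (\<lambda>u. \<Sum>i\<in>I. W i (\<theta> u)) u = (\<Sum>i\<in>I. pd j (W i \<circ> \<theta>) u)" for j
    using pd_sum[of I "\<lambda>i. W i \<circ> \<theta>" u j] C1_differentiable[OF assms(2) c(1,2)] by (simp add: comp_def)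
  then have "dv ((\<lambda>p. \<Sum>i\<in>I. W i p) \<circ> \<theta>) u = (\<Sum>i\<in>I. dv (W i \<circ> \<theta>) u)"
    unfolding dv_def by (simp add: comp_def inner_sum_right) (rule sum.swap)
  moreover have "C1 (\<lambda>p. \<Sum>i\<in>I. W i p)" using assms(2) by (rule C1_sum)
  ultimately show ?thesis
    by (simp add: c(3) divg_chart[OF c(1,2)] assms(2))
qed

section \<open>The Riemannian volume\<close>

abbreviation vol where "vol \<equiv> riemannian_volume M \<A> x"
abbreviation gens where "gens \<equiv> (\<lambda>(c, B). snd c ` B) ` {(c, B). c \<in> \<A> \<and> B \<in> sets borel \<and> B \<subseteq> fst c}"

lemma gens_Pow: "gens \<subseteq> Pow M"
proof
  fix y assume "y \<in> gens"
  then obtain U \<phi> B where "(U, \<phi>) \<in> \<A>" "B \<subseteq> U" "y = \<phi> ` B" by auto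
  then show "y \<in> Pow M" using chart(6)[of U \<phi>] by blast
qed

lemma space_vol: "space vol = M" and sets_vol: "sets vol = sigma_sets M gens"
  unfolding riemannian_volume_def using gens_Pow by (rule space_extend_measure, rule sets_extend_measure)

lemma chart_image_sets: "(U, \<phi>) \<in> \<A> \<Longrightarrow> B \<in> sets borel \<Longrightarrow> B \<subseteq> U \<Longrightarrow> \<phi> ` B \<in> sets vol"
  unfolding sets_vol by (rule sigma_sets.Basic) force

definition volume_defined :: bool
  where "volume_defined \<longleftrightarrow> (\<forall>(U, \<phi>)\<in>\<A>. \<forall>B\<in>sets borel. B \<subseteq> U \<longrightarrow>
    emeasure vol (\<phi> ` B) = (\<integral>\<^sup>+u\<in>B. ennreal (sqrt (det (induced_metric (x \<circ> \<phi>) u))) \<partial>lborel))"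

text \<open>By construction of \<open>extend_measure\<close> the volume is the zero measure unless a measure with the
  prescribed values exists. All integrals then vanish, so existence need not be proved.\<close>

lemma volume_cases:
  obtains "volume_defined" | "emeasure vol = (\<lambda>_. 0)"
proof (cases "emeasure vol = (\<lambda>_. 0)")
  case False
  let ?I = "{(c, B). c \<in> \<A> \<and> B \<in> sets borel \<and> B \<subseteq> fst c}"
  let ?G = "\<lambda>(c, B). snd c ` B"
  let ?\<mu> = "\<lambda>(c, B). \<integral>\<^sup>+u\<in>B. ennreal (sqrt (det (induced_metric (x \<circ> snd c) u))) \<partial>lborel"
  have "\<exists>\<mu>'. (\<forall>i\<in>?I. \<mu>' (?G i) = ?\<mu> i) \<and> measure_space M (sigma_sets M (?G ` ?I)) \<mu>'"
  proof (rule ccontr)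
    assume "\<not> ?thesis"
    then have "vol = measure_of M (?G ` ?I) (\<lambda>_. 0)"
      unfolding riemannian_volume_def extend_measure_def by (simp only: if_False simp_thms)
    with False show False by (simp add: emeasure_sigma)
  qed
  then obtain \<mu>' where 1: "\<forall>i\<in>?I. \<mu>' (?G i) = ?\<mu> i" and 2: "measure_space M (sigma_sets M (?G ` ?I)) \<mu>'"
    by blast
  have "emeasure vol (?G i) = ?\<mu> i" if "i \<in> ?I" for i
    by (rule emeasure_extend_measure[OF riemannian_volume_def, where i=i and \<mu>'=\<mu>'])
       (use 1 2 gens_Pow that in \<open>auto simp: sets_vol measure_space_def\<close>)
  then have "volume_defined" unfolding volume_defined_def by force
  then show ?thesis using that by blast
qed (use that in blast)

lemma integral_vol_zero:
  assumes "emeasure vol = (\<lambda>_. 0)"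
  shows "integral\<^sup>L vol (F :: 'm \<Rightarrow> real) = 0"
  by (rule integral_eq_zero_AE) (simp add: AE_iff_null null_sets_def assms AE_I[of _ _ "space vol"])

text \<open>The open balls cover \<open>M\<close>, while the closed balls, still inside the chart
  domains, provide the compactness needed for supports and bounds.\<close>

lemma cover:
  obtains I :: "((real ^ 'n) set \<times> (real ^ 'n \<Rightarrow> 'm) \<times> (real ^ 'n) \<times> real) set" where
    "finite I" "\<And>U \<phi> w r. (U, \<phi>, w, r) \<in> I \<Longrightarrow> (U, \<phi>) \<in> \<A> \<and> cball w r \<subseteq> U \<and> 0 < r"
    "M = (\<Union>(U, \<phi>, w, r)\<in>I. \<phi> ` ball w r)"
proof -
  let ?J = "{(U, \<phi>, w, r). (U, \<phi>) \<in> \<A> \<and> cball w r \<subseteq> U \<and> 0 < r}"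
  let ?b = "\<lambda>(U, \<phi>, w, r). \<phi> ` ball w r"
  have op: "openin (top_of_set M) c" if "c \<in> ?b ` ?J" for c
    using that by (force intro: chart_image_ball)
  have "M \<subseteq> \<Union>(?b ` ?J)"
  proof
    fix p assume "p \<in> M"
    then obtain U \<phi> u where c: "(U, \<phi>) \<in> \<A>" "u \<in> U" "p = \<phi> u" using charts_cover by blast
    obtain r where r: "r > 0" "cball u r \<subseteq> U" using chart(1)[OF c(1)] c(2) open_contains_cball by blast
    then show "p \<in> \<Union>(?b ` ?J)" using c by (force intro!: bexI[of _ "(U, \<phi>, u, r)"])
  qed
  with op obtain D where D: "D \<subseteq> ?b ` ?J" "finite D" "M \<subseteq> \<Union>D"
    using compact_M unfolding compact_eq_openin_cover by meson
  then obtain I where I: "I \<subseteq> ?J" "finite I" "D = ?b ` I"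
    by (meson finite_subset_image)
  have "c \<subseteq> M" if "c \<in> ?b ` I" for c
  proof -
    have "c \<in> ?b ` ?J" using that image_mono[OF I(1)] by (rule rev_subsetD)
    then show ?thesis using op openin_imp_subset by blast
  qed
  then have "\<Union>(?b ` I) \<subseteq> M" by (rule Union_least)
  with D(3) have M: "M = \<Union>(?b ` I)" unfolding I(3) by (rule subset_antisym)
  show thesis
  proof (rule that)
    show "finite I" by fact
    show "(U, \<phi>) \<in> \<A> \<and> cball w r \<subseteq> U \<and> 0 < r" if "(U, \<phi>, w, r) \<in> I" for U \<phi> w r
      using subsetD[OF I(1) that] by simp
    show "M = (\<Union>(U, \<phi>, w, r)\<in>I. \<phi> ` ball w r)" by (fact M)
  qed
qed

text \<open>The \<sigma>-algebra of the volume is generated by chart images of Borel sets, so the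
  preimage of an open set has to be written as a finite union of such images.\<close>

lemma C0_measurable:
  assumes "C0 F"
  shows "F \<in> borel_measurable vol"
proof (rule borel_measurableI)
  fix O' :: "real set" assume O': "open O'"
  obtain I where I: "finite I" "\<And>U \<phi> w r. (U, \<phi>, w, r) \<in> I \<Longrightarrow> (U, \<phi>) \<in> \<A> \<and> cball w r \<subseteq> U \<and> 0 < r"
    "M = (\<Union>(U, \<phi>, w, r)\<in>I. \<phi> ` ball w r)" by (rule cover) blast
  have "F -` O' \<inter> space vol = (\<Union>i\<in>I. case i of (U, \<phi>, w, r) \<Rightarrow> \<phi> ` (ball w r \<inter> (F \<circ> \<phi>) -` O'))"
    unfolding space_vol by (subst I(3)) auto
  also have "\<dots> \<in> sets vol"
  proof (rule sets.finite_UN[OF I(1)])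
    fix i assume i: "i \<in> I"
    obtain U \<phi> w r where [simp]: "i = (U, \<phi>, w, r)" by (cases i)
    have c: "(U, \<phi>) \<in> \<A>" "ball w r \<subseteq> U" using I(2) i ball_subset_cball by fastforce+
    then have "continuous_on (ball w r) (F \<circ> \<phi>)" using assms unfolding C0_def by (auto intro: continuous_on_subset)
    then have "open (ball w r \<inter> (F \<circ> \<phi>) -` O')" using O' by (intro continuous_open_preimage) auto
    then show "(case i of (U, \<phi>, w, r) \<Rightarrow> \<phi> ` (ball w r \<inter> (F \<circ> \<phi>) -` O')) \<in> sets vol"
      using c by (auto intro!: chart_image_sets[OF c(1)])
  qed
  finally show "F -` O' \<inter> space vol \<in> sets vol" .
qed

lemma C0_bounded:
  assumes "C0 F"
  shows "\<exists>B. \<forall>p\<in>M. \<bar>F p\<bar> \<le> B"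
proof -
  obtain I where I: "finite I" "\<And>U \<phi> w r. (U, \<phi>, w, r) \<in> I \<Longrightarrow> (U, \<phi>) \<in> \<A> \<and> cball w r \<subseteq> U \<and> 0 < r"
    "M = (\<Union>(U, \<phi>, w, r)\<in>I. \<phi> ` ball w r)" by (rule cover) blast
  have "bounded (\<Union>(U, \<phi>, w, r)\<in>I. (F \<circ> \<phi>) ` cball w r)"
  proof (rule bounded_UN[OF I(1)], rule ballI)
    fix i assume i: "i \<in> I"
    obtain U \<phi> w r where [simp]: "i = (U, \<phi>, w, r)" by (cases i)
    have c: "(U, \<phi>) \<in> \<A>" "cball w r \<subseteq> U" using I(2) i by auto
    then have "continuous_on (cball w r) (F \<circ> \<phi>)" using assms unfolding C0_def by (auto intro: continuous_on_subset)
    then show "bounded (case i of (U, \<phi>, w, r) \<Rightarrow> (F \<circ> \<phi>) ` cball w r)"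
      by (simp add: compact_imp_bounded compact_continuous_image)
  qed
  then obtain B where B: "\<forall>y\<in>(\<Union>(U, \<phi>, w, r)\<in>I. (F \<circ> \<phi>) ` cball w r). norm y \<le> B"
    unfolding bounded_iff by blast
  have "\<bar>F p\<bar> \<le> B" if "p \<in> M" for p
  proof -
    have "p \<in> (\<Union>(U, \<phi>, w, r)\<in>I. \<phi> ` ball w r)" using that I(3) by simp
    then obtain i where i: "i \<in> I" "p \<in> (case i of (U, \<phi>, w, r) \<Rightarrow> \<phi> ` ball w r)" by (rule UN_E)
    obtain U \<phi> w r where [simp]: "i = (U, \<phi>, w, r)" by (cases i)
    have "F p \<in> (case i of (U, \<phi>, w, r) \<Rightarrow> (F \<circ> \<phi>) ` cball w r)"
      using i(2) ball_subset_cball by fastforce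
    with i(1) have "F p \<in> (\<Union>(U, \<phi>, w, r)\<in>I. (F \<circ> \<phi>) ` cball w r)" by (rule UN_I)
    from bspec[OF B this] show ?thesis by simp
  qed
  then show ?thesis by blast
qed

lemma finite_vol:
  assumes vd: "volume_defined"
  shows "finite_measure vol"
proof
  obtain I where I: "finite I" "\<And>U \<phi> w r. (U, \<phi>, w, r) \<in> I \<Longrightarrow> (U, \<phi>) \<in> \<A> \<and> cball w r \<subseteq> U \<and> 0 < r"
    "M = (\<Union>(U, \<phi>, w, r)\<in>I. \<phi> ` ball w r)" by (rule cover) blast
  let ?c = "\<lambda>(U, \<phi>, w, r). \<phi> ` ball w r"
  have 1: "?c i \<in> sets vol \<and> emeasure vol (?c i) < \<infinity>" if i: "i \<in> I" for i
  proof -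
    obtain U \<phi> w r where [simp]: "i = (U, \<phi>, w, r)" by (cases i)
    have c: "(U, \<phi>) \<in> \<A>" "cball w r \<subseteq> U" using I(2) i by auto
    then have b: "ball w r \<subseteq> U" using ball_subset_cball by blast
    interpret patch U "x \<circ> \<phi>" "\<nu> \<circ> \<phi>" using c(1) by (rule chart_patch)
    have "continuous_on (cball w r) dens"
      using Ck_on_imp_continuous_on[OF Ck_dens[of 0]] c(2) continuous_on_subset by blast
    then have "integrable lborel (\<lambda>u. indicator (cball w r) u *\<^sub>R dens u)"
      by (intro borel_integrable_compact) auto
    then have "(\<integral>\<^sup>+u. ennreal (norm (indicator (cball w r) u *\<^sub>R dens u)) \<partial>lborel) < \<infinity>"
      unfolding integrable_iff_bounded by simp
    moreover have "(\<integral>\<^sup>+u\<in>ball w r. ennreal (dens u) \<partial>lborel) \<le> (\<integral>\<^sup>+u. ennreal (norm (indicator (cball w r) u *\<^sub>R dens u)) \<partial>lborel)"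
      by (rule nn_integral_mono) (auto simp: indicator_def intro!: ennreal_leI)
    moreover have "emeasure vol (\<phi> ` ball w r) = (\<integral>\<^sup>+u\<in>ball w r. ennreal (dens u) \<partial>lborel)"
      using vd c(1) b unfolding volume_defined_def dens_def by auto
    ultimately show ?thesis using chart_image_sets[OF c(1) _ b] by auto
  qed
  have "emeasure vol (\<Union>i\<in>I. ?c i) \<le> (\<Sum>i\<in>I. emeasure vol (?c i))"
    using 1 by (intro emeasure_subadditive_finite I) auto
  also have "\<dots> < \<infinity>" using 1 I(1) by (simp add: less_top)
  finally show "emeasure vol (space vol) \<noteq> \<infinity>"
    unfolding space_vol by (subst I(3)) simp
qed

lemma C0_integrable:
  assumes vd: "volume_defined" and "C0 F"
  shows "integrable vol F"
proof -
  interpret finite_measure vol using vd by (rule finite_vol)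
  obtain B where "\<forall>p\<in>M. \<bar>F p\<bar> \<le> B" using C0_bounded[OF assms(2)] by blast
  then have "AE p in vol. norm (F p) \<le> B" by (intro AE_I2) (simp add: space_vol)
  then show ?thesis by (rule integrable_const_bound) (rule C0_measurable[OF assms(2)])
qed

text \<open>The volume restricted to the chart image is the push-forward of the measure with density
  \<open>dens\<close> on \<open>U\<close>. On sets this is the prescribed value of the volume;
  integrals then follow from the general rules for densities and image measures.\<close>

lemma integral_chart:
  assumes vd: "volume_defined" and c: "(U, \<phi>) \<in> \<A>" and F: "F \<in> borel_measurable vol"
    and z: "\<And>p. p \<in> M \<Longrightarrow> p \<notin> \<phi> ` U \<Longrightarrow> F p = 0"
  shows "integral\<^sup>L vol F = (\<integral>u. indicator U u * (patch.dens (x \<circ> \<phi>) u * F (\<phi> u)) \<partial>lborel)"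
proof -
  interpret patch U "x \<circ> \<phi>" "\<nu> \<circ> \<phi>" using c by (rule chart_patch)
  have Ub: "U \<in> sets borel" using U by simp
  have \<phi>U: "\<phi> ` U \<in> sets vol" by (rule chart_image_sets[OF c Ub]) simp
  \<comment> \<open>It suffices to test generators. One that comes from another chart pulls back to
    the preimage of a Borel set under the transition map, which is continuous on an open
    set.\<close>
  have mR [measurable]: "\<phi> \<in> measurable (restrict_space lborel U) vol"
  proof (rule measurable_sigma_sets[OF sets_vol gens_Pow])
    show "\<phi> \<in> space (restrict_space lborel U) \<rightarrow> M" using chart(6)[OF c] by (auto simp: space_restrict_space)
    fix y assume "y \<in> gens"
    then obtain V \<theta> B where y: "(V, \<theta>) \<in> \<A>" "B \<in> sets borel" "B \<subseteq> V" "y = \<theta> ` B" by auto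
    let ?V = "U \<inter> \<phi> -` (\<theta> ` V)" and ?\<tau> = "inv_into V \<theta> \<circ> \<phi>"
    have "\<phi> -` y \<inter> U = ?\<tau> -` B \<inter> ?V"
      using y(3) inv_chart[OF y(1)] by (auto simp: y(4))
    also have "\<dots> \<in> sets borel"
    proof -
      have "continuous_on ?V ?\<tau>"
        using transition(1)[OF c y(1)] unfolding smooth_on_def using Ck_on_imp_continuous_on by blast
      then have "?\<tau> \<in> borel_measurable (restrict_space borel ?V)"
        by (rule borel_measurable_continuous_on_restrict)
      then have "?\<tau> -` B \<inter> space (restrict_space borel ?V) \<in> sets (restrict_space borel ?V)"
        using y(2) by (rule measurable_sets)
      then show ?thesis
        using transition(2)[OF c y(1)] by (simp add: space_restrict_space sets_restrict_space_iff)
    qed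
    finally show "\<phi> -` y \<inter> space (restrict_space lborel U) \<in> sets (restrict_space lborel U)"
      using Ub by (simp add: space_restrict_space sets_restrict_space_iff)
  qed
  have md: "dens \<in> borel_measurable (restrict_space lborel U)"
    using borel_measurable_continuous_on_restrict[OF Ck_on_imp_continuous_on[OF Ck_dens[of 0]]]
    by (simp add: measurable_cong_sets[OF sets_restrict_space_cong[OF sets_lborel] refl])
  have md' [measurable]: "(\<lambda>u. ennreal (dens u)) \<in> borel_measurable (restrict_space lborel U)"
    using md by simp
  let ?N = "density (restrict_space lborel U) (\<lambda>u. ennreal (dens u))"
  have eq: "density vol (indicator (\<phi> ` U)) = distr ?N vol \<phi>"
  proof (rule measure_eqI)
    show "sets (density vol (indicator (\<phi> ` U))) = sets (distr ?N vol \<phi>)" by simp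
    fix A assume "A \<in> sets (density vol (indicator (\<phi> ` U)))"
    then have A: "A \<in> sets vol" by simp
    let ?B = "\<phi> -` A \<inter> U"
    have "?B \<in> sets (restrict_space lborel U)"
      using measurable_sets[OF mR A] by (simp add: space_restrict_space)
    then have B: "?B \<in> sets borel" using Ub by (simp add: sets_restrict_space_iff)
    have "emeasure (density vol (indicator (\<phi> ` U))) A = emeasure vol (\<phi> ` U \<inter> A)"
      using A \<phi>U by (simp add: emeasure_density nn_integral_indicator'[symmetric] indicator_inter_arith[symmetric] sets.Int)
    also have "\<phi> ` U \<inter> A = \<phi> ` ?B" by auto
    also have "emeasure vol (\<phi> ` ?B) = (\<integral>\<^sup>+u\<in>?B. ennreal (dens u) \<partial>lborel)"
      using vd c B unfolding volume_defined_def dens_def by auto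
    also have "\<dots> = (\<integral>\<^sup>+u. (ennreal (dens u) * indicator ?B u) * indicator U u \<partial>lborel)"
      by (rule nn_integral_cong) (auto simp: indicator_def)
    also have "\<dots> = (\<integral>\<^sup>+u. ennreal (dens u) * indicator ?B u \<partial>restrict_space lborel U)"
      using Ub by (subst nn_integral_restrict_space) auto
    also have "\<dots> = emeasure ?N ?B"
      by (subst emeasure_density) (use B Ub in \<open>auto simp: sets_restrict_space_iff\<close>)
    also have "\<dots> = emeasure (distr ?N vol \<phi>) A"
      using A by (subst emeasure_distr) (auto simp: space_restrict_space)
    finally show "emeasure (density vol (indicator (\<phi> ` U))) A = emeasure (distr ?N vol \<phi>) A" .
  qed
  have "integral\<^sup>L vol F = integral\<^sup>L vol (\<lambda>p. indicator (\<phi> ` U) p *\<^sub>R F p)"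
    by (rule Bochner_Integration.integral_cong) (use z in \<open>auto simp: space_vol indicator_def\<close>)
  also have "\<dots> = integral\<^sup>L (density vol (\<lambda>p. ennreal (indicator (\<phi> ` U) p))) F"
    using F \<phi>U by (subst integral_density) auto
  also have "\<dots> = integral\<^sup>L (distr ?N vol \<phi>) F"
    unfolding eq[symmetric] by (simp add: ennreal_indicator)
  also have "\<dots> = integral\<^sup>L ?N (\<lambda>u. F (\<phi> u))"
    using F mR by (subst integral_distr) auto
  also have "\<dots> = integral\<^sup>L (restrict_space lborel U) (\<lambda>u. dens u *\<^sub>R F (\<phi> u))"
  proof (rule integral_density)
    show "(\<lambda>u. F (\<phi> u)) \<in> borel_measurable (restrict_space lborel U)"
      using mR F by (rule measurable_compose)
    show "AE u in restrict_space lborel U. 0 \<le> dens u"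
      using det_G_pos by (intro AE_I2) (auto simp: dens_def space_restrict_space less_imp_le)
  qed (rule md)
  also have "\<dots> = (\<integral>u. indicator U u * (dens u * F (\<phi> u)) \<partial>lborel)"
    using Ub by (subst integral_restrict_space) auto
  finally show ?thesis .
qed

end

context hypersurface begin

section \<open>The divergence theorem\<close>

lemma continuous_on_dv:
  assumes c: "(U, \<phi>) \<in> \<A>" and W: "Ck_on 1 U W"
  shows "continuous_on U (patch.dv (x \<circ> \<phi>) W)"
proof -
  interpret patch U "x \<circ> \<phi>" "\<nu> \<circ> \<phi>" using c by (rule chart_patch)
  have "continuous_on U (pd j W)" for j
    using Ck_on_pd[of 0 U W j] W by simp
  then show ?thesis
    unfolding dv_def[abs_def] by (intro continuous_intros Ck_on_imp_continuous_on[OF Ck_E[of 0]])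
qed

lemma C0_divg:
  assumes W: "C1 W"
  shows "C0 (divg W)"
  unfolding C0_def
proof safe
  fix U \<phi> assume c: "(U, \<phi>) \<in> \<A>"
  show "continuous_on U (divg W \<circ> \<phi>)"
    by (rule continuous_on_eq[OF continuous_on_dv[OF c C1D[OF W c]]]) (simp add: divg_chart[OF c _ W])
qed

text \<open>The image of the closed ball is compact, hence closed since the space is Hausdorff. So
  \<open>W\<close> vanishes on a whole neighbourhood of \<open>p\<close>, and with it its derivative
  there.\<close>

lemma divg_zero_off_support:
  assumes c: "(U, \<phi>) \<in> \<A>" and b: "cball w r \<subseteq> U" and W: "C1 W"
    and supp: "\<And>p. p \<in> M \<Longrightarrow> p \<notin> \<phi> ` cball w r \<Longrightarrow> W p = 0"
    and p: "p \<in> M" "p \<notin> \<phi> ` cball w r"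
  shows "divg W p = 0"
proof -
  obtain V \<theta> v where d: "(V, \<theta>) \<in> \<A>" "v \<in> V" "p = \<theta> v" using charts_cover[OF p(1)] by blast
  have "compact (\<phi> ` cball w r)"
    by (rule compact_continuous_image) (use chart(4)[OF c] b continuous_on_subset in auto)
  then have cl: "open (- (\<phi> ` cball w r))" by (simp add: compact_imp_closed open_Compl)
  have "tangent_deriv W (\<theta> v) a = tangent_deriv (\<lambda>_. 0) (\<theta> v) a" for a
  proof (rule tangent_deriv_local[OF d(1) W])
    show "open (V \<inter> \<theta> -` (- (\<phi> ` cball w r)))"
      by (rule continuous_open_preimage[OF chart(4)[OF d(1)] chart(1)[OF d(1)] cl])
    show "v \<in> V \<inter> \<theta> -` (- (\<phi> ` cball w r))" using d p by simp
    show "W (\<theta> z) = 0" if "z \<in> V \<inter> \<theta> -` (- (\<phi> ` cball w r))" for z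
      using that chart(6)[OF d(1)] by (intro supp) auto
  qed simp_all
  moreover have "tangent_deriv (\<lambda>_. 0 :: 'v) (\<theta> v) a = 0" for a
    by (simp add: tangent_deriv_def comp_def)
  ultimately show ?thesis by (simp add: divg_def d(3))
qed

text \<open>In the chart the integrand is the flat divergence of the fields \<open>F i\<close>.
  Their extension by zero is C^1 everywhere because \<open>U\<close> and the complement of the
  closed ball are open and cover the space.\<close>

lemma integral_divg_local:
  assumes vd: "volume_defined" and c: "(U, \<phi>) \<in> \<A>" and b: "cball w r \<subseteq> U" and W: "C1 W"
    and tang: "\<And>p. p \<in> M \<Longrightarrow> W p \<bullet> x p = 0" "\<And>p. p \<in> M \<Longrightarrow> W p \<bullet> \<nu> p = 0"
    and supp: "\<And>p. p \<in> M \<Longrightarrow> p \<notin> \<phi> ` cball w r \<Longrightarrow> W p = 0"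
  shows "integral\<^sup>L vol (divg W) = 0"
proof -
  interpret patch U "x \<circ> \<phi>" "\<nu> \<circ> \<phi>" using c by (rule chart_patch)
  define F where "F i u = (if u \<in> U then dens u * (W (\<phi> u) \<bullet> E i u) else 0)" for i u
  have out: "F i u = 0" if "u \<notin> cball w r" for i u
  proof (cases "u \<in> U")
    case True
    then have "\<phi> u \<notin> \<phi> ` cball w r"
      using that b chart(5)[OF c] by (meson inj_on_image_mem_iff)
    then show ?thesis using True supp[of "\<phi> u"] chart(6)[OF c] by (auto simp: F_def)
  qed (simp add: F_def)
  have "Ck_on 1 U (\<lambda>u. dens u * ((W \<circ> \<phi>) u \<bullet> E i u))" for i
    by (intro Ck_on_mult Ck_on_inner U Ck_dens Ck_E C1D[OF W c])
  then have C1: "Ck_on 1 U (F i)" for i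
    by (subst Ck_on_cong[OF U]) (auto simp: F_def)
  have C2: "Ck_on 1 (- cball w r) (F i)" for i
    by (subst Ck_on_cong[where g="\<lambda>_. 0"]) (use out in auto)
  have "Ck_on 1 (U \<union> - cball w r) (F i)" for i
    by (rule Ck_on_Un[OF U _ C1 C2]) auto
  then have C: "Ck_on 1 UNIV (F i)" for i
    using b by (metis Un_commute Un_upper1 compl_sup_top sup.absorb_iff2 sup_assoc sup_top_right)
  have "indicator U u * (dens u * divg W (\<phi> u)) = (\<Sum>i\<in>UNIV. pd i (F i) u)" for u
  proof (cases "u \<in> U")
    case True
    have "pd i (F i) u = pd i (\<lambda>u. dens u * ((W \<circ> \<phi>) u \<bullet> E i u)) u" for i
      by (rule pd_cong_open[OF U True]) (simp add: F_def)
    then have "(\<Sum>i\<in>UNIV. pd i (F i) u) = dens u * dv (W \<circ> \<phi>) u"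
      using pd_dens_component[OF True C1_differentiable[OF W c True]] tang[of "\<phi> u"] chart(6)[OF c] True by auto
    then show ?thesis using True by (simp add: divg_chart[OF c True W])
  next
    case False
    then have "u \<in> - cball w r" using b by auto
    then have "pd i (F i) u = 0" for i
      using pd_cong_open[of "- cball w r" u "F i" "\<lambda>_. 0" i] out by auto
    then show ?thesis using False by simp
  qed
  moreover have "integral\<^sup>L vol (divg W) = (\<integral>u. indicator U u * (dens u * divg W (\<phi> u)) \<partial>lborel)"
    by (rule integral_chart[OF vd c C0_measurable[OF C0_divg[OF W]]])
       (rule divg_zero_off_support[OF c b W supp], use b in auto)
  moreover have "integrable lborel (pd i (F i))" "integral\<^sup>L lborel (pd i (F i)) = 0" for i
    by (rule integral_pd_compact_support[OF C out]; assumption)+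
  ultimately show ?thesis by simp
qed

section \<open>Cutoff functions and the global divergence theorem\<close>

definition bump :: "(real ^ 'n) set \<Rightarrow> (real ^ 'n \<Rightarrow> 'm) \<Rightarrow> real ^ 'n \<Rightarrow> real \<Rightarrow> 'm \<Rightarrow> real"
  where "bump U \<phi> w r p = (if p \<in> \<phi> ` U
     then (max 0 (r\<^sup>2 - (inv_into U \<phi> p - w) \<bullet> (inv_into U \<phi> p - w)))\<^sup>2 else 0)"

lemma bump_chart: "(U, \<phi>) \<in> \<A> \<Longrightarrow> u \<in> U \<Longrightarrow> bump U \<phi> w r (\<phi> u) = (max 0 (r\<^sup>2 - (u - w) \<bullet> (u - w)))\<^sup>2"
  by (simp add: bump_def inv_chart)

lemma bump_zero:
  assumes c: "(U, \<phi>) \<in> \<A>" and r: "r > 0" and p: "p \<notin> \<phi> ` cball w r"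
  shows "bump U \<phi> w r p = 0"
proof (cases "p \<in> \<phi> ` U")
  case True
  then obtain u where u: "u \<in> U" "p = \<phi> u" by blast
  then have "r < norm (u - w)" using p by (auto simp: dist_norm norm_minus_commute)
  then have "r\<^sup>2 \<le> (u - w) \<bullet> (u - w)"
    using r by (simp add: power2_norm_eq_inner[symmetric])
  then show ?thesis using u by (simp add: bump_chart[OF c])
qed (simp add: bump_def)

lemma bump_pos:
  assumes c: "(U, \<phi>) \<in> \<A>" and b: "cball w r \<subseteq> U" and p: "p \<in> \<phi> ` ball w r"
  shows "bump U \<phi> w r p > 0"
proof -
  obtain u where u: "u \<in> ball w r" "p = \<phi> u" using p by blast
  then have "u \<in> U" using b ball_subset_cball by blast
  moreover have "norm (u - w) < r" using u by (simp add: dist_norm norm_minus_commute)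
  then have "(u - w) \<bullet> (u - w) < r\<^sup>2"
    by (simp add: power2_norm_eq_inner[symmetric] power_strict_mono)
  ultimately show ?thesis using u by (simp add: bump_chart[OF c])
qed

text \<open>Seen from another chart, the domain splits into two open sets: \<open>V1\<close>, where
  the transition map expresses the cutoff, and \<open>V2\<close>, where the cutoff vanishes. They
  cover the domain because the closed ball lies in \<open>U\<close>.\<close>

lemma C1_bump:
  assumes c: "(U, \<phi>) \<in> \<A>" and b: "cball w r \<subseteq> U" and r: "r > 0"
  shows "C1 (bump U \<phi> w r)"
  unfolding C1_def
proof safe
  fix V \<theta> assume d: "(V, \<theta>) \<in> \<A>"
  define V1 where "V1 = V \<inter> \<theta> -` (\<phi> ` U)"
  define V2 where "V2 = V \<inter> \<theta> -` (- (\<phi> ` cball w r))"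
  define \<tau> where "\<tau> = inv_into U \<phi> \<circ> \<theta>"
  have V1: "open V1" and \<tau>: "Ck_on 1 V1 \<tau>"
    using transition[OF d c] by (auto simp: V1_def \<tau>_def smooth_on_def)
  have "compact (\<phi> ` cball w r)"
    by (rule compact_continuous_image) (use chart(4)[OF c] b continuous_on_subset in auto)
  then have V2: "open V2"
    unfolding V2_def using chart(1,4)[OF d] by (intro continuous_open_preimage) (auto simp: compact_imp_closed)
  have "Ck_on 1 V1 (\<lambda>v. (max 0 (r\<^sup>2 - (\<tau> v - w) \<bullet> (\<tau> v - w)))\<^sup>2)"
    by (intro Ck_on_pos_part_square Ck_on_diff Ck_on_inner V1 Ck_on_const \<tau>)
  then have 1: "Ck_on 1 V1 (bump U \<phi> w r \<circ> \<theta>)"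
    by (subst Ck_on_cong[OF V1, where g="\<lambda>v. (max 0 (r\<^sup>2 - (\<tau> v - w) \<bullet> (\<tau> v - w)))\<^sup>2"])
       (auto simp: bump_def V1_def \<tau>_def)
  have 2: "Ck_on 1 V2 (bump U \<phi> w r \<circ> \<theta>)"
    by (subst Ck_on_cong[OF V2, where g="\<lambda>_. 0"]) (auto simp: V2_def bump_zero[OF c r])
  have "V = V1 \<union> V2" using image_mono[OF b, of \<phi>] unfolding V1_def V2_def by blast
  then show "Ck_on 1 V (bump U \<phi> w r \<circ> \<theta>)" using Ck_on_Un[OF V1 V2 1 2] by simp
qed

text \<open>The cutoffs of a finite cover have a positive sum on \<open>M\<close>; dividing by it
  gives a partition of unity. Each piece of \<open>W\<close> is a multiple of \<open>W\<close>,
  hence still tangent, and is supported in one chart ball.\<close>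

theorem integral_divg:
  assumes W: "C1 W" and tang: "\<And>p. p \<in> M \<Longrightarrow> W p \<bullet> x p = 0" "\<And>p. p \<in> M \<Longrightarrow> W p \<bullet> \<nu> p = 0"
  shows "integral\<^sup>L vol (divg W) = 0"
proof (cases rule: volume_cases)
  case 1
  obtain I where I: "finite I" "\<And>U \<phi> w r. (U, \<phi>, w, r) \<in> I \<Longrightarrow> (U, \<phi>) \<in> \<A> \<and> cball w r \<subseteq> U \<and> 0 < r"
    "M = (\<Union>(U, \<phi>, w, r)\<in>I. \<phi> ` ball w r)" by (rule cover) blast
  define b where "b i = (case i of (U, \<phi>, w, r) \<Rightarrow> bump U \<phi> w r)" for i
  have Cb: "C1 (b i)" if "i \<in> I" for i
  proof -
    obtain U \<phi> w r where iu: "i = (U, \<phi>, w, r)" by (cases i)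
    show ?thesis using I(2)[of U \<phi> w r] that by (simp add: iu b_def C1_bump)
  qed
  define s where "s p = (\<Sum>i\<in>I. b i p)" for p
  have b0: "b i p \<ge> 0" for i p by (cases i) (simp add: b_def bump_def)
  have s: "s p > 0" if "p \<in> M" for p
  proof -
    have "p \<in> (\<Union>(U, \<phi>, w, r)\<in>I. \<phi> ` ball w r)" using that I(3) by simp
    then obtain i where i: "i \<in> I" "p \<in> (case i of (U, \<phi>, w, r) \<Rightarrow> \<phi> ` ball w r)" by (rule UN_E)
    obtain U \<phi> w r where iu: "i = (U, \<phi>, w, r)" by (cases i)
    have "b i p > 0" using i I(2)[of U \<phi> w r] by (simp add: iu b_def bump_pos)
    then show ?thesis
      unfolding s_def by (rule sum_pos2[OF I(1) i(1), of "\<lambda>i. b i p"]) (rule b0)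
  qed
  have Cs: "C1 s" unfolding s_def[abs_def] using Cb by (rule C1_sum)
  have Cis: "C1 (\<lambda>p. inverse (s p))" using s by (intro C1_inverse[OF Cs]) (simp add: less_imp_neq[symmetric])
  define V where "V i p = (b i p * inverse (s p)) *\<^sub>R W p" for i p
  have CV: "C1 (V i)" if "i \<in> I" for i
    unfolding V_def[abs_def] by (rule C1_scaleR[OF C1_mult[OF Cb[OF that] Cis] W])
  have "integral\<^sup>L vol (divg (V i)) = 0" if i: "i \<in> I" for i
  proof -
    obtain U \<phi> w r where iu: "i = (U, \<phi>, w, r)" by (cases i)
    have c: "(U, \<phi>) \<in> \<A>" "cball w r \<subseteq> U" "0 < r" using I(2) i iu by auto
    show ?thesis
      by (rule integral_divg_local[OF 1 c(1,2) CV[OF i]])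
         (use tang in \<open>auto simp: V_def iu b_def bump_zero[OF c(1,3)]\<close>)
  qed
  moreover have "integral\<^sup>L vol (divg W) = (\<integral>p. (\<Sum>i\<in>I. divg (V i) p) \<partial>vol)"
  proof (rule Bochner_Integration.integral_cong[OF refl])
    fix p assume "p \<in> space vol"
    then have p: "p \<in> M" by (simp add: space_vol)
    have "W p = (\<Sum>i\<in>I. V i p)" if "p \<in> M" for p
      using s[OF that] by (simp add: V_def scaleR_sum_left[symmetric] sum_distrib_right[symmetric] s_def[symmetric])
    then have "divg W p = divg (\<lambda>p. \<Sum>i\<in>I. V i p) p"
      using CV by (intro divg_cong W C1_sum p)
    then show "divg W p = (\<Sum>i\<in>I. divg (V i) p)" using divg_sum[OF I(1) CV p] by simp
  qed
  moreover have "integrable vol (divg (V i))" if "i \<in> I" for i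
    using C0_integrable[OF 1 C0_divg[OF CV[OF that]]] .
  ultimately show ?thesis by simp
qed (rule integral_vol_zero)

section \<open>Integral formulas\<close>

lemma C1_x [simp]: "C1 x" and C1_nu [simp]: "C1 \<nu>"
proof -
  have "Ck_on 1 U (x \<circ> \<phi>) \<and> Ck_on 1 U (\<nu> \<circ> \<phi>)" if "(U, \<phi>) \<in> \<A>" for U \<phi>
  proof -
    interpret patch U "x \<circ> \<phi>" "\<nu> \<circ> \<phi>" using that by (rule chart_patch)
    show ?thesis using Ck_f Ck_N by blast
  qed
  then show "C1 x" "C1 \<nu>" by (auto simp: C1_def)
qed

text \<open>\<open>HH\<close> is \<open>- n H\<close> and \<open>SS\<close> is \<open>S\<close>. Written through \<^const>\<open>tangent_deriv\<close>, i.e. as traces over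
  the ambient space, they are visibly independent of the charts, hence smooth.\<close>

definition HH where "HH = divg \<nu>"
definition SS where "SS p = (\<Sum>b\<in>Basis. b \<bullet> tangent_deriv \<nu> p (tangent_deriv \<nu> p b))"
definition QQ where "QQ a p = tangent_deriv \<nu> p a"
definition ZZ where "ZZ a p = tangent_deriv \<nu> p (tangent_deriv \<nu> p a)"
definition TT where "TT a p = a - (x p \<bullet> a) *\<^sub>R x p - (\<nu> p \<bullet> a) *\<^sub>R \<nu> p"

lemma chart_values:
  assumes c: "(U, \<phi>) \<in> \<A>" and u: "u \<in> U"
  shows "HH (\<phi> u) = patch.h (x \<circ> \<phi>) (\<nu> \<circ> \<phi>) u" "QQ a (\<phi> u) = patch.Q (x \<circ> \<phi>) (\<nu> \<circ> \<phi>) a u"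
    "ZZ a (\<phi> u) = patch.Z (x \<circ> \<phi>) (\<nu> \<circ> \<phi>) a u" "TT a (\<phi> u) = patch.tangential_part (x \<circ> \<phi>) (\<nu> \<circ> \<phi>) a u"
    "SS (\<phi> u) = patch.S (x \<circ> \<phi>) (\<nu> \<circ> \<phi>) u"
proof -
  interpret patch U "x \<circ> \<phi>" "\<nu> \<circ> \<phi>" using c by (rule chart_patch)
  show "HH (\<phi> u) = h u" by (simp add: HH_def divg_chart[OF c u] dv_def h_def)
  have K: "tangent_deriv \<nu> (\<phi> u) v = Q v u" for v by (simp add: tangent_deriv_coord[OF c u] Q_def)
  show "QQ a (\<phi> u) = Q a u" by (simp add: QQ_def K)
  show "ZZ a (\<phi> u) = Z a u" by (simp add: ZZ_def K Z_def Q_def[of "Q a u"])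
  show "TT a (\<phi> u) = tangential_part a u" by (simp add: TT_def tangential_part_def)
  have "SS (\<phi> u) = (\<Sum>b\<in>Basis. \<Sum>k\<in>UNIV. \<Sum>l\<in>UNIV. (nu l u \<bullet> E k u) * ((b \<bullet> E l u) * (b \<bullet> nu k u)))"
    by (simp add: SS_def K Q_def inner_sum_right inner_sum_left sum_distrib_right sum_distrib_left mult_ac)
  also have "\<dots> = (\<Sum>k\<in>UNIV. \<Sum>l\<in>UNIV. \<Sum>b\<in>Basis. (nu l u \<bullet> E k u) * ((b \<bullet> E l u) * (b \<bullet> nu k u)))"
    by (subst sum.swap, rule sum.cong[OF refl], rule sum.swap)
  also have "\<dots> = (\<Sum>k\<in>UNIV. \<Sum>l\<in>UNIV. (nu l u \<bullet> E k u) * (E l u \<bullet> nu k u))"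
    by (simp only: sum_distrib_left[symmetric] sum_Basis_inner)
  also have "\<dots> = S u" by (simp add: S_def inner_commute)
  finally show "SS (\<phi> u) = S u" .
qed

lemma C1I_patch:
  assumes "\<And>U \<phi>. (U, \<phi>) \<in> \<A> \<Longrightarrow> \<exists>g. Ck_on 1 U g \<and> (\<forall>u\<in>U. F (\<phi> u) = g u)"
  shows "C1 F"
  unfolding C1_def
proof safe
  fix U \<phi> assume c: "(U, \<phi>) \<in> \<A>"
  then obtain g where "Ck_on 1 U g" "\<forall>u\<in>U. F (\<phi> u) = g u" using assms by blast
  then show "Ck_on 1 U (F \<circ> \<phi>)" using Ck_on_cong[OF chart(1)[OF c], of "F \<circ> \<phi>" g 1] by simp
qed

lemma C1_HH: "C1 HH" and C1_SS: "C1 SS" and C1_QQ: "C1 (QQ a)" and C1_ZZ: "C1 (ZZ a)" and C1_TT: "C1 (TT a)"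
proof -
  have *: "Ck_on 1 U (patch.h (x \<circ> \<phi>) (\<nu> \<circ> \<phi>))" "Ck_on 1 U (patch.S (x \<circ> \<phi>) (\<nu> \<circ> \<phi>))"
     "Ck_on 1 U (patch.Q (x \<circ> \<phi>) (\<nu> \<circ> \<phi>) a)" "Ck_on 1 U (patch.Z (x \<circ> \<phi>) (\<nu> \<circ> \<phi>) a)"
     "Ck_on 1 U (patch.tangential_part (x \<circ> \<phi>) (\<nu> \<circ> \<phi>) a)"
    if "(U, \<phi>) \<in> \<A>" for U \<phi>
  proof -
    interpret patch U "x \<circ> \<phi>" "\<nu> \<circ> \<phi>" using that by (rule chart_patch)
    show "Ck_on 1 U h" "Ck_on 1 U S" "Ck_on 1 U (Q a)" "Ck_on 1 U (Z a)" "Ck_on 1 U (tangential_part a)"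
      by (rule Ck_h Ck_S Ck_Q Ck_Z Ck_tan)+
  qed
  show "C1 HH" by (rule C1I_patch) (use *(1) chart_values(1) in blast)
  show "C1 SS" by (rule C1I_patch) (use *(2) chart_values(5) in blast)
  show "C1 (QQ a)" by (rule C1I_patch) (use *(3) chart_values(2) in blast)
  show "C1 (ZZ a)" by (rule C1I_patch) (use *(4) chart_values(3) in blast)
  show "C1 (TT a)" by (rule C1I_patch) (use *(5) chart_values(4) in blast)
qed

lemma C1_phi: "C1 (\<lambda>p. x p \<bullet> a)" and C1_psi: "C1 (\<lambda>p. \<nu> p \<bullet> a)"
  by (rule C1_bilinear[OF bounded_bilinear_inner]; simp)+

lemma tangential:
  assumes "p \<in> M"
  shows "QQ a p \<bullet> x p = 0" "QQ a p \<bullet> \<nu> p = 0" "ZZ a p \<bullet> x p = 0" "ZZ a p \<bullet> \<nu> p = 0"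
    "TT a p \<bullet> x p = 0" "TT a p \<bullet> \<nu> p = 0"
proof -
  obtain U \<phi> u where c: "(U, \<phi>) \<in> \<A>" "u \<in> U" "p = \<phi> u" using charts_cover[OF assms] by blast
  interpret patch U "x \<circ> \<phi>" "\<nu> \<circ> \<phi>" using c(1) by (rule chart_patch)
  show "QQ a p \<bullet> x p = 0" "QQ a p \<bullet> \<nu> p = 0" "ZZ a p \<bullet> x p = 0" "ZZ a p \<bullet> \<nu> p = 0"
    "TT a p \<bullet> x p = 0" "TT a p \<bullet> \<nu> p = 0"
    using Q_f[OF c(2)] Q_N[OF c(2)] Z_f[OF c(2)] Z_N[OF c(2)] tan_f[OF c(2)] tan_N[OF c(2)]
    by (simp_all add: c(3) chart_values[OF c(1,2)])
qed

lemma divg_phi_TT: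
  assumes a: "a \<bullet> a = 1" and p: "p \<in> M"
  shows "divg (\<lambda>p. (x p \<bullet> a) *\<^sub>R TT a p) p =
    1 - (real CARD('n) + 1) * (x p \<bullet> a)\<^sup>2 - (\<nu> p \<bullet> a)\<^sup>2 - HH p * (x p \<bullet> a) * (\<nu> p \<bullet> a)"
proof -
  obtain U \<phi> u where c: "(U, \<phi>) \<in> \<A>" "u \<in> U" "p = \<phi> u" using charts_cover[OF p] by blast
  interpret patch U "x \<circ> \<phi>" "\<nu> \<circ> \<phi>" using c(1) by (rule chart_patch)
  have "(\<lambda>p. (x p \<bullet> a) *\<^sub>R TT a p) \<circ> \<phi> = (\<lambda>u. ((x \<circ> \<phi>) u \<bullet> a) *\<^sub>R tangential_part a u)"
    by (rule ext) (simp add: TT_def tangential_part_def)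
  then show ?thesis
    using dv_phi_tan[OF c(2), of a] a
    by (simp add: c(3) divg_chart[OF c(1,2) C1_scaleR[OF C1_phi C1_TT]] chart_values[OF c(1,2)])
qed

lemma dv_cong:
  assumes c: "(U, \<phi>) \<in> \<A>" "u \<in> U" and eq: "\<And>w. w \<in> U \<Longrightarrow> V w = W w"
  shows "patch.dv (x \<circ> \<phi>) V u = patch.dv (x \<circ> \<phi>) W u"
proof -
  interpret patch U "x \<circ> \<phi>" "\<nu> \<circ> \<phi>" using c(1) by (rule chart_patch)
  show ?thesis by (simp add: dv_def pd_cong_open[OF U c(2) eq])
qed

lemma C1_diff: "C1 V \<Longrightarrow> C1 W \<Longrightarrow> C1 (\<lambda>p. V p - W p)"
proof -
  assume "C1 V" "C1 W"
  then have "Ck_on 1 U (\<lambda>u. (V \<circ> \<phi>) u - (W \<circ> \<phi>) u)" if "(U, \<phi>) \<in> \<A>" for U \<phi>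
    using that by (intro Ck_on_diff chart(1) C1D)
  then show ?thesis by (auto simp: C1_def comp_def)
qed

lemma C1_QQ_TT: "C1 (\<lambda>p. (\<nu> p \<bullet> a) *\<^sub>R (QQ a p - HH p *\<^sub>R TT a p))"
  by (rule C1_scaleR[OF C1_psi C1_diff[OF C1_QQ C1_scaleR[OF C1_HH C1_TT]]])

lemma divg_psi_QQ_TT:
  assumes p: "p \<in> M"
  shows "divg (\<lambda>p. (\<nu> p \<bullet> a) *\<^sub>R (QQ a p - HH p *\<^sub>R TT a p)) p =
    QQ a p \<bullet> QQ a p - HH p * (QQ a p \<bullet> a) + (real CARD('n) - 1) * (HH p * (x p \<bullet> a) * (\<nu> p \<bullet> a))
      + (\<nu> p \<bullet> a)\<^sup>2 * ((HH p)\<^sup>2 - SS p)"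
proof -
  obtain U \<phi> u where c: "(U, \<phi>) \<in> \<A>" "u \<in> U" "p = \<phi> u" using charts_cover[OF p] by blast
  interpret patch U "x \<circ> \<phi>" "\<nu> \<circ> \<phi>" using c(1) by (rule chart_patch)
  have "dv ((\<lambda>p. (\<nu> p \<bullet> a) *\<^sub>R (QQ a p - HH p *\<^sub>R TT a p)) \<circ> \<phi>) u =
      dv (\<lambda>u. ((\<nu> \<circ> \<phi>) u \<bullet> a) *\<^sub>R (Q a u - h u *\<^sub>R tangential_part a u)) u"
    by (rule dv_cong[OF c(1,2)]) (simp add: chart_values[OF c(1)])
  then show ?thesis
    using dv_Q_tan[OF c(2), of a]
    by (simp add: c(3) divg_chart[OF c(1,2) C1_QQ_TT] chart_values[OF c(1,2)])
qed

text \<open>The bridge from quantities evaluated in the chart selected by \<open>param_at\<close> to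
  the chart-independent functions. Signs change for the odd traces, since \<nu> is differentiated
  instead of applying the shape operator.\<close>

lemma pointwise:
  assumes p: "p \<in> M"
  shows "mean_curvature \<A> x \<nu> p = - HH p / real CARD('n)" (is ?H)
    and "second_ff_sq \<A> x \<nu> p = SS p" (is ?S)
    and "scalar_curvature \<A> x p = real CARD('n) * (real CARD('n) - 1) + (HH p)\<^sup>2 - SS p"
    and "a \<bullet> a = 1 \<Longrightarrow> traceless_ricci_tangent \<A> x a p =
      (real CARD('n) - 1 - scalar_curvature \<A> x p / real CARD('n)) * (1 - (x p \<bullet> a)\<^sup>2 - (\<nu> p \<bullet> a)\<^sup>2)
      + HH p * (QQ a p \<bullet> a) - QQ a p \<bullet> QQ a p"
    and "(\<And>q. q \<in> M \<Longrightarrow> HH q = 0) \<Longrightarrow> (\<And>q. q \<in> M \<Longrightarrow> SS q = s) \<Longrightarrow>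
      divg (\<lambda>p. (x p \<bullet> a) *\<^sub>R ZZ a p) p =
        QQ a p \<bullet> QQ a p - (x p \<bullet> a)\<^sup>2 * s + (x p \<bullet> a) * (\<nu> p \<bullet> a) * trace_A3 \<A> x \<nu> p"
proof -
  obtain U \<phi> where pa: "param_at \<A> p = (U, \<phi>)" and c: "(U, \<phi>) \<in> \<A>" and u: "coord_at \<A> p \<in> U" and e: "\<phi> (coord_at \<A> p) = p"
    by (rule param_at[OF p])
  define u where "u = coord_at \<A> p"
  have u: "u \<in> U" and e: "\<phi> u = p" using u e by (auto simp: u_def)
  have lr: "local_rep \<A> F p = F \<circ> \<phi>" for F :: "'m \<Rightarrow> 'v" by (simp add: local_rep_def pa)
  interpret patch U "x \<circ> \<phi>" "\<nu> \<circ> \<phi>" using c by (rule chart_patch)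
  note v = chart_values[OF c u, unfolded e]
  show ?H
    by (simp add: mean_curvature_def lr u_def[symmetric] trace_shape_op[OF u] v)
  show ?S
    using second_ff_sq_eq[OF u] by (simp add: second_ff_sq_def lr u_def[symmetric] v Let_def)
  show sc: "scalar_curvature \<A> x p = real CARD('n) * (real CARD('n) - 1) + (HH p)\<^sup>2 - SS p"
    by (simp add: scalar_curvature_def lr u_def[symmetric] scalar_curv_eq[OF u] v)
  show "traceless_ricci_tangent \<A> x a p =
      (real CARD('n) - 1 - scalar_curvature \<A> x p / real CARD('n)) * (1 - (x p \<bullet> a)\<^sup>2 - (\<nu> p \<bullet> a)\<^sup>2)
      + HH p * (QQ a p \<bullet> a) - QQ a p \<bullet> QQ a p" if "a \<bullet> a = 1"
    using that tan_norm[OF u, of a] traceless_ricci_eq[OF u, of a "scalar_curvature \<A> x p / real CARD('n)"]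
    by (simp add: traceless_ricci_tangent_def lr u_def[symmetric] v e)
  show "divg (\<lambda>p. (x p \<bullet> a) *\<^sub>R ZZ a p) p =
        QQ a p \<bullet> QQ a p - (x p \<bullet> a)\<^sup>2 * s + (x p \<bullet> a) * (\<nu> p \<bullet> a) * trace_A3 \<A> x \<nu> p"
    if H0: "\<And>q. q \<in> M \<Longrightarrow> HH q = 0" and S0: "\<And>q. q \<in> M \<Longrightarrow> SS q = s"
  proof -
    have M: "\<phi> w \<in> M" if "w \<in> U" for w using chart(6)[OF c] that by blast
    have h0: "h w = 0" if "w \<in> U" for w using H0[OF M[OF that]] by (simp add: chart_values[OF c that])
    have s0: "S w = s" if "w \<in> U" for w using S0[OF M[OF that]] by (simp add: chart_values[OF c that])
    have t: "trace_A3 \<A> x \<nu> p = - T u"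
      using trace_shape_op3[OF u] by (simp add: trace_A3_def lr u_def[symmetric])
    have "dv ((\<lambda>p. (x p \<bullet> a) *\<^sub>R ZZ a p) \<circ> \<phi>) u = dv (\<lambda>u. ((x \<circ> \<phi>) u \<bullet> a) *\<^sub>R Z a u) u"
      by (rule dv_cong[OF c u]) (simp add: chart_values[OF c])
    then have "divg (\<lambda>p. (x p \<bullet> a) *\<^sub>R ZZ a p) (\<phi> u) = dv (\<lambda>u. ((x \<circ> \<phi>) u \<bullet> a) *\<^sub>R Z a u) u"
      by (simp add: divg_chart[OF c u C1_scaleR[OF C1_phi C1_ZZ]])
    also have "\<dots> = Q a u \<bullet> Q a u - ((x \<circ> \<phi>) u \<bullet> a)\<^sup>2 * s - ((x \<circ> \<phi>) u \<bullet> a) * ((\<nu> \<circ> \<phi>) u \<bullet> a) * T u"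
      by (rule dv_phi_Z[OF u h0 s0])
    finally show ?thesis by (simp add: e t v)
  qed
qed

end

section \<open>Principal curvatures\<close>

text \<open>A maximizer \<open>v\<close> of the quadratic form on the unit sphere of
  \<open>W\<close> works: by first variation \<open>A v\<close> is orthogonal to every vector of
  \<open>W\<close> orthogonal to \<open>v\<close>, in particular to its own residue
  \<open>r\<close>.\<close>

lemma symmetric_eigenvector:
  fixes A :: "'a::euclidean_space \<Rightarrow> 'a"
  assumes W: "subspace W" and A: "linear A" and inv: "\<And>v. v \<in> W \<Longrightarrow> A v \<in> W"
    and sym: "\<And>v w. v \<in> W \<Longrightarrow> w \<in> W \<Longrightarrow> A v \<bullet> w = v \<bullet> A w" and ne: "W \<noteq> {0}"
  shows "\<exists>v k. v \<in> W \<and> norm v = 1 \<and> A v = k *\<^sub>R v"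
proof -
  interpret A: linear A by fact
  obtain y where y: "y \<in> W" "y \<noteq> 0" using ne subspace_0[OF W] by blast
  define S where "S = W \<inter> sphere 0 1"
  have "compact S" unfolding S_def using closed_subspace[OF W] by (simp add: closed_Int_compact)
  moreover have "(1 / norm y) *\<^sub>R y \<in> S" using y W by (simp add: S_def subspace_scale)
  moreover have "continuous_on S (\<lambda>v. A v \<bullet> v)"
    by (intro continuous_intros linear_continuous_on) (simp add: A linear_linear)
  ultimately obtain v where v: "v \<in> S" and max: "\<And>w. w \<in> S \<Longrightarrow> A w \<bullet> w \<le> A v \<bullet> v"
    using continuous_attains_sup[of S "\<lambda>v. A v \<bullet> v"] by blast
  define k where "k = A v \<bullet> v"
  have vW: "v \<in> W" and nv: "norm v = 1" "v \<bullet> v = 1" using v by (auto simp: S_def norm_eq_1)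
  have le: "A w \<bullet> w \<le> k * (w \<bullet> w)" if "w \<in> W" for w
  proof (cases "w = 0")
    case False
    then have "(1 / norm w) *\<^sub>R w \<in> S" using that W by (simp add: S_def subspace_scale)
    from max[OF this] have "(A w \<bullet> w) / (norm w)\<^sup>2 \<le> k" by (simp add: A.scale k_def power2_eq_square)
    then show ?thesis using False by (simp add: divide_le_eq power2_norm_eq_inner)
  qed (simp add: A.zero)
  have orth: "A v \<bullet> w = 0" if w: "w \<in> W" "v \<bullet> w = 0" for w
  proof (rule ccontr)
    define c where "c = A v \<bullet> w"
    define d where "d = \<bar>A w \<bullet> w - k * (w \<bullet> w)\<bar> + 1"
    assume "A v \<bullet> w \<noteq> 0"
    then have c: "c \<noteq> 0" by (simp add: c_def)
    have d: "d > 0" by (simp add: d_def)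
    \<comment> \<open>Moving from \<open>v\<close> by \<open>t *\<^sub>R w\<close> gains 2tc to
      first order and loses at most t^2 d to second order. With this t the net gain is at least tc >
      0, contradicting maximality.\<close>
    define t where "t = c / d"
    have "A w \<bullet> v = c" using sym[OF w(1) vW] by (simp add: c_def inner_commute)
    then have e: "A (v + t *\<^sub>R w) \<bullet> (v + t *\<^sub>R w) = k + 2 * t * c + t\<^sup>2 * (A w \<bullet> w)"
      by (simp add: A.add A.scale inner_add_left inner_add_right k_def c_def[symmetric] power2_eq_square algebra_simps)
    have e2: "(v + t *\<^sub>R w) \<bullet> (v + t *\<^sub>R w) = 1 + t\<^sup>2 * (w \<bullet> w)"
      using w(2) nv by (simp add: inner_add_left inner_add_right inner_commute power2_eq_square)
    have "v + t *\<^sub>R w \<in> W" using w(1) vW W by (simp add: subspace_add subspace_scale)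
    from le[OF this] have "2 * t * c + t\<^sup>2 * (A w \<bullet> w - k * (w \<bullet> w)) \<le> 0"
      unfolding e e2 by (simp add: algebra_simps)
    moreover have "t\<^sup>2 * (A w \<bullet> w - k * (w \<bullet> w)) \<ge> - (t\<^sup>2 * d)"
    proof -
      have "t\<^sup>2 * (- d) \<le> t\<^sup>2 * (A w \<bullet> w - k * (w \<bullet> w))"
        by (rule mult_left_mono) (auto simp: d_def)
      then show ?thesis by simp
    qed
    moreover have "t\<^sup>2 * d = t * c" using d by (simp add: t_def power2_eq_square)
    moreover have "t * c > 0" using c d by (simp add: t_def power2_eq_square[symmetric])
    ultimately show False by linarith
  qed
  define r where "r = A v - k *\<^sub>R v"
  have rW: "r \<in> W" unfolding r_def using vW W inv by (simp add: subspace_diff subspace_scale)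
  have vr: "v \<bullet> r = 0" by (simp add: r_def inner_diff_right nv k_def inner_commute)
  have "r \<bullet> r = A v \<bullet> r - k * (v \<bullet> r)" by (simp add: r_def inner_diff_left)
  then have "r = 0" using orth[OF rW vr] vr by simp
  then show ?thesis using vW nv by (intro exI[of _ v] exI[of _ k]) (simp add: r_def)
qed

text \<open>Stated for invariant subspaces so that induction on dimension can pass to the part of
  \<open>W\<close> orthogonal to an eigenvector, which is invariant by symmetry.\<close>

lemma symmetric_orthonormal_eigenbasis:
  fixes A :: "'a::euclidean_space \<Rightarrow> 'a"
  assumes A: "linear A"
  shows "subspace W \<Longrightarrow> (\<And>v. v \<in> W \<Longrightarrow> A v \<in> W) \<Longrightarrow>
    (\<And>v w. v \<in> W \<Longrightarrow> w \<in> W \<Longrightarrow> A v \<bullet> w = v \<bullet> A w) \<Longrightarrow>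
    \<exists>B. B \<subseteq> W \<and> pairwise orthogonal B \<and> span B = W \<and> (\<forall>b\<in>B. norm b = 1 \<and> (\<exists>k. A b = k *\<^sub>R b))"
proof (induction "dim W" arbitrary: W rule: less_induct)
  case less
  note W = less.prems(1) and inv = less.prems(2) and sym = less.prems(3)
  show ?case
  proof (cases "W = {0}")
    case True
    then show ?thesis by (intro exI[of _ "{}"]) auto
  next
    case False
    obtain v k where v: "v \<in> W" "norm v = 1" "A v = k *\<^sub>R v"
      using symmetric_eigenvector[OF W A inv sym False] by blast
    have vv: "v \<bullet> v = 1" using v(2) by (simp add: norm_eq_1)
    define W' where "W' = W \<inter> {w. v \<bullet> w = 0}"
    have W': "subspace W'" unfolding W'_def using W by (auto simp: subspace_def inner_add_right)
    have "W' \<subseteq> W" "v \<notin> W'" using vv by (auto simp: W'_def)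
    then have "W' \<subset> W" using v(1) by blast
    then have "dim W' < dim W" using W W' by (metis dim_psubset span_eq_iff)
    moreover have "A w \<in> W'" if "w \<in> W'" for w
      using that inv sym[OF v(1), of w] v(3) by (auto simp: W'_def)
    moreover have "A w \<bullet> z = w \<bullet> A z" if "w \<in> W'" "z \<in> W'" for w z
      using that sym by (auto simp: W'_def)
    ultimately obtain B where B: "B \<subseteq> W'" "pairwise orthogonal B" "span B = W'"
      "\<forall>b\<in>B. norm b = 1 \<and> (\<exists>k. A b = k *\<^sub>R b)"
      using less.hyps[OF _ W'] by blast
    have "span (insert v B) = W"
    proof
      show "span (insert v B) \<subseteq> W"
        using B(1) v(1) by (intro span_minimal W) (auto simp: W'_def)
      show "W \<subseteq> span (insert v B)"
      proof
        fix w assume w: "w \<in> W"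
        have "w - (v \<bullet> w) *\<^sub>R v \<in> span B"
          unfolding B(3) W'_def using w v(1) W vv by (auto simp: subspace_diff subspace_scale inner_diff_right)
        then show "w \<in> span (insert v B)" using span_breakdown_eq by blast
      qed
    qed
    moreover have "pairwise orthogonal (insert v B)"
      using B(1,2) by (auto simp: pairwise_insert W'_def orthogonal_def inner_commute)
    ultimately show ?thesis
      using B v by (intro exI[of _ "insert v B"]) (auto simp: W'_def)
  qed
qed

context patch begin

text \<open>This supplies the witness behind the choice in \<open>principal_curvatures\<close>. The
  spectral argument is carried out on the tangent space inside the ambient space, where the operator
  is symmetric for the ordinary inner product instead of the metric \<open>G\<close>.\<close>

lemma principal_basis_exists:
  assumes u: "u \<in> U"
  shows "\<exists>\<kappa>. \<exists>Eb :: 'n \<Rightarrow> real ^ 'n.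
    (\<forall>i j. frechet_derivative f (at u) (Eb i) \<bullet> frechet_derivative f (at u) (Eb j) = (if i = j then 1 else 0)) \<and>
    (\<forall>i. shape_op f N u (Eb i) = \<kappa> i *\<^sub>R Eb i)"
proof -
  interpret df: linear "frechet_derivative f (at u)" using u by (rule linear_df)
  let ?df = "frechet_derivative f (at u)"
  define A where "A v = - Q v u" for v
  define W where "W = range ?df"
  have W: "subspace W" unfolding W_def by (rule linear_subspace_image[OF linear_df[OF u] subspace_UNIV])
  have inW: "v \<in> W \<longleftrightarrow> v \<bullet> f u = 0 \<and> v \<bullet> N u = 0" for v
  proof
    show "v \<bullet> f u = 0 \<and> v \<bullet> N u = 0" if "v \<in> W"
      using that u by (auto simp: W_def df_eq inner_sum_left orth')
    assume "v \<bullet> f u = 0 \<and> v \<bullet> N u = 0"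
    then have "v = ?df (\<chi> i. v \<bullet> E i u)" using expand[OF u, of v] by (simp add: df_eq[OF u])
    then show "v \<in> W" by (auto simp: W_def)
  qed
  have "linear A"
    unfolding A_def Q_def
    by (rule linearI) (simp_all add: inner_add_left scaleR_left_distrib sum.distrib scaleR_sum_right)
  moreover have "A v \<in> W" for v
    unfolding inW A_def using Q_f[OF u] Q_N[OF u] by simp
  moreover have "A v \<bullet> w = v \<bullet> A w" if "v \<in> W" "w \<in> W" for v w
  proof -
    have Qe: "Q v u \<bullet> w = (\<Sum>k\<in>UNIV. \<Sum>j\<in>UNIV. (v \<bullet> E k u) * ((w \<bullet> E j u) * (nu k u \<bullet> e j u)))" if "w \<in> W" for v w
    proof -
      have "nu k u \<bullet> w = (\<Sum>j\<in>UNIV. (w \<bullet> E j u) * (nu k u \<bullet> e j u))" for k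
        using inner_expand[OF u, of w "nu k u"] that by (simp add: inW inner_commute)
      then show ?thesis by (simp add: Q_def inner_sum_left sum_distrib_left)
    qed
    have "Q v u \<bullet> w = Q w u \<bullet> v"
      unfolding Qe[OF that(2)] Qe[OF that(1)]
      by (subst sum.swap) (simp add: nu_sym[OF u] mult.left_commute)
    then show ?thesis by (simp add: A_def inner_commute)
  qed
  ultimately obtain B where B: "B \<subseteq> W" "pairwise orthogonal B" "span B = W"
      "\<forall>b\<in>B. norm b = 1 \<and> (\<exists>k. A b = k *\<^sub>R b)"
    using symmetric_orthonormal_eigenbasis[OF _ W, of A] by blast
  have "0 \<notin> B" using B(4) by auto
  with B(2) have "independent B" by (rule pairwise_orthogonal_independent)
  then have fin: "finite B" and "card B = dim (span B)"
    by (auto simp: independent_imp_finite dim_eq_card_independent)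
  note this(2)
  also have "dim (span B) = dim W" by (simp only: B(3))
  \<comment> \<open>The differential is injective, so the eigenbasis has as many members as there
    are coordinates and can be indexed by \<open>'n\<close>.\<close>
  also have "dim W = CARD('n)"
    unfolding W_def using dim_image_eq[OF df.linear_axioms, of UNIV] inj_df[OF u] by simp
  finally obtain g :: "'n \<Rightarrow> 'v" where g: "bij_betw g UNIV B"
    using finite_same_card_bij[of "UNIV :: 'n set" B] fin by auto
  define Eb where "Eb i = (\<chi> k. g i \<bullet> E k u)" for i
  have gB: "g i \<in> B" for i using g bij_betwE by blast
  have dfE: "?df (Eb i) = g i" for i
    using expand[OF u, of "g i"] gB[of i] B(1) inW by (auto simp: df_eq[OF u] Eb_def)
  have "\<forall>i. \<exists>k. A (g i) = k *\<^sub>R g i" using B(4) gB by blast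
  from choice[OF this] obtain \<kappa> where \<kappa>: "\<And>i. A (g i) = \<kappa> i *\<^sub>R g i" by blast
  have "?df (Eb i) \<bullet> ?df (Eb j) = (if i = j then 1 else 0)" for i j
  proof (cases "i = j")
    case True
    then show ?thesis using B(4) gB[of i] by (simp add: dfE norm_eq_1)
  next
    case False
    then have "g i \<noteq> g j" using g by (metis UNIV_I bij_betw_imp_inj_on injD)
    then show ?thesis using False B(2) gB by (auto simp: dfE pairwise_def orthogonal_def)
  qed
  moreover have "shape_op f N u (Eb i) = \<kappa> i *\<^sub>R Eb i" for i
  proof -
    have "(\<Sum>j\<in>UNIV. (E k u \<bullet> nu j u) * (g i \<bullet> E j u)) = E k u \<bullet> Q (g i) u" for k
      by (simp add: Q_def inner_sum_right mult.commute)
    moreover have "Q (g i) u = - (\<kappa> i *\<^sub>R g i)" by (simp add: \<kappa>[symmetric] A_def)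
    ultimately show ?thesis
      by (simp add: shape_op_eq[OF u] vec_eq_iff matrix_vector_mult_def Bm_def Eb_def inner_commute)
  qed
  ultimately show ?thesis by blast
qed

text \<open>The matrix \<open>P\<close> with columns \<open>Eb j\<close> diagonalizes the shape
  operator. Orthonormality with respect to \<open>G\<close> exhibits a left inverse of
  \<open>P\<close>, and the trace is invariant under conjugation.\<close>

lemma trace_eigenvalues:
  fixes \<kappa> :: "'n \<Rightarrow> real" and Eb :: "'n \<Rightarrow> real ^ 'n"
  assumes u: "u \<in> U"
    and Eb: "\<forall>i j. frechet_derivative f (at u) (Eb i) \<bullet> frechet_derivative f (at u) (Eb j) = (if i = j then 1 else 0)"
    and \<kappa>: "\<forall>i. shape_op f N u (Eb i) = \<kappa> i *\<^sub>R Eb i"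
  shows "h u = - (\<Sum>i\<in>UNIV. \<kappa> i)" "T u = - (\<Sum>i\<in>UNIV. \<kappa> i ^ 3)"
proof -
  define A where "A = matrix (shape_op f N u)"
  define P :: "real ^ 'n ^ 'n" where "P = (\<chi> i j. Eb j $ i)"
  define D :: "real ^ 'n ^ 'n" where "D = (\<chi> i j. if i = j then \<kappa> i else 0)"
  have col: "P *v axis j 1 = Eb j" for j
    by (simp add: P_def matrix_vector_mult_basis column_def vec_eq_iff)
  have "(transpose P ** G u ** P) $ i $ j = (if i = j then 1 else 0)" for i j
  proof -
    have "(transpose P ** G u ** P) $ i $ j = Eb i \<bullet> (G u *v Eb j)"
      by (simp add: matrix_matrix_mult_def transpose_def P_def inner_vec_def matrix_vector_mult_def
          sum_distrib_left sum_distrib_right mult_ac) (rule sum.swap)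
    then show ?thesis using Eb by (simp add: G_quadratic[OF u])
  qed
  then have "(transpose P ** G u) ** P = mat 1" by (simp add: vec_eq_iff mat_def)
  then have inv: "invertible P" using invertible_left_inverse by blast
  have AP: "A ** P = P ** D"
  proof -
    have "A *v (P *v axis j 1) = P *v (D *v axis j 1)" for j
    proof -
      have "A *v Eb j = \<kappa> j *\<^sub>R Eb j"
        using \<kappa> by (simp add: A_def matrix_shape_op[OF u] shape_op_eq[OF u] matrix_vector_mult_def vec_eq_iff sum_negf)
      moreover have "D *v axis j 1 = \<kappa> j *\<^sub>R axis j 1"
        unfolding matrix_vector_mult_basis by (simp add: D_def column_def vec_eq_iff axis_def)
      ultimately show ?thesis by (simp add: col matrix_vector_mult_scaleR)
    qed
    then have "(A ** P) *v axis j 1 = (P ** D) *v axis j 1" for j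
      by (simp add: matrix_vector_mul_assoc)
    then have "column j (A ** P) = column j (P ** D)" for j by (simp add: matrix_vector_mult_basis)
    then show ?thesis by (simp add: column_def vec_eq_iff)
  qed
  have A: "A = P ** D ** matrix_inv P"
    using arg_cong[OF AP, of "\<lambda>X. X ** matrix_inv P"] matrix_inv_works[OF inv]
    by (simp add: matrix_mul_assoc[symmetric])
  have tr: "trace (P ** X ** matrix_inv P) = trace X" for X :: "real ^ 'n ^ 'n"
  proof -
    have "trace (P ** X ** matrix_inv P) = trace (matrix_inv P ** (P ** X))"
      by (rule trace_mul_sym)
    also have "matrix_inv P ** (P ** X) = X"
      by (simp add: matrix_mul_assoc matrix_inv_works[OF inv])
    finally show ?thesis .
  qed
  have "A ** A ** A = P ** D ** (matrix_inv P ** P) ** D ** (matrix_inv P ** P) ** D ** matrix_inv P"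
    unfolding A by (simp add: matrix_mul_assoc)
  also have "\<dots> = P ** (D ** D ** D) ** matrix_inv P"
    by (simp add: matrix_inv_works[OF inv] matrix_mul_assoc)
  finally have A3: "A ** A ** A = P ** (D ** D ** D) ** matrix_inv P" .
  have DD: "D ** (\<chi> i j. if i = j then g i else 0) = (\<chi> i j. if i = j then \<kappa> i * g i else 0)" for g
    by (simp add: D_def matrix_matrix_mult_def vec_eq_iff if_distrib[of "\<lambda>c. _ * c"] if_distrib[of "\<lambda>c. c * _"] cong: if_cong)
  have "D ** D ** D = (\<chi> i j. if i = j then \<kappa> i ^ 3 else 0)"
    unfolding matrix_mul_assoc[symmetric]
    by (subst (3) D_def, simp only: DD) (simp add: power3_eq_cube mult.assoc vec_eq_iff)
  then have "trace (A ** A ** A) = (\<Sum>i\<in>UNIV. \<kappa> i ^ 3)"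
    by (simp add: A3 tr) (simp add: trace_def)
  then show "T u = - (\<Sum>i\<in>UNIV. \<kappa> i ^ 3)"
    using trace_shape_op3[OF u] by (simp add: A_def Let_def)
  have "trace A = (\<Sum>i\<in>UNIV. \<kappa> i)" by (subst A) (simp add: tr, simp add: trace_def D_def)
  then show "h u = - (\<Sum>i\<in>UNIV. \<kappa> i)" using trace_shape_op[OF u] by (simp add: A_def)
qed

end

section \<open>Elementary symmetric polynomials and Newton's identities\<close>

definition esym :: "nat \<Rightarrow> ('a \<Rightarrow> real) \<Rightarrow> 'a set \<Rightarrow> real"
  where "esym k \<kappa> A = (\<Sum>I | I \<subseteq> A \<and> card I = k. \<Prod>i\<in>I. \<kappa> i)"

lemma esym_0: "finite A \<Longrightarrow> esym 0 \<kappa> A = 1"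
proof -
  assume "finite A"
  then have "{I. I \<subseteq> A \<and> card I = 0} = {{}}" by (auto dest: finite_subset)
  then show ?thesis by (simp add: esym_def)
qed

lemma esym_empty: "esym (Suc k) \<kappa> {} = 0"
  by (auto simp: esym_def intro!: sum.neutral)

text \<open>Subsets are split by whether they contain \<open>a\<close>. This recursion makes
  Newton's identities provable by induction on the set of variables.\<close>

lemma esym_insert:
  assumes A: "finite A" "a \<notin> A"
  shows "esym (Suc k) \<kappa> (insert a A) = esym (Suc k) \<kappa> A + \<kappa> a * esym k \<kappa> A"
proof -
  let ?S = "\<lambda>k. {I. I \<subseteq> A \<and> card I = k}"
  have fin: "finite I" if "I \<subseteq> A" for I using that A(1) finite_subset by blast
  have "{I. I \<subseteq> insert a A \<and> card I = Suc k} = ?S (Suc k) \<union> insert a ` ?S k"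
  proof (intro equalityI subsetI)
    fix I assume I: "I \<in> {I. I \<subseteq> insert a A \<and> card I = Suc k}"
    show "I \<in> ?S (Suc k) \<union> insert a ` ?S k"
    proof (cases "a \<in> I")
      case True
      then have "I = insert a (I - {a})" "I - {a} \<subseteq> A" "card (I - {a}) = k" using I A by auto
      then show ?thesis by blast
    qed (use I in auto)
  next
    fix I assume "I \<in> ?S (Suc k) \<union> insert a ` ?S k"
    then show "I \<in> {I. I \<subseteq> insert a A \<and> card I = Suc k}"
      using A fin by (auto simp: card_insert_if)
  qed
  moreover have "?S (Suc k) \<inter> insert a ` ?S k = {}" using A by auto
  moreover have "finite (?S j)" for j using A(1) by simp
  ultimately have "esym (Suc k) \<kappa> (insert a A) = esym (Suc k) \<kappa> A + (\<Sum>I\<in>insert a ` ?S k. \<Prod>i\<in>I. \<kappa> i)"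
    unfolding esym_def by (simp add: sum.union_disjoint)
  also have "(\<Sum>I\<in>insert a ` ?S k. \<Prod>i\<in>I. \<kappa> i) = (\<Sum>I\<in>?S k. \<Prod>i\<in>insert a I. \<kappa> i)"
    using A by (subst sum.reindex) (auto intro!: inj_onI)
  also have "\<dots> = (\<Sum>I\<in>?S k. \<kappa> a * (\<Prod>i\<in>I. \<kappa> i))"
    using A fin by (intro sum.cong refl) (auto intro!: prod.insert)
  finally show ?thesis by (simp add: esym_def sum_distrib_left)
qed

lemma esym_1: "finite A \<Longrightarrow> esym 1 \<kappa> A = (\<Sum>i\<in>A. \<kappa> i)"
  by (induction rule: finite_induct) (simp_all add: esym_insert esym_empty esym_0)

lemma newton_identity_2:
  assumes "finite A"
  shows "2 * esym 2 \<kappa> A = (\<Sum>i\<in>A. \<kappa> i)\<^sup>2 - (\<Sum>i\<in>A. (\<kappa> i)\<^sup>2)"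
  using assms
proof induction
  case (insert a A)
  have "esym 2 \<kappa> (insert a A) = esym 2 \<kappa> A + \<kappa> a * (\<Sum>i\<in>A. \<kappa> i)"
    using esym_insert[OF insert(1,2), of 1] esym_1[OF insert(1)] by (simp add: numeral_2_eq_2)
  then show ?case using insert by (simp add: power2_eq_square algebra_simps)
qed (simp add: numeral_2_eq_2 esym_empty)

lemma newton_identity_3:
  assumes "finite A"
  shows "6 * esym 3 \<kappa> A = (\<Sum>i\<in>A. \<kappa> i) ^ 3 - 3 * (\<Sum>i\<in>A. \<kappa> i) * (\<Sum>i\<in>A. (\<kappa> i)\<^sup>2) + 2 * (\<Sum>i\<in>A. \<kappa> i ^ 3)"
  using assms
proof induction
  case (insert a A)
  have "esym 3 \<kappa> (insert a A) = esym 3 \<kappa> A + \<kappa> a * esym 2 \<kappa> A"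
    using esym_insert[OF insert(1,2), of 2] by (simp add: numeral_3_eq_3 numeral_2_eq_2)
  then have "6 * esym 3 \<kappa> (insert a A) = 6 * esym 3 \<kappa> A + 3 * \<kappa> a * (2 * esym 2 \<kappa> A)"
    by simp
  then show ?case
    using insert by (simp only: newton_identity_2[OF insert(1)] insert.IH sum.insert[OF insert(1,2)])
      (simp add: power2_eq_square power3_eq_cube algebra_simps)
qed (simp add: numeral_3_eq_3 esym_empty)

context hypersurface begin

text \<open>When the principal curvatures sum to 0, Newton's third identity reduces to 6 e_3 = 2
  p_3; this is the origin of the factor 3. The bound n \<ge> 3 makes the normalizing binomial
  coefficient nonzero.\<close>

lemma trace_A3_third_mean_curvature:
  assumes p: "p \<in> M" and h0: "HH p = 0" and n: "CARD('n) \<ge> 3"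
  shows "trace_A3 \<A> x \<nu> p = 3 * real (CARD('n) choose 3) * third_mean_curvature \<A> x \<nu> p"
proof -
  obtain U \<phi> where pa: "param_at \<A> p = (U, \<phi>)" and c: "(U, \<phi>) \<in> \<A>" and u: "coord_at \<A> p \<in> U" and e: "\<phi> (coord_at \<A> p) = p"
    by (rule param_at[OF p])
  define u where "u = coord_at \<A> p"
  have u: "u \<in> U" and e: "\<phi> u = p" using u e by (auto simp: u_def)
  have lr: "local_rep \<A> F p = F \<circ> \<phi>" for F :: "'m \<Rightarrow> 'v" by (simp add: local_rep_def pa)
  interpret patch U "x \<circ> \<phi>" "\<nu> \<circ> \<phi>" using c by (rule chart_patch)
  define \<kappa> where "\<kappa> = principal_curvatures \<A> x \<nu> p"
  have "\<exists>Eb. (\<forall>i j. frechet_derivative (x \<circ> \<phi>) (at u) (Eb i) \<bullet> frechet_derivative (x \<circ> \<phi>) (at u) (Eb j)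
                 = (if i = j then 1 else 0)) \<and>
          (\<forall>i. shape_op (x \<circ> \<phi>) (\<nu> \<circ> \<phi>) u (Eb i) = \<kappa> i *\<^sub>R Eb i)"
    unfolding \<kappa>_def principal_curvatures_def Let_def lr u_def[symmetric]
    by (rule someI_ex[OF principal_basis_exists[OF u]])
  then obtain Eb where "\<forall>i j. frechet_derivative (x \<circ> \<phi>) (at u) (Eb i) \<bullet> frechet_derivative (x \<circ> \<phi>) (at u) (Eb j)
                 = (if i = j then 1 else 0)" "\<forall>i. shape_op (x \<circ> \<phi>) (\<nu> \<circ> \<phi>) u (Eb i) = \<kappa> i *\<^sub>R Eb i"
    by blast
  note tr = trace_eigenvalues[OF u this]
  have "trace_A3 \<A> x \<nu> p = (\<Sum>i\<in>UNIV. \<kappa> i ^ 3)"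
    using trace_shape_op3[OF u] tr(2) by (simp add: trace_A3_def lr u_def[symmetric])
  moreover have "(\<Sum>i\<in>UNIV. \<kappa> i) = 0"
    using tr(1) h0 chart_values(1)[OF c u] e by simp
  ultimately have "6 * esym 3 \<kappa> UNIV = 2 * trace_A3 \<A> x \<nu> p"
    using newton_identity_3[of UNIV \<kappa>] by simp
  moreover have "third_mean_curvature \<A> x \<nu> p = esym 3 \<kappa> UNIV / real (CARD('n) choose 3)"
    by (simp add: third_mean_curvature_def esym_def \<kappa>_def)
  moreover have "real (CARD('n) choose 3) \<noteq> 0" using n by (simp add: binomial_eq_0_iff)
  ultimately show ?thesis by simp
qed

end

section \<open>The integral identities assembled\<close>

context hypersurface begin

lemma C0_const [simp]: "C0 (\<lambda>_. c)"
  by (simp add: C0_def comp_def)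

lemma C0_add: "C0 F \<Longrightarrow> C0 G \<Longrightarrow> C0 (\<lambda>p. F p + G p)"
  and C0_diff: "C0 F \<Longrightarrow> C0 G \<Longrightarrow> C0 (\<lambda>p. F p - G p)"
  and C0_mult: "C0 F \<Longrightarrow> C0 G \<Longrightarrow> C0 (\<lambda>p. F p * G p)"
  and C0_power: "C0 F \<Longrightarrow> C0 (\<lambda>p. F p ^ k)"
  and C0_divide_const: "C0 F \<Longrightarrow> C0 (\<lambda>p. F p / c)"
  unfolding C0_def comp_def by (auto intro!: continuous_intros simp: divide_inverse)

lemmas C0_intros = C0_const C0_add C0_diff C0_mult C0_power C0_divide_const
  C1_C0[OF C1_phi] C1_C0[OF C1_psi] C1_C0[OF C1_HH] C1_C0[OF C1_SS] C0_divg

lemma integral_cong_M: "(\<And>p. p \<in> M \<Longrightarrow> F p = G p) \<Longrightarrow> integral\<^sup>L vol F = integral\<^sup>L vol (G :: 'm \<Rightarrow> real)"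
  by (rule Bochner_Integration.integral_cong) (simp_all add: space_vol)

lemma C1_phi_TT: "C1 (\<lambda>p. (x p \<bullet> a) *\<^sub>R TT a p)" and C1_phi_ZZ: "C1 (\<lambda>p. (x p \<bullet> a) *\<^sub>R ZZ a p)"
  by (rule C1_scaleR[OF C1_phi C1_TT], rule C1_scaleR[OF C1_phi C1_ZZ])

lemma integral_divg_fields:
  shows "integral\<^sup>L vol (divg (\<lambda>p. (x p \<bullet> a) *\<^sub>R TT a p)) = 0"
    and "integral\<^sup>L vol (divg (\<lambda>p. (\<nu> p \<bullet> a) *\<^sub>R (QQ a p - HH p *\<^sub>R TT a p))) = 0"
    and "integral\<^sup>L vol (divg (\<lambda>p. (x p \<bullet> a) *\<^sub>R ZZ a p)) = 0"
  by (rule integral_divg; simp add: C1_phi_TT C1_QQ_TT C1_phi_ZZ tangential inner_diff_left)+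

lemma rho_eq:
  assumes p: "p \<in> M" and n: "CARD('n) \<ge> 3"
  shows "normalized_scalar_curvature \<A> x p - 1 = ((HH p)\<^sup>2 - SS p) / (real CARD('n) * (real CARD('n) - 1))"
  using n by (simp add: normalized_scalar_curvature_def pointwise(3)[OF p] divide_simps)

lemma integral_traceless_ricci:
  assumes n: "CARD('n) \<ge> 3" and a: "a \<in> sphere 0 1"
  shows "(\<integral>p. traceless_ricci_tangent \<A> x a p \<partial>vol) = (real CARD('n) - 1) *
    ((\<integral>p. 1 - (real CARD('n) + 1) * (x p \<bullet> a)\<^sup>2 - (\<nu> p \<bullet> a)\<^sup>2 \<partial>vol) -
     (\<integral>p. (normalized_scalar_curvature \<A> x p - 1) * (1 - (x p \<bullet> a)\<^sup>2 - (real CARD('n) + 1) * (\<nu> p \<bullet> a)\<^sup>2) \<partial>vol))"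
proof (cases rule: volume_cases)
  case 1
  define n' where "n' = real CARD('n)"
  have n': "n' > 1" using n by (simp add: n'_def)
  have a1: "a \<bullet> a = 1" using a by (simp add: norm_eq_1)
  define X where "X p = 1 - (n' + 1) * (x p \<bullet> a)\<^sup>2 - (\<nu> p \<bullet> a)\<^sup>2" for p
  define Y where "Y p = ((HH p)\<^sup>2 - SS p) / (n' * (n' - 1)) * (1 - (x p \<bullet> a)\<^sup>2 - (n' + 1) * (\<nu> p \<bullet> a)\<^sup>2)" for p
  let ?d1 = "divg (\<lambda>p. (x p \<bullet> a) *\<^sub>R TT a p)"
  let ?d2 = "divg (\<lambda>p. (\<nu> p \<bullet> a) *\<^sub>R (QQ a p - HH p *\<^sub>R TT a p))"
  \<comment> \<open>In this combination the divergence \<open>?d2\<close> removes the quadratic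
    expression in \<open>QQ\<close>, and n - 1 copies of \<open>?d1\<close> cancel the mixed terms
    in \<open>HH\<close> that \<open>?d2\<close> introduces.\<close>
  have "traceless_ricci_tangent \<A> x a p = (n' - 1) * (X p - Y p) - ?d2 p - (n' - 1) * ?d1 p" if p: "p \<in> M" for p
  proof -
    \<comment> \<open>Both R/n - (n - 1) and (n - 1)(\<rho> - 1) equal this number, so it links the
      traceless Ricci term to the right side of the criterion.\<close>
    define c where "c = ((HH p)\<^sup>2 - SS p) / n'"
    have K: "(HH p)\<^sup>2 - SS p = n' * c" using n' by (simp add: c_def)
    have "scalar_curvature \<A> x p = n' * (n' - 1 + c)"
      using K by (simp add: pointwise(3)[OF p] n'_def[symmetric] algebra_simps)
    then have R: "scalar_curvature \<A> x p / n' = n' - 1 + c" using n' by simp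
    have Y: "(n' - 1) * Y p = c * (1 - (x p \<bullet> a)\<^sup>2 - (n' + 1) * (\<nu> p \<bullet> a)\<^sup>2)"
      using n' by (simp add: Y_def K)
    show ?thesis
      unfolding pointwise(4)[OF p a1] divg_phi_TT[OF a1 p] divg_psi_QQ_TT[OF p] n'_def[symmetric]
        right_diff_distrib[of "n' - 1" "X p"] K R Y
      by (simp add: X_def algebra_simps)
  qed
  then have "(\<integral>p. traceless_ricci_tangent \<A> x a p \<partial>vol) = (\<integral>p. (n' - 1) * (X p - Y p) - ?d2 p - (n' - 1) * ?d1 p \<partial>vol)"
    by (rule integral_cong_M)
  also have "\<dots> = (n' - 1) * (integral\<^sup>L vol X - integral\<^sup>L vol Y) - integral\<^sup>L vol ?d2 - (n' - 1) * integral\<^sup>L vol ?d1"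
  proof -
    have "integrable vol X" "integrable vol Y" "integrable vol ?d1" "integrable vol ?d2"
      unfolding X_def[abs_def] Y_def[abs_def]
      by (intro C0_integrable[OF 1] C0_intros C1_phi_TT C1_QQ_TT)+
    then show ?thesis by simp
  qed
  also have "integral\<^sup>L vol Y = (\<integral>p. (normalized_scalar_curvature \<A> x p - 1) * (1 - (x p \<bullet> a)\<^sup>2 - (n' + 1) * (\<nu> p \<bullet> a)\<^sup>2) \<partial>vol)"
    by (rule integral_cong_M) (simp add: Y_def rho_eq[OF _ n] n'_def)
  finally show ?thesis by (simp add: integral_divg_fields X_def[abs_def] n'_def)
qed (simp add: integral_vol_zero)

context
  assumes n: "CARD('n) \<ge> 3" and minimal: "minimal_hypersurface M \<A> x \<nu>"
begin

lemma HH_zero: "p \<in> M \<Longrightarrow> HH p = 0"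
  using minimal by (simp add: minimal_hypersurface_def pointwise(1))

lemma integral_minimal:
  assumes a: "a \<in> sphere 0 1"
  shows "(\<integral>p. 1 - (real CARD('n) + 1) * (x p \<bullet> a)\<^sup>2 - (\<nu> p \<bullet> a)\<^sup>2 \<partial>vol) = 0"
proof -
  have a1: "a \<bullet> a = 1" using a by (simp add: norm_eq_1)
  have "integral\<^sup>L vol (divg (\<lambda>p. (x p \<bullet> a) *\<^sub>R TT a p)) =
      (\<integral>p. 1 - (real CARD('n) + 1) * (x p \<bullet> a)\<^sup>2 - (\<nu> p \<bullet> a)\<^sup>2 \<partial>vol)"
    by (rule integral_cong_M) (simp add: divg_phi_TT[OF a1] HH_zero)
  then show ?thesis by (simp add: integral_divg_fields)
qed

text \<open>For minimal M one side of the general criterion is the integral of the divergence of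
  \<phi>_a a^T and vanishes; on the other, \<rho> - 1 is -S/(n(n-1)).\<close>

lemma integral_traceless_ricci_minimal:
  assumes a: "a \<in> sphere 0 1"
  shows "real CARD('n) * (\<integral>p. traceless_ricci_tangent \<A> x a p \<partial>vol) =
    (\<integral>p. second_ff_sq \<A> x \<nu> p * (1 - (x p \<bullet> a)\<^sup>2 - (real CARD('n) + 1) * (\<nu> p \<bullet> a)\<^sup>2) \<partial>vol)"
proof -
  define n' where "n' = real CARD('n)"
  have n': "n' > 1" using n by (simp add: n'_def)
  let ?Y = "\<lambda>p. second_ff_sq \<A> x \<nu> p * (1 - (x p \<bullet> a)\<^sup>2 - (n' + 1) * (\<nu> p \<bullet> a)\<^sup>2)"
  have "(\<integral>p. (normalized_scalar_curvature \<A> x p - 1) * (1 - (x p \<bullet> a)\<^sup>2 - (n' + 1) * (\<nu> p \<bullet> a)\<^sup>2) \<partial>vol)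
      = (\<integral>p. (- 1 / (n' * (n' - 1))) * ?Y p \<partial>vol)"
    by (rule integral_cong_M) (simp add: rho_eq[OF _ n] HH_zero pointwise(2) n'_def)
  also have "\<dots> = (- 1 / (n' * (n' - 1))) * integral\<^sup>L vol ?Y"
    by (rule integral_mult_right_zero)
  finally have "(\<integral>p. traceless_ricci_tangent \<A> x a p \<partial>vol) = (n' - 1) * (1 / (n' * (n' - 1)) * integral\<^sup>L vol ?Y)"
    using integral_traceless_ricci[OF n a] integral_minimal[OF a] by (simp add: n'_def)
  then show ?thesis using n' by (simp add: n'_def[symmetric])
qed

text \<open>With \<open>S\<close> constant everything is linear in the volume and the integrals of
  \<phi>_a^2 and \<psi>_a^2. The first relation is \<open>integral_minimal\<close>; it eliminates
  \<psi>_a from the second. The third compares two divergences.\<close>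

lemma integrals_constant_S:
  assumes S: "\<forall>p\<in>M. second_ff_sq \<A> x \<nu> p = s" and a: "a \<in> sphere 0 1"
  shows "measure vol M = (real CARD('n) + 1) * (\<integral>p. (x p \<bullet> a)\<^sup>2 \<partial>vol) + (\<integral>p. (\<nu> p \<bullet> a)\<^sup>2 \<partial>vol)" (is ?A)
    and "(\<integral>p. traceless_ricci_tangent \<A> x a p \<partial>vol) = s * ((real CARD('n) + 2) * (\<integral>p. (x p \<bullet> a)\<^sup>2 \<partial>vol) - measure vol M)" (is ?B)
    and "(\<integral>p. (x p \<bullet> a) * (\<nu> p \<bullet> a) * trace_A3 \<A> x \<nu> p \<partial>vol) =
      s * ((\<integral>p. (x p \<bullet> a)\<^sup>2 \<partial>vol) - (\<integral>p. (\<nu> p \<bullet> a)\<^sup>2 \<partial>vol))" (is ?C)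
proof -
  have "?A \<and> ?B \<and> ?C"
  proof (cases rule: volume_cases)
    case 1
    interpret finite_measure vol using 1 by (rule finite_vol)
    define n' where "n' = real CARD('n)"
    have n': "n' > 1" using n by (simp add: n'_def)
    define I J where "I = (\<integral>p. (x p \<bullet> a)\<^sup>2 \<partial>vol)" and "J = (\<integral>p. (\<nu> p \<bullet> a)\<^sup>2 \<partial>vol)"
    have SS: "SS p = s" if "p \<in> M" for p using S pointwise(2)[OF that] that by simp
    have i: "integrable vol (\<lambda>p. (x p \<bullet> a)\<^sup>2)" "integrable vol (\<lambda>p. (\<nu> p \<bullet> a)\<^sup>2)"
      by (intro C0_integrable[OF 1] C0_intros)+
    have V: "(\<integral>p. 1 \<partial>vol) = measure vol M" by (simp add: space_vol)
    have m: "measure vol M - (n' + 1) * I - J = 0"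
      using integral_minimal[OF a] i by (simp add: V I_def J_def n'_def space_vol)
    have "n' * (\<integral>p. traceless_ricci_tangent \<A> x a p \<partial>vol) = (\<integral>p. s * (1 - (x p \<bullet> a)\<^sup>2 - (n' + 1) * (\<nu> p \<bullet> a)\<^sup>2) \<partial>vol)"
      unfolding n'_def integral_traceless_ricci_minimal[OF a] by (rule integral_cong_M) (simp add: S)
    also have "\<dots> = s * (measure vol M - I - (n' + 1) * J)"
      using i by (simp add: I_def J_def space_vol)
    also have "\<dots> = n' * (s * ((n' + 2) * I - measure vol M))"
    proof -
      \<comment> \<open>After eliminating \<open>J\<close> the coefficient of \<open>I\<close> is
        (n+1)^2 - 1 = n(n+2), so a common factor n splits off.\<close>
      have J: "J = measure vol M - (n' + 1) * I" using m by simp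
      show ?thesis unfolding J by (simp add: algebra_simps)
    qed
    finally have t: "(\<integral>p. traceless_ricci_tangent \<A> x a p \<partial>vol) = s * ((n' + 2) * I - measure vol M)"
      using n' by simp
    let ?d2 = "divg (\<lambda>p. (\<nu> p \<bullet> a) *\<^sub>R (QQ a p - HH p *\<^sub>R TT a p))"
    let ?d3 = "divg (\<lambda>p. (x p \<bullet> a) *\<^sub>R ZZ a p)"
    \<comment> \<open>Both divergences contain the squared length of \<open>QQ a p\<close>;
      subtracting them leaves the cubic term and multiples of \<phi>_a^2 and \<psi>_a^2.\<close>
    have "(\<integral>p. (x p \<bullet> a) * (\<nu> p \<bullet> a) * trace_A3 \<A> x \<nu> p \<partial>vol) =
       (\<integral>p. ?d3 p - ?d2 p + s * (x p \<bullet> a)\<^sup>2 - s * (\<nu> p \<bullet> a)\<^sup>2 \<partial>vol)"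
      by (rule integral_cong_M) (simp add: pointwise(5)[OF _ HH_zero SS] divg_psi_QQ_TT HH_zero SS mult.commute)
    also have "\<dots> = integral\<^sup>L vol ?d3 - integral\<^sup>L vol ?d2 + s * I - s * J"
    proof -
      have "integrable vol ?d2" "integrable vol ?d3"
        by (intro C0_integrable[OF 1] C0_divg C1_QQ_TT C1_phi_ZZ)+
      then show ?thesis using i by (simp add: I_def J_def)
    qed
    finally show ?thesis
      using m t by (simp add: integral_divg_fields I_def J_def n'_def right_diff_distrib)
  next
    case 2
    then show ?thesis by (simp add: integral_vol_zero measure_def)
  qed
  then show ?A ?B ?C by blast+
qed

end
end

theorem theorem2p2:
  fixes n :: nat
    and M :: "'m::t2_space set"
    and \<A> :: "('n::finite, 'm) param set"
    and x \<nu> :: "'m \<Rightarrow> 'v::euclidean_space"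
    and vol :: "'m measure"
    and H S \<rho> f3 :: "'m \<Rightarrow> real"
    and \<phi> \<psi> :: "'v \<Rightarrow> 'm \<Rightarrow> real"
  assumes n: "n = CARD('n)" "n \<ge> 3"
    and hyp: "closed_immersed_hypersurface M \<A> x \<nu>"
    and vol: "vol = riemannian_volume M \<A> x"
    and H: "H = mean_curvature \<A> x \<nu>"
    and S: "S = second_ff_sq \<A> x \<nu>"
    and rho: "\<rho> = normalized_scalar_curvature \<A> x"
    and f3: "f3 = trace_A3 \<A> x \<nu>"
    and phi: "\<phi> = (\<lambda>a p. x p \<bullet> a)"
    and psi: "\<psi> = (\<lambda>a p. \<nu> p \<bullet> a)"
  shows "(\<forall>p\<in>M. \<rho> p - 1 = (real n ^ 2 * H p ^ 2 - S p) / (real n * (real n - 1)))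
    \<and> (integral_einstein M \<A> x \<longleftrightarrow>
        (\<forall>a\<in>sphere 0 1.
          (\<integral>p. (1 - (real n + 1) * \<phi> a p ^ 2 - \<psi> a p ^ 2) \<partial>vol)
          = (\<integral>p. (\<rho> p - 1) * (1 - \<phi> a p ^ 2 - (real n + 1) * \<psi> a p ^ 2) \<partial>vol)))
    \<and> (minimal_hypersurface M \<A> x \<nu> \<longrightarrow>
        (integral_einstein M \<A> x \<longleftrightarrow>
          (\<forall>a\<in>sphere 0 1. (\<integral>p. S p * (1 - \<phi> a p ^ 2 - (real n + 1) * \<psi> a p ^ 2) \<partial>vol) = 0)))
    \<and> (\<forall>s>0. minimal_hypersurface M \<A> x \<nu> \<and> (\<forall>p\<in>M. S p = s) \<longrightarrow>
        (\<forall>a\<in>sphere 0 1.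
          (\<integral>p. traceless_ricci_tangent \<A> x a p \<partial>vol)
          = s * ((real n + 2) * (\<integral>p. \<phi> a p ^ 2 \<partial>vol) - measure vol M))
        \<and> (integral_einstein M \<A> x \<longleftrightarrow>
            (\<forall>a\<in>sphere 0 1. (\<integral>p. \<phi> a p ^ 2 \<partial>vol) = 1 / (real n + 2) * measure vol M))
        \<and> (integral_einstein M \<A> x \<longleftrightarrow>
            (\<forall>a\<in>sphere 0 1. (\<integral>p. \<psi> a p ^ 2 \<partial>vol) = 1 / (real n + 2) * measure vol M))
        \<and> (integral_einstein M \<A> x \<longleftrightarrow>
            (\<forall>a\<in>sphere 0 1. (\<integral>p. \<phi> a p ^ 2 \<partial>vol) = (\<integral>p. \<psi> a p ^ 2 \<partial>vol)))
        \<and> (integral_einstein M \<A> x \<longleftrightarrow>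
            (\<forall>a\<in>sphere 0 1. (\<integral>p. \<phi> a p * \<psi> a p * f3 p \<partial>vol) = 0))
        \<and> (\<forall>p\<in>M. f3 p = 3 * real (n choose 3) * third_mean_curvature \<A> x \<nu> p))"
proof -
  interpret hypersurface M \<A> x \<nu> using hyp by unfold_locales
  have n3: "CARD('n) \<ge> 3" using n by simp
  have IE: "integral_einstein M \<A> x \<longleftrightarrow> (\<forall>a\<in>sphere 0 1. (\<integral>p. traceless_ricci_tangent \<A> x a p \<partial>vol) = 0)"
    by (simp add: integral_einstein_def vol)
  show ?thesis
  proof (intro conjI allI impI)
    show "\<forall>p\<in>M. \<rho> p - 1 = (real n ^ 2 * H p ^ 2 - S p) / (real n * (real n - 1))"
      using n by (simp add: rho rho_eq[OF _ n3] H S pointwise(1,2) power_divide)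
    show "integral_einstein M \<A> x \<longleftrightarrow>
        (\<forall>a\<in>sphere 0 1.
          (\<integral>p. (1 - (real n + 1) * \<phi> a p ^ 2 - \<psi> a p ^ 2) \<partial>vol)
          = (\<integral>p. (\<rho> p - 1) * (1 - \<phi> a p ^ 2 - (real n + 1) * \<psi> a p ^ 2) \<partial>vol))"
      \<comment> \<open>The integral of the traceless Ricci term is n - 1 times the difference of
        the two sides, and n \<ge> 3 makes this factor nonzero.\<close>
      unfolding IE vol phi psi rho n(1)
      by (intro ball_cong refl) (use n in \<open>simp add: integral_traceless_ricci[OF n3] del: mem_sphere_0\<close>)
    show "integral_einstein M \<A> x \<longleftrightarrow>
          (\<forall>a\<in>sphere 0 1. (\<integral>p. S p * (1 - \<phi> a p ^ 2 - (real n + 1) * \<psi> a p ^ 2) \<partial>vol) = 0)"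
      if "minimal_hypersurface M \<A> x \<nu>"
      unfolding IE vol phi psi S n(1)
      by (intro ball_cong refl) (simp add: integral_traceless_ricci_minimal[OF n3 that, symmetric] del: mem_sphere_0)
  next
    fix s :: real assume s: "s > 0" and hs: "minimal_hypersurface M \<A> x \<nu> \<and> (\<forall>p\<in>M. S p = s)"
    then have minimal: "minimal_hypersurface M \<A> x \<nu>" and Ss: "\<forall>p\<in>M. second_ff_sq \<A> x \<nu> p = s"
      by (auto simp: S)
    note I = integrals_constant_S[OF n3 minimal Ss, folded vol n(1)]
    show "\<forall>a\<in>sphere 0 1. (\<integral>p. traceless_ricci_tangent \<A> x a p \<partial>vol)
          = s * ((real n + 2) * (\<integral>p. \<phi> a p ^ 2 \<partial>vol) - measure vol M)"
      unfolding phi using I(2) by blast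
    \<comment> \<open>Here s > 0 is used: the factor s in the integral formula can be
      cancelled.\<close>
    have t0: "(\<integral>p. traceless_ricci_tangent \<A> x a p \<partial>vol) = 0 \<longleftrightarrow> (real n + 2) * (\<integral>p. (x p \<bullet> a)\<^sup>2 \<partial>vol) = measure vol M"
      if "a \<in> sphere 0 1" for a
      unfolding I(2)[OF that] using s by simp
    show "integral_einstein M \<A> x \<longleftrightarrow>
            (\<forall>a\<in>sphere 0 1. (\<integral>p. \<phi> a p ^ 2 \<partial>vol) = 1 / (real n + 2) * measure vol M)"
      unfolding IE phi by (intro ball_cong refl) (simp only: t0, simp add: field_simps)
    show "integral_einstein M \<A> x \<longleftrightarrow>
            (\<forall>a\<in>sphere 0 1. (\<integral>p. \<psi> a p ^ 2 \<partial>vol) = 1 / (real n + 2) * measure vol M)"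
      unfolding IE psi
    proof (intro ball_cong refl)
      fix a :: 'v assume a: "a \<in> sphere 0 1"
      \<comment> \<open>The relation Vol = (n+1) I + J makes the defects of J and I proportional
        with the nonzero factor -(n+1), so they vanish together.\<close>
      have "(real n + 2) * (\<integral>p. (\<nu> p \<bullet> a)\<^sup>2 \<partial>vol) - measure vol M =
          - (real n + 1) * ((real n + 2) * (\<integral>p. (x p \<bullet> a)\<^sup>2 \<partial>vol) - measure vol M)"
        using I(1)[OF a] by (simp add: algebra_simps)
      then have "(real n + 2) * (\<integral>p. (\<nu> p \<bullet> a)\<^sup>2 \<partial>vol) = measure vol M \<longleftrightarrow>
          (real n + 2) * (\<integral>p. (x p \<bullet> a)\<^sup>2 \<partial>vol) = measure vol M"
        by (smt (verit) mult_eq_0_iff of_nat_0_le_iff)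
      then show "(\<integral>p. traceless_ricci_tangent \<A> x a p \<partial>vol) = 0 \<longleftrightarrow>
          (\<integral>p. (\<nu> p \<bullet> a)\<^sup>2 \<partial>vol) = 1 / (real n + 2) * measure vol M"
        unfolding t0[OF a] by (simp add: field_simps)
    qed
    \<comment> \<open>Substituting (n+1) I + J for the volume turns (n+2) I = Vol into I =
      J.\<close>
    have t1: "(\<integral>p. traceless_ricci_tangent \<A> x a p \<partial>vol) = 0 \<longleftrightarrow> (\<integral>p. (x p \<bullet> a)\<^sup>2 \<partial>vol) = (\<integral>p. (\<nu> p \<bullet> a)\<^sup>2 \<partial>vol)"
      if a: "a \<in> sphere 0 1" for a
      unfolding t0[OF a] I(1)[OF a] by (auto simp: algebra_simps)
    show "integral_einstein M \<A> x \<longleftrightarrow>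
            (\<forall>a\<in>sphere 0 1. (\<integral>p. \<phi> a p ^ 2 \<partial>vol) = (\<integral>p. \<psi> a p ^ 2 \<partial>vol))"
      unfolding IE phi psi by (intro ball_cong refl t1)
    show "integral_einstein M \<A> x \<longleftrightarrow>
            (\<forall>a\<in>sphere 0 1. (\<integral>p. \<phi> a p * \<psi> a p * f3 p \<partial>vol) = 0)"
      unfolding IE phi psi f3 by (intro ball_cong refl) (use s in \<open>simp only: t1 I(3), simp\<close>)
    show "\<forall>p\<in>M. f3 p = 3 * real (n choose 3) * third_mean_curvature \<A> x \<nu> p"
      unfolding f3 n(1) using trace_A3_third_mean_curvature[OF _ HH_zero[OF n3 minimal] n3] by blast
  qed
qed

end
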